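(* We have the following asymptotic results for $n$ uniform i.i.d. points on the circle in the limit when $n$ tends to infinity: 1. the asymptotic fraction of the number of regions of type $0$, $1$ and $2$ is respectively $\tfrac14$, $\tfrac12$ and $\tfrac14$; 2. the asymptotic fraction of the length covered by regions of type $0$, $1$ and $2$ is respectively $\tfrac18$, $\tfrac12$ and $\tfrac38$; 3. the asymptotic fraction of the length covered by empty regions is $\tfrac38$.
   Context: Let $n\ge3$. Select $n$ i.i.d. points uniformly at random on the unit circle and label them $P_1,\ldots,P_n$ in counterclockwise cyclic order. For $1\le i\le n$ consider the perpendicular bisector of $[P_i,P_{i+1}]$ (indices modulo $n$). Almost surely these $n$ lines are pairwise distinct and contain none of the points; they all pass through the center of the circle and divide the plane into $2n$ regions. The antipodal region of a region is its image under $z\mapsto -z$. For $k\in\{0,1,2\}$, a region is of type $k$ if the total number of points $P_j$ contained in the union of the region with its antipodal region is $k$. A region is empty if it contains no point $P_j$. The length of a region is the length of the arc of the circle contained in it, with distances rescaled so that the total length of the circle is $1$. The fraction of the number of regions of type $k$ is the number of regions of type $k$ divided by the total number $2n$ of regions; the fraction of the length covered by regions of type $k$ (respectively by empty regions) is the sum of the lengths of all regions of type $k$ (respectively of all empty regions). *)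

theory Defs
  imports "HOL-Probability.Probability"
begin

definition uniform_circle :: "complex measure" where
  "uniform_circle = distr (uniform_measure lborel {0..<1}) borel (\<lambda>t. cis (2 * pi * t))"

definition arc_length :: "complex set \<Rightarrow> real" where
  "arc_length R = measure lborel {t \<in> {0..<1}. cis (2 * pi * t) \<in> R}"

text \<open>The points \<^term>\<open>x i\<close>, \<^term>\<open>i < n\<close>, relabelled in counterclockwise order, with indices
  read modulo \<^term>\<open>n\<close>. The labelling starts at angle 0; another starting point shifts the labels
  cyclically, which changes none of the notions below.\<close>

definition cyclic_label :: "nat \<Rightarrow> (nat \<Rightarrow> complex) \<Rightarrow> nat \<Rightarrow> complex" where
  "cyclic_label n x i = sort_key Arg2pi (map x [0..<n]) ! (i mod n)"

definition perp_bisector :: "complex \<Rightarrow> complex \<Rightarrow> complex set" where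
  "perp_bisector a b = {z. dist z a = dist z b}"

definition regions :: "nat \<Rightarrow> (nat \<Rightarrow> complex) \<Rightarrow> complex set set" where
  "regions n x =
     components (- (\<Union>i<n. perp_bisector (cyclic_label n x i) (cyclic_label n x (i + 1))))"

definition region_type :: "nat \<Rightarrow> (nat \<Rightarrow> complex) \<Rightarrow> complex set \<Rightarrow> nat" where
  "region_type n x R = card {j. j < n \<and> x j \<in> R \<union> uminus ` R}"

definition empty_region :: "nat \<Rightarrow> (nat \<Rightarrow> complex) \<Rightarrow> complex set \<Rightarrow> bool" where
  "empty_region n x R \<longleftrightarrow> (\<forall>j<n. x j \<notin> R)"

definition number_fraction :: "nat \<Rightarrow> nat \<Rightarrow> (nat \<Rightarrow> complex) \<Rightarrow> real" where
  "number_fraction k n x = real (card {R \<in> regions n x. region_type n x R = k}) / real (2 * n)"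

definition length_fraction :: "nat \<Rightarrow> nat \<Rightarrow> (nat \<Rightarrow> complex) \<Rightarrow> real" where
  "length_fraction k n x = (\<Sum>R\<in>{R \<in> regions n x. region_type n x R = k}. arc_length R)"

definition empty_length_fraction :: "nat \<Rightarrow> (nat \<Rightarrow> complex) \<Rightarrow> real" where
  "empty_length_fraction n x = (\<Sum>R\<in>{R \<in> regions n x. empty_region n x R}. arc_length R)"

text \<open>Convergence in probability to a constant, for variables on possibly different probability
  spaces. The exceptional set is covered by an event \<^term>\<open>E\<close> because \<^const>\<open>measure\<close> is 0 on
  non-measurable sets; for measurable \<^term>\<open>Y n\<close> this is the usual
  \<open>P(|Y n - c| > \<epsilon>) \<longrightarrow> 0\<close>.\<close>

definition tendsto_in_prob :: "(nat \<Rightarrow> 'a measure) \<Rightarrow> (nat \<Rightarrow> 'a \<Rightarrow> real) \<Rightarrow> real \<Rightarrow> bool" where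
  "tendsto_in_prob M Y c \<longleftrightarrow>
     (\<forall>\<epsilon>>0. \<forall>\<delta>>0. \<forall>\<^sub>F n in sequentially.
        \<exists>E \<in> sets (M n). {\<omega> \<in> space (M n). \<bar>Y n \<omega> - c\<bar> > \<epsilon>} \<subseteq> E \<and> measure (M n) E < \<delta>)"

end

theory Submission
  imports Defs "HOL-Real_Asymp.Real_Asymp"
begin

text \<open>The region of a point \<open>z\<close> is determined by the sample point \<open>p\<close> nearest to \<open>z\<close> and the sample
  point \<open>q\<close> nearest to \<open>- z\<close>: a consecutive pair equidistant from \<open>z\<close> would be nearest to \<open>z\<close> or
  to \<open>- z\<close>. Writing \<open>f p\<close> for the point nearest to \<open>- p\<close>, the type of this region is the number of
  true statements among \<open>f p = q\<close> and \<open>f q = p\<close>, and the region is empty iff \<open>f p \<noteq> q\<close>. Hence the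
  regions of type 2 correspond to the points with \<open>f (f p) = p\<close>, and since there are \<open>2 n\<close> regions,
  the number of such points determines all three counts. The lengths are split into four classes
  according to the truth values of \<open>f p = q\<close> and \<open>f q = p\<close>.

  All these functionals concentrate by the variance bound for functions with bounded differences, so
  only expectations are needed. For the four lengths one may restrict to points \<open>p\<close>, \<open>q\<close> in a window
  of width about \<open>n powr (- 3/4)\<close>: this gives lower bounds whose limits add up to 1, and the lengths
  add up to at most 1. The expectations are integrals over the displacements \<open>u\<close> of \<open>p\<close> from \<open>z\<close>
  and \<open>v\<close> of \<open>q\<close> from \<open>- z\<close> of \<open>(1 - S u v) ^ (n - 2)\<close>, where \<open>S u v\<close> is the length of the set
  that the other points avoid; after scaling they converge to integrals of \<open>exp (- S u v)\<close>.\<close>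

section \<open>Bounded differences\<close>

text \<open>The window reconciles two demands. Without it, moving one point may reclassify a long
  arc, so the lengths have no small bounded differences. With half-width \<open>w\<close> the change
  is at most \<open>24 * w\<close>, and the variance bound \<open>n * (24 * w)\<^sup>2\<close>
  vanishes in the limit when \<open>w\<close> is much smaller than \<open>n powr (- 1/2)\<close>.
  The expectations keep their full limit only when \<open>n * w\<close> tends to infinity. The
  exponent \<open>- 3/4\<close> lies between \<open>- 1\<close> and \<open>- 1/2\<close>. The number
  of mutual pairs allows a fixed window, since a moved point changes it by a bounded amount. The
  probability of a configuration is a power only if all other points have to avoid one set. This is
  so when \<open>f p = q\<close> and \<open>f q = p\<close> are each required or left open, but not
  when one of them is forbidden. Inclusion-exclusion turns the limits 1, 5/8, 5/8, 3/8 of the former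
  kind into the class lengths 1/8, 1/4, 1/4, 3/8. The fractions themselves are compared with
  measurable functionals outside an event of small probability, so their own measurability never
  enters.\<close>

lemma oscillation_variance:
  fixes g :: "'a \<Rightarrow> real"
  assumes N: "prob_space N" and [measurable]: "g \<in> borel_measurable N"
    and B: "\<And>x. x \<in> space N \<Longrightarrow> \<bar>g x\<bar> \<le> B"
    and c: "\<And>x y. x \<in> space N \<Longrightarrow> y \<in> space N \<Longrightarrow> \<bar>g x - g y\<bar> \<le> c"
  shows "(\<integral>x. (g x)\<^sup>2 \<partial>N) \<le> (\<integral>x. g x \<partial>N)\<^sup>2 + c\<^sup>2"
proof -
  interpret prob_space N by fact
  have ig: "integrable N g"
    using B by (intro integrable_const_bound[where B=B]) auto
  have ig2: "integrable N (\<lambda>x. (g x)\<^sup>2)"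
  proof (intro integrable_const_bound[where B="B\<^sup>2"])
    show "AE x in N. norm ((g x)\<^sup>2) \<le> B\<^sup>2"
      using B by (auto intro!: AE_I2 simp: abs_le_square_iff[symmetric] intro: order_trans[OF B])
  qed simp
  define m where "m = (\<integral>x. g x \<partial>N)"
  have dev: "\<bar>g x - m\<bar> \<le> c" if x: "x \<in> space N" for x
  proof -
    have "g x - c \<le> g y" "g y \<le> g x + c" if "y \<in> space N" for y
      using c[OF x that] by auto
    then have "g x - c \<le> m" and "m \<le> g x + c"
      using ig unfolding m_def by (auto intro!: integral_ge_const integral_le_const)
    then show ?thesis by (simp add: abs_le_iff)
  qed
  have "(\<integral>x. (g x)\<^sup>2 \<partial>N) - m\<^sup>2 = (\<integral>x. (g x - m)\<^sup>2 \<partial>N)"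
    using variance_eq[OF ig ig2] by (simp add: m_def)
  also have "\<dots> \<le> c\<^sup>2"
  proof (intro integral_le_const AE_I2)
    show "integrable N (\<lambda>x. (g x - m)\<^sup>2)"
      using ig ig2 by (simp add: power2_diff)
    show "(g x - m)\<^sup>2 \<le> c\<^sup>2" if "x \<in> space N" for x
      using dev[OF that] by (auto simp: abs_le_square_iff[symmetric])
  qed
  finally show ?thesis by (simp add: m_def)
qed

text \<open>Coordinates are integrated out one at a time. The average \<open>g\<close> over the new
  coordinate keeps the bound \<open>B\<close> and the differences \<open>c\<close> in the remaining
  coordinates, and \<open>oscillation_variance\<close> charges \<open>c\<^sup>2\<close> for
  replacing \<open>f\<close> by \<open>g\<close>. Stated for second moments, the inductive
  hypothesis applies to \<open>g\<close> directly.\<close>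

lemma bounded_differences_variance:
  fixes f :: "('i \<Rightarrow> 'a) \<Rightarrow> real"
  assumes N: "prob_space N" and I: "finite I"
    and f: "f \<in> borel_measurable (PiM I (\<lambda>_. N))"
    and B: "\<And>x. x \<in> space (PiM I (\<lambda>_. N)) \<Longrightarrow> \<bar>f x\<bar> \<le> B"
    and c: "\<And>x i y. x \<in> space (PiM I (\<lambda>_. N)) \<Longrightarrow> i \<in> I \<Longrightarrow> y \<in> space N \<Longrightarrow> \<bar>f (x(i := y)) - f x\<bar> \<le> c"
  shows "(\<integral>x. (f x)\<^sup>2 \<partial>PiM I (\<lambda>_. N)) \<le> (\<integral>x. f x \<partial>PiM I (\<lambda>_. N))\<^sup>2 + real (card I) * c\<^sup>2"
  using I f B c
proof (induction I arbitrary: f)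
  case empty
  interpret product_prob_space "\<lambda>_. N" "{}::'i set"
    using N by (simp add: product_prob_spaceI)
  show ?case by (simp add: PiM_empty lebesgue_integral_count_space_finite)
next
  case (insert i I)
  interpret N: prob_space N by fact
  interpret P: product_prob_space "\<lambda>_. N" I
    using N by (simp add: product_prob_spaceI)
  let ?P = "PiM I (\<lambda>_. N)"
  let ?Q = "PiM (insert i I) (\<lambda>_. N)"
  interpret Q: prob_space ?Q using N by (intro prob_space_PiM)
  have [measurable]: "f \<in> borel_measurable ?Q" by (rule insert.prems)
  have upd[measurable]: "(\<lambda>(x, y). x(i := y)) \<in> measurable (?P \<Otimes>\<^sub>M N) ?Q"
    by (rule measurable_add_dim)
  have upd': "(\<lambda>p. f ((fst p)(i := snd p))) \<in> borel_measurable (?P \<Otimes>\<^sub>M N)"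
    using measurable_compose[OF upd, of f borel] by (simp add: case_prod_beta')
  have spQ: "x(i := y) \<in> space ?Q" if "x \<in> space ?P" "y \<in> space N" for x y
    using that by (auto simp: space_PiM PiE_iff extensional_def)
  have fx[measurable]: "(\<lambda>y. f (x(i := y))) \<in> borel_measurable N" if "x \<in> space ?P" for x
    using measurable_compose[OF measurable_Pair1'[OF that] upd'] by simp
  define g where "g x = (\<integral>y. f (x(i := y)) \<partial>N)" for x
  have g[measurable]: "g \<in> borel_measurable ?P"
    unfolding g_def by (rule N.borel_measurable_lebesgue_integral) (use upd' in \<open>simp add: case_prod_beta'\<close>)
  have if1: "integrable ?Q f"
    using insert.prems(2) by (intro Q.integrable_const_bound[where B=B]) auto
  have B2: "(f x)\<^sup>2 \<le> B\<^sup>2" if "x \<in> space ?Q" for x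
    using insert.prems(2)[OF that] by (auto simp: abs_le_square_iff[symmetric] intro: order_trans)
  have if2: "integrable ?Q (\<lambda>x. (f x)\<^sup>2)"
    using B2 by (intro Q.integrable_const_bound[where B="B\<^sup>2"] AE_I2) auto
  have fB: "\<bar>f (x(i := y))\<bar> \<le> B" "(f (x(i := y)))\<^sup>2 \<le> B\<^sup>2"
    if "x \<in> space ?P" "y \<in> space N" for x y
    by (rule insert.prems(2)[OF spQ[OF that]], rule B2[OF spQ[OF that]])
  have ifx: "integrable N (\<lambda>y. f (x(i := y)))" if "x \<in> space ?P" for x
    by (rule N.integrable_const_bound[where B=B]) (auto intro!: AE_I2 fB that fx)
  have gB: "\<bar>g x\<bar> \<le> B" if x: "x \<in> space ?P" for x
    unfolding g_def by (rule order_trans[OF integral_abs_bound], rule N.integral_le_const)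
      (auto intro!: AE_I2 fB x ifx integrable_abs)
  have gc: "\<bar>g (x(j := z)) - g x\<bar> \<le> c" if x: "x \<in> space ?P" and j: "j \<in> I" and z: "z \<in> space N" for x j z
  proof -
    have x': "x(j := z) \<in> space ?P" using x j z by (auto simp: space_PiM PiE_iff extensional_def)
    have ij: "i \<noteq> j" using j insert.hyps by auto
    have d: "\<bar>f (x(j := z, i := y)) - f (x(i := y))\<bar> \<le> c" if "y \<in> space N" for y
      unfolding fun_upd_twist[OF ij[symmetric]]
      by (rule insert.prems(3)[OF spQ[OF x that] _ z]) (use j in simp)
    have "g (x(j := z)) - g x = (\<integral>y. f (x(j := z, i := y)) - f (x(i := y)) \<partial>N)"
      unfolding g_def by (rule Bochner_Integration.integral_diff[symmetric, OF ifx[OF x'] ifx[OF x]])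
    also have "\<bar>\<dots>\<bar> \<le> c"
      by (rule order_trans[OF integral_abs_bound], rule N.integral_le_const)
        (auto intro!: AE_I2 d ifx x x' integrable_abs Bochner_Integration.integrable_diff)
    finally show ?thesis .
  qed
  have ig2: "integrable ?P (\<lambda>x. (g x)\<^sup>2)"
  proof (rule P.P.integrable_const_bound[where B="B\<^sup>2"])
    have "(g x)\<^sup>2 \<le> B\<^sup>2" if "x \<in> space ?P" for x
      using gB[OF that] by (auto simp: abs_le_square_iff[symmetric] intro: order_trans)
    then show "AE x in ?P. norm ((g x)\<^sup>2) \<le> B\<^sup>2"
      by (intro AE_I2) simp
  qed simp
  have "(\<integral>x. (f x)\<^sup>2 \<partial>?Q) = (\<integral>x. (\<integral>y. (f (x(i := y)))\<^sup>2 \<partial>N) \<partial>?P)"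
    by (rule P.product_integral_insert[OF insert.hyps if2])
  also have "\<dots> \<le> (\<integral>x. (g x)\<^sup>2 + c\<^sup>2 \<partial>?P)"
  proof (rule integral_mono)
    have "(\<lambda>x. \<integral>y. (f (x(i := y)))\<^sup>2 \<partial>N) \<in> borel_measurable ?P"
      by (rule N.borel_measurable_lebesgue_integral) (use upd' in \<open>simp add: case_prod_beta'\<close>)
    moreover have "\<bar>\<integral>y. (f (x(i := y)))\<^sup>2 \<partial>N\<bar> \<le> B\<^sup>2" if x: "x \<in> space ?P" for x
    proof -
      have "integrable N (\<lambda>y. (f (x(i := y)))\<^sup>2)"
        by (rule N.integrable_const_bound[where B="B\<^sup>2"]) (auto intro!: AE_I2 fB x borel_measurable_power fx)
      then show ?thesis
        by (intro order_trans[OF integral_abs_bound] N.integral_le_const) (auto intro!: AE_I2 fB x)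
    qed
    ultimately show "integrable ?P (\<lambda>x. \<integral>y. (f (x(i := y)))\<^sup>2 \<partial>N)"
      by (intro P.P.integrable_const_bound[where B="B\<^sup>2"] AE_I2) auto
    show "integrable ?P (\<lambda>x. (g x)\<^sup>2 + c\<^sup>2)"
      using ig2 by simp
    show "(\<integral>y. (f (x(i := y)))\<^sup>2 \<partial>N) \<le> (g x)\<^sup>2 + c\<^sup>2" if x: "x \<in> space ?P" for x
      unfolding g_def
    proof (rule oscillation_variance[where B=B, OF N])
      \<comment> \<open>Both arguments overwrite coordinate \<open>i\<close> of the same
        \<open>x\<close>, so the first is a single update of \<open>x(i := z)\<close>.\<close>
      show "\<bar>f (x(i := y)) - f (x(i := z))\<bar> \<le> c" if "y \<in> space N" "z \<in> space N" for y z
        using insert.prems(3)[OF spQ[OF x that(2)] insertI1 that(1)] unfolding fun_upd_upd .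
    qed (auto intro!: fB x fx)
  qed
  also have "\<dots> = (\<integral>x. (g x)\<^sup>2 \<partial>?P) + c\<^sup>2"
    using ig2 by (simp add: P.P.prob_space)
  also have "\<dots> \<le> (\<integral>x. g x \<partial>?P)\<^sup>2 + real (card I) * c\<^sup>2 + c\<^sup>2"
    using insert.IH[OF g gB gc] by simp
  also have "(\<integral>x. g x \<partial>?P) = (\<integral>x. f x \<partial>?Q)"
    unfolding g_def by (rule P.product_integral_insert[OF insert.hyps if1, symmetric])
  finally show ?case using insert.hyps by (simp add: algebra_simps)
qed

lemma bounded_differences_Chebyshev:
  fixes f :: "('i \<Rightarrow> 'a) \<Rightarrow> real"
  assumes N: "prob_space N" and I: "finite I"
    and f: "f \<in> borel_measurable (PiM I (\<lambda>_. N))"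
    and B: "\<And>x. x \<in> space (PiM I (\<lambda>_. N)) \<Longrightarrow> \<bar>f x\<bar> \<le> B"
    and c: "\<And>x i y. x \<in> space (PiM I (\<lambda>_. N)) \<Longrightarrow> i \<in> I \<Longrightarrow> y \<in> space N \<Longrightarrow> \<bar>f (x(i := y)) - f x\<bar> \<le> c"
    and a: "0 < a"
  shows "measure (PiM I (\<lambda>_. N)) {x \<in> space (PiM I (\<lambda>_. N)). a \<le> \<bar>f x - (\<integral>x. f x \<partial>PiM I (\<lambda>_. N))\<bar>}
    \<le> real (card I) * c\<^sup>2 / a\<^sup>2"
proof -
  let ?P = "PiM I (\<lambda>_. N)"
  interpret P: prob_space ?P using N by (intro prob_space_PiM)
  have B2: "(f x)\<^sup>2 \<le> B\<^sup>2" if "x \<in> space ?P" for x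
    using B[OF that] by (auto simp: abs_le_square_iff[symmetric] intro: order_trans)
  have i2: "integrable ?P (\<lambda>x. (f x)\<^sup>2)"
    using B2 f by (intro P.integrable_const_bound[where B="B\<^sup>2"] AE_I2) auto
  have i1: "integrable ?P f"
    using B f by (intro P.integrable_const_bound[where B=B] AE_I2) auto
  have "measure ?P {x \<in> space ?P. a \<le> \<bar>f x - (\<integral>x. f x \<partial>?P)\<bar>} \<le> P.variance f / a\<^sup>2"
    by (rule P.Chebyshev_inequality[OF f i2 a])
  also have "P.variance f \<le> real (card I) * c\<^sup>2"
    using bounded_differences_variance[OF N I f B c] by (simp add: P.variance_eq[OF i1 i2])
  finally show ?thesis using a by (simp add: divide_right_mono)
qed

section \<open>Regions as cells of nearest and farthest points\<close>

text \<open>Among unit vectors the one nearest to \<open>z\<close> maximises the inner product with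
  \<open>z\<close>, whatever the norm of \<open>z\<close>. The inequality is strict, so a tie for
  the maximum means that no nearest point exists.\<close>

definition nearest :: "nat \<Rightarrow> (nat \<Rightarrow> complex) \<Rightarrow> complex \<Rightarrow> nat \<Rightarrow> bool" where
  "nearest n x z p \<longleftrightarrow> p < n \<and> (\<forall>k<n. k \<noteq> p \<longrightarrow> inner z (x k) < inner z (x p))"

definition sector :: "nat \<Rightarrow> (nat \<Rightarrow> complex) \<Rightarrow> nat \<Rightarrow> nat \<Rightarrow> complex set" where
  "sector n x p q = {z. nearest n x z p \<and> nearest n x (- z) q}"

text \<open>Twice the signed area of the triangle \<open>a\<close>, \<open>b\<close>,
  \<open>c\<close>, positive in counterclockwise order.\<close>

definition orient :: "complex \<Rightarrow> complex \<Rightarrow> complex \<Rightarrow> real" where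
  "orient a b c = (Re b - Re a) * (Im c - Im a) - (Im b - Im a) * (Re c - Re a)"

lemma orient_rotate: "orient b c a = orient a b c"
  by (simp add: orient_def algebra_simps)

text \<open>The chords from \<open>a\<close> to \<open>c\<close> and from \<open>b\<close> to \<open>d\<close> of points in cyclic order cross; this identity says
  that a linear functional takes the same value at the crossing point on both chords.\<close>

lemma orient_inner:
  "orient b c d * (inner u a - inner u b) + orient a b d * (inner u c - inner u b) =
    orient a b c * (inner u d - inner u b)"
  by (simp add: orient_def inner_complex_def algebra_simps)

text \<open>In the half-angles \<open>A\<close> and \<open>B\<close> the doubled area factors as
  \<open>4 * sin A * sin B * sin (A + B)\<close>, and the hypotheses put \<open>A\<close>,
  \<open>B\<close> and \<open>A + B\<close> strictly between 0 and \<open>pi\<close>.\<close>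

lemma orient_cis_pos:
  assumes "\<alpha> < \<beta>" "\<beta> < \<gamma>" "\<gamma> < \<alpha> + 2 * pi"
  shows "0 < orient (cis \<alpha>) (cis \<beta>) (cis \<gamma>)"
proof -
  define A where "A = (\<beta> - \<alpha>) / 2"
  define B where "B = (\<gamma> - \<beta>) / 2"
  have \<beta>: "\<beta> = \<alpha> + 2 * A" and \<gamma>: "\<gamma> = \<alpha> + 2 * A + 2 * B"
    by (simp_all add: A_def B_def field_simps)
  have "orient (cis \<alpha>) (cis \<beta>) (cis \<gamma>) = sin (\<beta> - \<alpha>) + sin (\<gamma> - \<beta>) - sin (\<gamma> - \<alpha>)"
    by (simp add: orient_def sin_diff algebra_simps)
  also have "\<dots> = sin (2 * A) + sin (2 * B) - sin (2 * A + 2 * B)"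
    by (simp add: \<beta> \<gamma>)
  also have "\<dots> = sin (2 * A) * (1 - cos (2 * B)) + sin (2 * B) * (1 - cos (2 * A))"
    by (simp only: sin_add) algebra
  also have "\<dots> = 4 * sin A * sin B * sin (A + B)"
    unfolding cos_double_sin sin_double sin_add by (simp add: power2_eq_square algebra_simps)
  also have "\<dots> > 0"
    using assms by (intro mult_pos_pos sin_gt_zero) (auto simp: A_def B_def field_simps)
  finally show ?thesis .
qed

section \<open>The sample points as vertices of a convex polygon\<close>

locale circle_config =
  fixes n :: nat and x :: "nat \<Rightarrow> complex"
  assumes n: "3 \<le> n" and unit: "\<And>i. i < n \<Longrightarrow> norm (x i) = 1"
    and inj: "inj_on x {..<n}"
begin

abbreviation "y \<equiv> cyclic_label n x"

lemma label_set: "y ` {..<n} = x ` {..<n}"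
proof -
  have "y ` {..<n} = set (sort_key Arg2pi (map x [0..<n]))"
    unfolding cyclic_label_def set_conv_nth by auto
  also have "\<dots> = x ` {..<n}" by (simp add: atLeast0LessThan)
  finally show ?thesis .
qed

lemma label_inj: "inj_on y {..<n}"
proof -
  have "distinct (sort_key Arg2pi (map x [0..<n]))"
    using inj by (simp add: distinct_map atLeast0LessThan)
  then show ?thesis
    by (auto simp: inj_on_def cyclic_label_def nth_eq_iff_index_eq)
qed

lemma label_mod: "y (i mod n) = y i"
  by (simp add: cyclic_label_def)

lemma label_norm: "norm (y i) = 1"
proof -
  have "y (i mod n) \<in> x ` {..<n}" using n label_set by fastforce
  then show ?thesis using unit by (auto simp: label_mod)
qed

lemma label_arg_less:
  assumes "i < j" "j < n"
  shows "Arg2pi (y i) < Arg2pi (y j)"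
proof -
  have "sorted (map Arg2pi (sort_key Arg2pi (map x [0..<n])))" by simp
  then have "Arg2pi (y i) \<le> Arg2pi (y j)"
    using assms by (auto simp: sorted_iff_nth_mono cyclic_label_def)
  moreover have "y i \<noteq> y j"
    using assms label_inj by (auto dest: inj_onD)
  then have "Arg2pi (y i) \<noteq> Arg2pi (y j)"
    using Arg2pi_eq[of "y i"] Arg2pi_eq[of "y j"] label_norm[of i] label_norm[of j] by (metis of_real_1 mult_1)
  ultimately show ?thesis by simp
qed

lemma label_cis: "y i = cis (Arg2pi (y i))"
  using Arg2pi_eq[of "y i"] label_norm[of i] by (simp add: cis_conv_exp)

lemma orient_label:
  assumes "i < j" "j < k" "k < n"
  shows "0 < orient (y i) (y j) (y k)"
proof -
  have "Arg2pi (y k) < 2 * pi" "0 \<le> Arg2pi (y i)"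
    by (simp_all add: Arg2pi_lt_2pi Arg2pi_ge_0)
  then have "0 < orient (cis (Arg2pi (y i))) (cis (Arg2pi (y j))) (cis (Arg2pi (y k)))"
    using assms by (intro orient_cis_pos label_arg_less) auto
  then show ?thesis by (simp only: label_cis[symmetric])
qed

text \<open>Increasing labels are in counterclockwise order, so a cyclic rotation of the triple
  reduces every case, including the closing side from \<open>n - 1\<close> to 0, to
  \<open>orient_label\<close>. This is the convexity of the inscribed polygon.\<close>

lemma orient_consecutive:
  assumes "i < n" "k < n" "y k \<noteq> y i" "y k \<noteq> y (Suc i)"
  shows "0 < orient (y i) (y (Suc i)) (y k)"
proof (cases "Suc i < n")
  case True
  then have "k \<noteq> i" "k \<noteq> Suc i" using assms by auto
  then consider "k < i" | "Suc i < k" by linarith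
  then show ?thesis
  proof cases
    case 1 then show ?thesis
      using orient_label[of k i "Suc i"] True by (metis lessI orient_rotate)
  next
    case 2 then show ?thesis using orient_label[of i "Suc i" k] assms by simp
  qed
next
  case False
  then have i: "Suc i = n" using assms by simp
  then have [simp]: "y (Suc i) = y 0" by (metis label_mod mod_self)
  have "k \<noteq> 0" using assms(4) \<open>y (Suc i) = y 0\<close> by metis
  moreover have "k \<noteq> i" using assms(3) by metis
  ultimately have "0 < k" "k < i" using assms(2) i by auto
  then show ?thesis
    using orient_label[of 0 k i] assms(1) \<open>y (Suc i) = y 0\<close> by (metis orient_rotate)
qed

text \<open>A tie makes \<open>inner z\<close> constant along the line through the side, so all
  points to the left of that line have values on one side of the tied value. The maximiser
  \<open>x p\<close> and the minimiser \<open>x q\<close> both lie to the left, but their values lie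
  on opposite sides.\<close>

lemma sector_no_tie:
  assumes z: "z \<in> sector n x p q" and i: "i < n"
  shows "inner z (y i) \<noteq> inner z (y (Suc i))"
proof
  assume tie: "inner z (y i) = inner z (y (Suc i))"
  have p: "p < n" "q < n" using z by (auto simp: sector_def nearest_def)
  have max: "inner z v < inner z (x p)" if "v \<in> x ` {..<n}" "v \<noteq> x p" for v
    using that z by (auto simp: sector_def nearest_def)
  have min: "inner z v > inner z (x q)" if "v \<in> x ` {..<n}" "v \<noteq> x q" for v
    using that z by (auto simp: sector_def nearest_def)
  have "y i \<in> x ` {..<n}" using label_set i by blast
  moreover have "y (Suc i mod n) \<in> x ` {..<n}" using label_set n by fastforce
  ultimately have mem: "y i \<in> x ` {..<n}" "y (Suc i) \<in> x ` {..<n}" by (simp_all only: label_mod)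
  have "i \<noteq> Suc i mod n" using i n by (cases "Suc i < n") (auto simp: not_less le_Suc_eq)
  then have ne: "y i \<noteq> y (Suc i)"
    using label_inj i n label_mod[of "Suc i"] by (metis inj_onD lessThan_iff mod_less_divisor not_numeral_le_zero gr0I)
  have "x p \<noteq> y i" "x p \<noteq> y (Suc i)" "x q \<noteq> y i" "x q \<noteq> y (Suc i)"
    using max[OF mem(1)] max[OF mem(2)] min[OF mem(1)] min[OF mem(2)] tie ne by auto
  moreover obtain k l where kl: "k < n" "y k = x p" "l < n" "y l = x q"
    using label_set p by (metis imageE image_eqI lessThan_iff)
  ultimately have "0 < orient (y i) (y (Suc i)) (x p)" "0 < orient (y i) (y (Suc i)) (x q)"
    using orient_consecutive[OF i kl(1)] orient_consecutive[OF i kl(3)] by auto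
  moreover have "inner z (x q) < inner z (y i)" "inner z (y i) < inner z (x p)"
    using max[OF mem(1)] min[OF mem(1)] \<open>x p \<noteq> y i\<close> \<open>x q \<noteq> y i\<close> by auto
  \<comment> \<open>The tie kills the first term of \<open>orient_inner\<close>; the two remaining
    products have opposite signs.\<close>
  moreover have "orient (y i) (y (Suc i)) (x q) * (inner z (x p) - inner z (y i)) =
      orient (y i) (y (Suc i)) (x p) * (inner z (x q) - inner z (y i))"
    using orient_inner[of "y (Suc i)" "x p" "x q" z "y i"] tie by simp
  ultimately show False
    by (smt (verit) mult_pos_pos mult_pos_neg)
qed

text \<open>A maximum at the vertex \<open>k\<close> is strict against both neighbours because no
  side is tied. For any other vertex \<open>l\<close>, the chord joining the two neighbours crosses
  the chord from \<open>k\<close> to \<open>l\<close>. The value at the crossing is below the value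
  at \<open>k\<close>, hence so is the value at \<open>l\<close>.\<close>

lemma nearest_exists:
  assumes "\<And>i. i < n \<Longrightarrow> inner z (y i) \<noteq> inner z (y (Suc i))"
  shows "\<exists>p. nearest n x z p"
proof -
  let ?V = "(\<lambda>i. inner z (y i)) ` {..<n}"
  have V: "finite ?V" "?V \<noteq> {}" using n by (auto simp: lessThan_empty_iff)
  obtain k where k: "k < n" and Vk: "Max ?V = inner z (y k)" using Max_in[OF V] by auto
  have kmax: "inner z (y i) \<le> inner z (y k)" if "i < n" for i
    unfolding Vk[symmetric] using that by (intro Max_ge[OF V(1)]) auto
  define j where "j = (if k = 0 then n - 1 else k - 1)"
  have j: "j < n" "y (Suc j) = y k"
    using k n label_mod[of "Suc j"] label_mod[of k] by (auto simp: j_def)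
  have "y (Suc k mod n) = y (Suc k)" by (rule label_mod)
  then have lt: "inner z (y j) < inner z (y k)" "inner z (y (Suc k)) < inner z (y k)"
    using assms[OF j(1)] assms[OF k] kmax[OF j(1)] kmax[of "Suc k mod n"] j n by force+
  have strict: "inner z (y l) < inner z (y k)" if l: "l < n" "l \<noteq> k" for l
  proof (cases "y l = y j \<or> y l = y (Suc k)")
    case True then show ?thesis using lt by auto
  next
    case False
    have "y l \<noteq> y k" using l k label_inj by (auto dest: inj_onD)
    then have 1: "0 < orient (y j) (y k) (y l)" "0 < orient (y k) (y (Suc k)) (y l)"
      using orient_consecutive[OF j(1) l(1)] orient_consecutive[OF k l(1)] False j by auto
    have "y j \<noteq> y (Suc k)"
    proof -
      have "j \<noteq> Suc k mod n" using k n
        by (cases "Suc k = n") (auto simp: j_def)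
      then show ?thesis using label_inj j k n label_mod[of "Suc k"]
        by (metis inj_onD lessThan_iff mod_less_divisor not_numeral_le_zero gr0I)
    qed
    moreover have "y (Suc k mod n) = y (Suc k)" by (rule label_mod)
    moreover have "y (Suc k) \<noteq> y k" using lt(2) by (metis less_irrefl)
    ultimately have "0 < orient (y j) (y k) (y (Suc k))"
      using orient_consecutive[OF j(1), of "Suc k mod n"] lt j n by auto
    moreover have "orient (y k) (y (Suc k)) (y l) * (inner z (y j) - inner z (y k)) < 0"
      "orient (y j) (y k) (y l) * (inner z (y (Suc k)) - inner z (y k)) < 0"
      using 1 lt by (auto intro: mult_pos_neg)
    ultimately show ?thesis
      using orient_inner[of "y k" "y (Suc k)" "y l" z "y j"] by (smt (verit) mult_nonneg_nonneg)
  qed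
  obtain p where p: "p < n" "x p = y k" using label_set k by (metis imageE image_eqI lessThan_iff)
  have "inner z (x m) < inner z (x p)" if m: "m < n" "m \<noteq> p" for m
  proof -
    have "x m \<noteq> x p" using m p(1) inj_onD[OF inj, of m p] by auto
    moreover obtain l where "l < n" "x m = y l" using label_set m by (metis imageE image_eqI lessThan_iff)
    ultimately show ?thesis using strict[of l] p by auto
  qed
  then show ?thesis using p by (auto simp: nearest_def)
qed

section \<open>Sectors as connected components\<close>

lemma perp_bisector_iff: "z \<in> perp_bisector (y i) (y j) \<longleftrightarrow> inner z (y i) = inner z (y j)"
proof -
  have "(dist z (y i))\<^sup>2 = inner z z - 2 * inner z (y i) + 1" for i
    using label_norm[of i] by (simp add: dist_norm power2_norm_eq_inner inner_diff_left inner_diff_right inner_commute)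
       (simp add: power2_norm_eq_inner[symmetric])
  then have "dist z (y i) = dist z (y j) \<longleftrightarrow> inner z (y i) = inner z (y j)"
    by (smt (verit) power2_eq_iff_nonneg zero_le_dist)
  then show ?thesis by (simp add: perp_bisector_def)
qed

lemma open_sector: "open (sector n x p q)"
proof -
  \<comment> \<open>The factor \<open>c\<close> treats \<open>z\<close> and \<open>- z\<close>
    together, as \<open>c = 1\<close> and \<open>c = - 1\<close>.\<close>
  have *: "{z. nearest n x (c *\<^sub>R z) p} =
    (if p < n then (\<Inter>k\<in>{..<n} - {p}. {z. inner (c *\<^sub>R z) (x k) < inner (c *\<^sub>R z) (x p)}) else {})" for c p
    by (auto simp: nearest_def)
  have "open {z. nearest n x (c *\<^sub>R z) p}" for c p
    unfolding * by (auto intro!: open_INT open_Collect_less continuous_intros)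
  from this[of 1 p] this[of "-1" q] have "open ({z. nearest n x z p} \<inter> {z. nearest n x (- z) q})"
    by (intro open_Int) simp_all
  then show ?thesis by (simp add: sector_def Collect_conj_eq)
qed

lemma convex_sector: "convex (sector n x p q)"
proof -
  have *: "{z. nearest n x (c *\<^sub>R z) p} =
    (if p < n then (\<Inter>k\<in>{..<n} - {p}. {z. inner (c *\<^sub>R (x k - x p)) z < 0}) else {})" for c p
    by (auto simp: nearest_def inner_diff_left inner_diff_right algebra_simps inner_commute)
  have "convex {z. nearest n x (c *\<^sub>R z) p}" for c p
    unfolding * by (simp del: inner_scaleR_left add: convex_INT convex_halfspace_lt)
  from this[of 1 p] this[of "-1" q] have "convex ({z. nearest n x z p} \<inter> {z. nearest n x (- z) q})"
    by (intro convex_Int) simp_all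
  then show ?thesis by (simp add: sector_def Collect_conj_eq)
qed

lemma nearest_unique: "nearest n x z p \<Longrightarrow> nearest n x z p' \<Longrightarrow> p = p'"
  by (metis nearest_def order.asym)

lemma sector_unique: "z \<in> sector n x p q \<Longrightarrow> z \<in> sector n x p' q' \<Longrightarrow> p = p' \<and> q = q'"
  unfolding sector_def using nearest_unique by blast

text \<open>A partition of the complement of the bisectors into nonempty open connected sets can
  only be the partition into components. That the sectors fill exactly this complement is
  \<open>sector_no_tie\<close> in one direction and \<open>nearest_exists\<close>, for
  \<open>z\<close> and for \<open>- z\<close>, in the other.\<close>

lemma regions_eq_sectors:
  "regions n x = {R. R \<noteq> {} \<and> (\<exists>p<n. \<exists>q<n. R = sector n x p q)}"
  unfolding regions_def
proof (rule components_open_unique)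
  let ?A = "{R. R \<noteq> {} \<and> (\<exists>p<n. \<exists>q<n. R = sector n x p q)}"
  show "pairwise disjnt ?A"
    by (auto simp: pairwise_def disjnt_def dest: sector_unique)
  show "\<Union> ?A = - (\<Union>i<n. perp_bisector (y i) (y (i + 1)))"
  proof (intro equalityI subsetI)
    fix z assume "z \<in> \<Union> ?A"
    then obtain p q where "z \<in> sector n x p q" by auto
    from sector_no_tie[OF this] show "z \<in> - (\<Union>i<n. perp_bisector (y i) (y (i + 1)))"
      by (auto simp: perp_bisector_iff)
  next
    fix z assume "z \<in> - (\<Union>i<n. perp_bisector (y i) (y (i + 1)))"
    then have *: "inner z (y i) \<noteq> inner z (y (Suc i))" if "i < n" for i
      using that by (auto simp: perp_bisector_iff)
    obtain p where "nearest n x z p" using nearest_exists * by blast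
    moreover obtain q where "nearest n x (- z) q" using nearest_exists[of "- z"] * by auto
    ultimately have "z \<in> sector n x p q" "p < n" "q < n" by (auto simp: sector_def nearest_def)
    then show "z \<in> \<Union> ?A" by blast
  qed
  show "open X \<and> connected X \<and> X \<noteq> {}" if "X \<in> ?A" for X
    using that by (auto intro: open_sector convex_connected convex_sector)
qed

end

section \<open>Counting the regions of a central line arrangement\<close>

text \<open>The vectors serve as normals of lines through the origin; \<open>Im (cnj v * w)\<close>
  is the determinant of \<open>v\<close> and \<open>w\<close>.\<close>

definition nonparallel :: "complex set \<Rightarrow> bool" where
  "nonparallel V \<longleftrightarrow> 0 \<notin> V \<and> (\<forall>v\<in>V. \<forall>w\<in>V. v \<noteq> w \<longrightarrow> Im (cnj v * w) \<noteq> 0)"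

definition positive_part :: "complex set \<Rightarrow> complex \<Rightarrow> complex set" where
  "positive_part V z = {v \<in> V. 0 < inner z v}"

definition avoids :: "complex set \<Rightarrow> complex \<Rightarrow> bool" where
  "avoids V z \<longleftrightarrow> (\<forall>v\<in>V. inner z v \<noteq> 0)"

definition sign_patterns :: "complex set \<Rightarrow> complex set set" where
  "sign_patterns V = positive_part V ` {z. avoids V z}"

text \<open>Finitely many nonzero inner products keep their signs under small displacements. Both
  signs of \<open>t\<close> are covered because a point on a new line is later pushed to either side
  of it.\<close>

lemma positive_part_perturb:
  assumes "finite V" "avoids V z"
  obtains e where "e > 0" "\<And>t. \<bar>t\<bar> \<le> e \<Longrightarrow> avoids V (z + t *\<^sub>R u) \<and> positive_part V (z + t *\<^sub>R u) = positive_part V z"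
proof -
  have "\<exists>e>0. \<forall>t. \<bar>t\<bar> \<le> e \<longrightarrow> avoids V (z + t *\<^sub>R u) \<and> positive_part V (z + t *\<^sub>R u) = positive_part V z"
    using assms
  proof (induction V rule: finite_induct)
    case empty then show ?case by (auto simp: avoids_def positive_part_def intro: exI[of _ 1])
  next
    case (insert v V)
    then obtain e where e: "e > 0" "\<And>t. \<bar>t\<bar> \<le> e \<Longrightarrow> avoids V (z + t *\<^sub>R u) \<and> positive_part V (z + t *\<^sub>R u) = positive_part V z"
      by (auto simp: avoids_def)
    have zv: "inner z v \<noteq> 0" using insert.prems by (auto simp: avoids_def)
    define K where "K = 1 + \<bar>inner u v\<bar>"
    have K: "0 < K" "\<bar>inner u v\<bar> \<le> K" by (simp_all add: K_def)
    define d where "d = \<bar>inner z v\<bar> / (2 * K)"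
    have d: "d > 0" using zv K by (simp add: d_def)
    have bd: "\<bar>t * inner u v\<bar> < \<bar>inner z v\<bar>" if "\<bar>t\<bar> \<le> d" for t
    proof -
      have "\<bar>t * inner u v\<bar> \<le> d * K"
        using that K d unfolding abs_mult by (intro mult_mono) auto
      also have "\<dots> = \<bar>inner z v\<bar> / 2" using K by (simp add: d_def)
      finally show ?thesis using zv by simp
    qed
    have "avoids (insert v V) (z + t *\<^sub>R u) \<and>
        positive_part (insert v V) (z + t *\<^sub>R u) = positive_part (insert v V) z" if t: "\<bar>t\<bar> \<le> min e d" for t
    proof -
      have s: "inner (z + t *\<^sub>R u) v \<noteq> 0 \<and> (0 < inner (z + t *\<^sub>R u) v \<longleftrightarrow> 0 < inner z v)"
        using bd[of t] t by (auto simp: inner_add_left)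
      have pi: "positive_part (insert v V) w = (if 0 < inner w v then insert v (positive_part V w) else positive_part V w)" for w
        by (auto simp: positive_part_def)
      show ?thesis using e(2)[of t] s t unfolding pi by (auto simp: avoids_def)
    qed
    then show ?case using e(1) d by (intro exI[of _ "min e d"]) auto
  qed
  then show ?thesis using that by blast
qed

lemma inner_rotate: "inner (\<i> * u) v = Im (cnj u * v)"
  by (simp add: inner_complex_def algebra_simps)

lemma orthogonal_multiple:
  assumes "inner w u = 0" "u \<noteq> 0"
  shows "\<exists>c. w = c *\<^sub>R (\<i> * u)"
proof -
  define X where "X = Im w * Re u - Re w * Im u"
  define Y where "Y = (Re u)\<^sup>2 + (Im u)\<^sup>2"
  define c where "c = X / Y"
  have nz: "Y \<noteq> 0" using assms(2) by (simp add: Y_def complex_eq_iff sum_power2_eq_zero_iff)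
  have h: "Re w * Re u + Im w * Im u = 0" using assms(1) by (simp add: inner_complex_def)
  have "Re w * Y = - X * Im u" "Im w * Y = X * Re u"
    using h unfolding X_def Y_def by algebra+
  then have "Re w = - (c * Im u)" "Im w = c * Re u"
    using nz by (simp_all add: c_def field_simps)
  then have "w = c *\<^sub>R (\<i> * u)"
    by (simp add: complex_eq_iff)
  then show ?thesis by blast
qed

lemma positive_part_scale:
  assumes "avoids V w" "c \<noteq> 0"
  shows "positive_part V (c *\<^sub>R w) = (if c > 0 then positive_part V w else positive_part V (- w))"
  using assms by (auto simp: positive_part_def zero_less_mult_iff)

text \<open>The new line meets exactly two cells, those of the two directions orthogonal to \<open>u\<close>, and splits them.\<close>

lemma sign_patterns_insert:
  assumes V: "finite V" "V \<noteq> {}" "u \<notin> V" "nonparallel (insert u V)"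
  shows "card (sign_patterns (insert u V)) = card (sign_patterns V) + 2"
proof -
  define e where "e = \<i> * u"
  have u: "u \<noteq> 0" using V by (auto simp: nonparallel_def)
  have av: "avoids V e" "avoids V (- e)"
    using V unfolding avoids_def nonparallel_def e_def inner_minus_left inner_rotate by auto
  have eu: "inner e u = 0" by (simp add: e_def inner_complex_def)
  \<comment> \<open>\<open>P\<close> and \<open>Q\<close> hold the patterns over \<open>V\<close>
    that occur on the two sides of the new line. Those in both belong to the cells that the line
    splits, so the new count is \<open>card (P \<union> Q) + card (P \<inter> Q)\<close>.\<close>
  define P where "P = {positive_part V z | z. avoids V z \<and> 0 < inner z u}"
  define Q where "Q = {positive_part V z | z. avoids V z \<and> inner z u < 0}"
  have sub: "P \<subseteq> Pow V" "Q \<subseteq> Pow V" by (auto simp: P_def Q_def positive_part_def)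
  then have fin: "finite P" "finite Q" using V(1) by (auto intro: finite_subset)
  have split: "sign_patterns (insert u V) = insert u ` P \<union> Q"
  proof -
    have "positive_part (insert u V) z = insert u (positive_part V z)" if "0 < inner z u" for z
      using that by (auto simp: positive_part_def)
    moreover have "positive_part (insert u V) z = positive_part V z" if "inner z u < 0" for z
      using that by (auto simp: positive_part_def)
    moreover have "avoids (insert u V) z \<longleftrightarrow> avoids V z \<and> (0 < inner z u \<or> inner z u < 0)" for z
      by (auto simp: avoids_def)
    ultimately show ?thesis
      unfolding sign_patterns_def P_def Q_def by (auto simp: image_iff) metis+
  qed
  have "card (insert u ` P) = card P"
    using sub(1) V(3) by (intro card_image inj_onI) (metis PowD insert_ident subset_iff)
  moreover have "insert u ` P \<inter> Q = {}" using sub V(3) by auto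
  ultimately have 1: "card (sign_patterns (insert u V)) = card (P \<union> Q) + card (P \<inter> Q)"
    unfolding split using fin card_Un_Int[OF fin] by (simp add: card_Un_disjoint)
  have uu: "0 < inner u u" using u by simp
  have both: "positive_part V z \<in> P \<inter> Q" if z: "avoids V z" "inner z u = 0" for z
  proof -
    obtain d where d: "d > 0" "\<And>t. \<bar>t\<bar> \<le> d \<Longrightarrow> avoids V (z + t *\<^sub>R u) \<and> positive_part V (z + t *\<^sub>R u) = positive_part V z"
      using positive_part_perturb[OF V(1) z(1)] by blast
    have "positive_part V z \<in> P" unfolding P_def
      using d(1) d(2)[of d] z uu by (intro CollectI exI[of _ "z + d *\<^sub>R u"]) (simp add: inner_add_left)
    moreover have "positive_part V z \<in> Q" unfolding Q_def
      using d(1) d(2)[of "-d"] z uu by (intro CollectI exI[of _ "z + (-d) *\<^sub>R u"]) (simp add: inner_add_left inner_diff_left)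
    ultimately show ?thesis by blast
  qed
  have 2: "P \<union> Q = sign_patterns V"
  proof -
    have "positive_part V z \<in> P \<union> Q" if z: "avoids V z" for z
      using both[of z] z by (cases "inner z u" "0::real" rule: linorder_cases) (auto simp: P_def Q_def)
    then show ?thesis by (auto simp: sign_patterns_def P_def Q_def)
  qed
  have 3: "P \<inter> Q = {positive_part V e, positive_part V (- e)}"
  proof
    show "{positive_part V e, positive_part V (- e)} \<subseteq> P \<inter> Q"
      using both[of e] both[of "- e"] av eu by simp
    show "P \<inter> Q \<subseteq> {positive_part V e, positive_part V (- e)}"
    proof
      fix S assume "S \<in> P \<inter> Q"
      then obtain z w where z: "S = positive_part V z" "avoids V z" "0 < inner z u"
        and w: "S = positive_part V w" "avoids V w" "inner w u < 0"
        by (auto simp: P_def Q_def)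
      \<comment> \<open>Up to scaling, the point where the segment from \<open>z\<close> to
        \<open>w\<close> meets the line orthogonal to \<open>u\<close>. As a positive combination it
        keeps the signs that \<open>z\<close> and \<open>w\<close> share on
        \<open>V\<close>.\<close>
      define r where "r = (- inner w u) *\<^sub>R z + inner z u *\<^sub>R w"
      have "inner r u = 0" by (simp add: r_def inner_add_left algebra_simps)
      then obtain c where c: "r = c *\<^sub>R e" using orthogonal_multiple u unfolding e_def by blast
      have pos: "0 < inner z v \<longleftrightarrow> 0 < inner w v" if "v \<in> V" for v
        using z(1) w(1) that by (auto simp: positive_part_def)
      have sgn: "inner r v \<noteq> 0 \<and> (0 < inner r v \<longleftrightarrow> 0 < inner z v)" if v: "v \<in> V" for v
      proof -
        have r: "inner r v = (- inner w u) * inner z v + inner z u * inner w v"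
          by (simp add: r_def inner_add_left inner_diff_left)
        have "inner z v \<noteq> 0" "inner w v \<noteq> 0" using v z(2) w(2) by (auto simp: avoids_def)
        then consider "0 < inner z v" "0 < inner w v" | "inner z v < 0" "inner w v < 0"
          using pos[OF v] by linarith
        then show ?thesis
        proof cases
          case 1
          then have "0 < (- inner w u) * inner z v" "0 < inner z u * inner w v"
            using z(3) w(3) by (auto intro: mult_pos_pos mult_neg_pos)
          then show ?thesis using r 1 by linarith
        next
          case 2
          then have "(- inner w u) * inner z v < 0" "inner z u * inner w v < 0"
            using z(3) w(3) by (auto intro: mult_pos_neg mult_neg_neg)
          then show ?thesis using r 2 by linarith
        qed
      qed
      have S: "S = positive_part V (c *\<^sub>R e)" using z(1) sgn unfolding c positive_part_def by blast
      have "c \<noteq> 0" using sgn V(2) unfolding c by auto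
      then show "S \<in> {positive_part V e, positive_part V (- e)}"
        unfolding S positive_part_scale[OF av(1) \<open>c \<noteq> 0\<close>] by auto
    qed
  qed
  have "positive_part V e \<noteq> positive_part V (- e)"
  proof
    assume eq: "positive_part V e = positive_part V (- e)"
    obtain v where v: "v \<in> V" using V by auto
    then have "inner e v \<noteq> 0" using av by (auto simp: avoids_def)
    moreover have "0 < inner e v \<longleftrightarrow> inner e v < 0"
      using eq v by (auto simp: positive_part_def set_eq_iff)
    ultimately show False by linarith
  qed
  then show ?thesis using 1 2 3 by simp
qed

lemma card_sign_patterns:
  assumes "finite V" "V \<noteq> {}" "nonparallel V"
  shows "card (sign_patterns V) = 2 * card V"
  using assms
proof (induction V rule: finite_ne_induct)
  case (singleton v)
  then have v: "v \<noteq> 0" by (auto simp: nonparallel_def)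
  have pp: "positive_part {v} z = (if 0 < inner z v then {v} else {})" for z
    by (auto simp: positive_part_def)
  have "sign_patterns {v} = {{v}, {}}"
  proof
    show "sign_patterns {v} \<subseteq> {{v}, {}}" by (auto simp: sign_patterns_def pp)
    have "avoids {v} v" "avoids {v} (- v)" "0 < inner v v" using v by (auto simp: avoids_def)
    then have "positive_part {v} v \<in> sign_patterns {v}" "positive_part {v} (- v) \<in> sign_patterns {v}"
      unfolding sign_patterns_def by blast+
    then show "{{v}, {}} \<subseteq> sign_patterns {v}"
      using \<open>0 < inner v v\<close> by (simp add: pp)
  qed
  then show ?case by simp
next
  case (insert u V)
  then have "nonparallel V" by (auto simp: nonparallel_def)
  then show ?case using insert sign_patterns_insert[of V u] by simp
qed

lemma components_lines:
  assumes "finite V" "V \<noteq> {}" "nonparallel V"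
  shows "card (components {z. avoids V z}) = 2 * card V"
proof -
  define cell where "cell S = {z. avoids V z \<and> positive_part V z = S}" for S
  have "components {z. avoids V z} = cell ` sign_patterns V"
  proof (rule components_open_unique)
    show "pairwise disjnt (cell ` sign_patterns V)"
      by (auto simp: pairwise_def disjnt_def cell_def)
    show "\<Union> (cell ` sign_patterns V) = {z. avoids V z}"
      by (auto simp: cell_def sign_patterns_def)
    fix X assume "X \<in> cell ` sign_patterns V"
    then obtain z0 where z0: "avoids V z0" "X = cell (positive_part V z0)"
      by (auto simp: sign_patterns_def)
    have X: "X = (\<Inter>v\<in>V. if 0 < inner z0 v then {z. 0 < inner v z} else {z. inner v z < 0})"
    proof (intro set_eqI)
      fix z
      have "z \<in> X \<longleftrightarrow> (\<forall>v\<in>V. inner z v \<noteq> 0 \<and> (0 < inner z v \<longleftrightarrow> 0 < inner z0 v))"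
        by (auto simp: z0(2) cell_def avoids_def positive_part_def set_eq_iff)
      also have "\<dots> \<longleftrightarrow> (\<forall>v\<in>V. if 0 < inner z0 v then 0 < inner v z else inner v z < 0)"
        by (intro ball_cong refl) (auto simp: inner_commute[of z])
      also have "\<dots> \<longleftrightarrow> z \<in> (\<Inter>v\<in>V. if 0 < inner z0 v then {z. 0 < inner v z} else {z. inner v z < 0})"
        unfolding INT_iff by (intro ball_cong refl) simp
      finally show "z \<in> X \<longleftrightarrow> z \<in> (\<Inter>v\<in>V. if 0 < inner z0 v then {z. 0 < inner v z} else {z. inner v z < 0})" .
    qed
    have "open X" unfolding X using assms(1)
      by (intro open_INT) (auto intro!: open_Collect_less continuous_intros)
    moreover have "convex X" unfolding X
      by (intro convex_INT) (auto intro: convex_halfspace_lt convex_halfspace_gt)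
    moreover have "X \<noteq> {}" using z0 by (auto simp: cell_def)
    ultimately show "open X \<and> connected X \<and> X \<noteq> {}" by (auto intro: convex_connected)
  qed
  moreover have "inj_on cell (sign_patterns V)"
    by (auto simp: inj_on_def cell_def sign_patterns_def set_eq_iff)
  ultimately show ?thesis using card_sign_patterns[OF assms] by (simp add: card_image)
qed

section \<open>Types and lengths of regions for generic points\<close>

text \<open>The bisector of unit vectors \<open>a\<close> and \<open>b\<close> is determined by \<open>a * b\<close>, the square of its direction. The
  indices \<open>b\<close>, \<open>c\<close>, \<open>d\<close> may coincide: \<open>b = d\<close> says that the points are distinct, and \<open>c = d\<close> that two
  points are never equidistant from a third one.\<close>

definition generic :: "nat \<Rightarrow> (nat \<Rightarrow> complex) \<Rightarrow> bool" where
  "generic n x \<longleftrightarrow>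
    (\<forall>a<n. \<forall>b<n. \<forall>c<n. \<forall>d<n. a \<noteq> b \<longrightarrow> a \<noteq> c \<longrightarrow> a \<noteq> d \<longrightarrow> x a * x b \<noteq> x c * x d)"

lemma genericD:
  assumes "generic n x" "a < n" "b < n" "c < n" "d < n" "a \<noteq> b" "a \<noteq> c" "a \<noteq> d"
  shows "x a * x b \<noteq> x c * x d"
  using assms unfolding generic_def by blast

lemma cnj_eq_inverse: "norm z = 1 \<Longrightarrow> cnj z = inverse z"
  by (metis complex_norm_square inverse_unique of_real_1 power_one)

text \<open>On the unit circle conjugation is inversion, so
  \<open>(b - a) / cnj (b - a) = - (a * b)\<close>, and this quotient is the same for parallel
  chords.\<close>

lemma parallel_chords:
  assumes "norm a = 1" "norm b = 1" "norm c = 1" "norm d = 1" "a \<noteq> b" "c \<noteq> d"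
    and "Im (cnj (b - a) * (d - c)) = 0"
  shows "a * b = c * d"
proof -
  have nz: "a \<noteq> 0" "b \<noteq> 0" "c \<noteq> 0" "d \<noteq> 0" using assms by auto
  have "cnj z = z" if "Im z = 0" for z using that by (simp add: complex_eq_iff)
  from this[OF assms(7)]
  have "cnj (cnj (b - a) * (d - c)) = cnj (b - a) * (d - c)" .
  then have "(b - a) * (inverse d - inverse c) = (inverse b - inverse a) * (d - c)"
    using assms(1-4) by (simp add: cnj_eq_inverse)
  moreover have "inverse d - inverse c = - ((d - c) * inverse (c * d))"
    "inverse b - inverse a = - ((b - a) * inverse (a * b))"
    using nz by (simp_all add: field_simps)
  ultimately have "((b - a) * (d - c)) * inverse (c * d) = ((b - a) * (d - c)) * inverse (a * b)"
    by (simp only: mult_minus_left mult_minus_right mult_ac neg_equal_iff_equal)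
  then have "inverse (c * d) = inverse (a * b)"
    using assms(5,6) by (subst (asm) mult_left_cancel) auto
  then show ?thesis by (metis inverse_inverse_eq)
qed

text \<open>After rotating \<open>p\<close> to 1, the images \<open>u\<close> and \<open>v\<close>
  are distinct points of the unit circle with the same real part. They are therefore conjugate, and
  \<open>u * v = 1\<close>.\<close>

lemma equal_inner_unit:
  fixes p a b :: complex
  assumes "norm p = 1" "norm a = 1" "norm b = 1" "inner p a = inner p b" "a \<noteq> b"
  shows "a * b = p * p"
proof -
  define u where "u = cnj p * a"
  define v where "v = cnj p * b"
  have pp: "p * cnj p = 1" using assms(1) by (metis complex_norm_square of_real_1 power_one)
  have "Re u = Re v" using assms(4) by (simp add: u_def v_def inner_complex_def)
  moreover have "norm u = 1" "norm v = 1" using assms by (simp_all add: u_def v_def norm_mult)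
  then have "(Re u)\<^sup>2 + (Im u)\<^sup>2 = 1" "(Re v)\<^sup>2 + (Im v)\<^sup>2 = 1" by (simp_all add: cmod_power2[symmetric])
  ultimately have "(Im u)\<^sup>2 = (Im v)\<^sup>2" by simp
  moreover have "u \<noteq> v"
  proof
    assume "u = v"
    then have "(p * cnj p) * a = (p * cnj p) * b" by (simp add: u_def v_def mult.assoc)
    then show False using assms(5) pp by simp
  qed
  ultimately have "u = cnj v" using \<open>Re u = Re v\<close> by (auto simp: complex_eq_iff power2_eq_iff)
  then have "u * v = 1" using \<open>norm v = 1\<close> by (metis complex_norm_square mult.commute of_real_1 power_one)
  then have "p * p * (u * v) = p * p" by simp
  moreover have "p * p * (u * v) = (p * cnj p) * (p * cnj p) * (a * b)"
    unfolding u_def v_def by (simp add: mult_ac)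
  ultimately show ?thesis by (simp add: pp)
qed

locale generic_config = circle_config +
  assumes gen: "generic n x"
begin

text \<open>Genericity refers to sample indices, the polygon to cyclic labels. Passing to values
  removes the permutation between them.\<close>

lemma generic_values:
  assumes "\<alpha> \<in> x ` {..<n}" "\<beta> \<in> x ` {..<n}" "\<gamma> \<in> x ` {..<n}" "\<delta> \<in> x ` {..<n}"
    and "\<alpha> \<noteq> \<beta>" "\<alpha> \<noteq> \<gamma>" "\<alpha> \<noteq> \<delta>"
  shows "\<alpha> * \<beta> \<noteq> \<gamma> * \<delta>"
proof -
  obtain a b c d where "a < n" "b < n" "c < n" "d < n" "\<alpha> = x a" "\<beta> = x b" "\<gamma> = x c" "\<delta> = x d"
    using assms(1-4) by auto
  then show ?thesis using assms(5-7) genericD[OF gen, of a b c d] by auto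
qed

lemma label_mem: "y i \<in> x ` {..<n}"
proof -
  have "y (i mod n) \<in> x ` {..<n}" using label_set n by fastforce
  then show ?thesis by (simp only: label_mod)
qed

lemma sides_nonparallel:
  assumes "i < n" "j < n" "i \<noteq> j"
  shows "Im (cnj (y (Suc i) - y i) * (y (Suc j) - y j)) \<noteq> 0"
proof
  assume *: "Im (cnj (y (Suc i) - y i) * (y (Suc j) - y j)) = 0"
  define s where "s i = (if Suc i = n then 0 else Suc i)" for i
  have s: "y (Suc i) = y (s i)" "s i < n" if "i < n" for i
    using that label_mod[of "Suc i"] by (auto simp: s_def)
  have ne: "y k = y l \<longleftrightarrow> k = l" if "k < n" "l < n" for k l
    using that label_inj by (auto dest: inj_onD)
  \<comment> \<open>Two sides may share a vertex, but since \<open>n\<close> is at least 3 they do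
    not share both. An endpoint of side \<open>i\<close> that is not on side \<open>j\<close> plays
    the singled-out role in \<open>generic_values\<close>.\<close>
  have "i \<noteq> s i" "j \<noteq> s j" "s i \<noteq> s j" "i \<noteq> s j \<or> s i \<noteq> j"
    using assms n by (auto simp: s_def split: if_splits)
  then have "y i \<noteq> y (Suc i)" "y j \<noteq> y (Suc j)" "y i \<noteq> y j" "y (Suc i) \<noteq> y (Suc j)" "y i \<noteq> y (Suc j) \<or> y (Suc i) \<noteq> y j"
    using assms s ne by auto
  moreover from this have "y i * y (Suc i) = y j * y (Suc j)"
    using * by (intro parallel_chords) (auto simp: label_norm)
  ultimately show False
    using generic_values[OF label_mem label_mem label_mem label_mem, of i "Suc i" j "Suc j"]
      generic_values[OF label_mem label_mem label_mem label_mem, of "Suc i" i j "Suc j"]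
    by (auto simp: mult.commute)
qed

text \<open>The bisector of two unit vectors is the line through the origin orthogonal to their
  difference. The side vectors of the polygon are thus normals of \<open>n\<close> pairwise distinct
  lines.\<close>

lemma card_regions: "card (regions n x) = 2 * n"
proof -
  let ?v = "\<lambda>i. y (Suc i) - y i"
  define V where "V = ?v ` {..<n}"
  have real: "Im (cnj v * v) = 0" for v by simp
  have "inj_on ?v {..<n}"
  proof (rule inj_onI, rule ccontr)
    fix i j assume "i \<in> {..<n}" "j \<in> {..<n}" "?v i = ?v j" "i \<noteq> j"
    then show False using sides_nonparallel[of i j] real[of "?v j"] by simp
  qed
  then have card: "card V = n" by (simp add: V_def card_image)
  have "0 \<notin> V"
  proof
    assume "0 \<in> V"
    then obtain i where i: "i < n" "y (Suc i) - y i = 0" by (auto simp: V_def)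
    define j where "j = (if i = 0 then 1 else 0 :: nat)"
    have "j < n" "i \<noteq> j" using n by (auto simp: j_def)
    from sides_nonparallel[OF i(1) this] i(2) show False by simp
  qed
  moreover have "Im (cnj v * w) \<noteq> 0" if "v \<in> V" "w \<in> V" "v \<noteq> w" for v w
  proof -
    obtain i j where "i < n" "v = ?v i" "j < n" "w = ?v j" using \<open>v \<in> V\<close> \<open>w \<in> V\<close> by (auto simp: V_def)
    then show ?thesis using sides_nonparallel[of i j] \<open>v \<noteq> w\<close> by auto
  qed
  ultimately have "nonparallel V" by (auto simp: nonparallel_def)
  moreover have "finite V" "V \<noteq> {}" using n by (auto simp: V_def lessThan_empty_iff)
  ultimately have "card (components {z. avoids V z}) = 2 * n"
    using components_lines card by simp
  moreover have "{z. avoids V z} = - (\<Union>i<n. perp_bisector (y i) (y (i + 1)))"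
  proof (intro set_eqI)
    fix z
    have "inner z (y (Suc i)) = inner z (y i) \<longleftrightarrow> inner z (y i) = inner z (y (Suc i))" for i
      by (rule eq_commute)
    then show "z \<in> {z. avoids V z} \<longleftrightarrow> z \<in> - (\<Union>i<n. perp_bisector (y i) (y (i + 1)))"
      by (simp add: avoids_def V_def inner_diff_right perp_bisector_iff)
  qed
  ultimately show ?thesis by (simp add: regions_def)
qed

section \<open>Farthest points and the types of regions\<close>

lemma inner_points_distinct:
  assumes "p < n" "j < n" "k < n" "j \<noteq> k"
  shows "inner (x p) (x j) \<noteq> inner (x p) (x k)"
proof
  assume "inner (x p) (x j) = inner (x p) (x k)"
  moreover have "x j \<noteq> x k" using assms inj by (auto dest: inj_onD)
  ultimately have *: "x j * x k = x p * x p"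
    using assms unit by (intro equal_inner_unit) auto
  show False
  proof (cases "p = j")
    case True
    then show False using genericD[OF gen, of k p p p] * assms by (simp add: mult.commute)
  next
    case False
    then show False using genericD[OF gen, of j k p p] * assms by simp
  qed
qed

lemma nearest_self: "p < n \<Longrightarrow> nearest n x (x p) p"
  unfolding nearest_def
proof (intro conjI allI impI)
  fix k assume k: "p < n" "k < n" "k \<noteq> p"
  have "inner (x p) (x k) \<le> 1"
    using norm_cauchy_schwarz[of "x p" "x k"] k unit by simp
  moreover have "inner (x p) (x p) = 1" using k unit by (simp add: dot_square_norm)
  ultimately show "inner (x p) (x k) < inner (x p) (x p)"
    using inner_points_distinct[OF k(1) k(2) k(1) k(3)] by simp
qed

text \<open>The map \<open>f\<close> of the overview; genericity rules out ties, so the description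
  is met for every \<open>p < n\<close>.\<close>

definition far :: "nat \<Rightarrow> nat" where
  "far p = (THE q. nearest n x (- x p) q)"

lemma nearest_far: 
  assumes p: "p < n"
  shows "nearest n x (- x p) (far p)"
proof -
  let ?V = "(\<lambda>i. inner (- x p) (x i)) ` {..<n}"
  have V: "finite ?V" "?V \<noteq> {}" using n by (auto simp: lessThan_empty_iff)
  obtain k where k: "k < n" and Vk: "Max ?V = inner (- x p) (x k)" using Max_in[OF V] by auto
  have "inner (- x p) (x i) < inner (- x p) (x k)" if "i < n" "i \<noteq> k" for i
  proof -
    have "inner (- x p) (x i) \<le> inner (- x p) (x k)"
      unfolding Vk[symmetric] using that by (intro Max_ge[OF V(1)]) auto
    then show ?thesis using inner_points_distinct[OF p that(1) k that(2)] by simp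
  qed
  then have kn: "nearest n x (- x p) k" using k by (simp add: nearest_def)
  show ?thesis unfolding far_def by (rule theI, rule kn, rule nearest_unique[OF _ kn])
qed

lemma far_less: "p < n \<Longrightarrow> far p < n"
  using nearest_far by (auto simp: nearest_def)

lemma nearest_antipode_iff: "p < n \<Longrightarrow> nearest n x (- x p) q \<longleftrightarrow> far p = q"
  using nearest_far nearest_unique by blast

text \<open>A sample point is its own nearest point, so only its farthest point decides in which
  sector it lies. Types and emptiness are read off from this.\<close>

lemma point_in_sector_iff: "j < n \<Longrightarrow> x j \<in> sector n x p q \<longleftrightarrow> j = p \<and> far j = q"
  unfolding sector_def using nearest_self nearest_antipode_iff nearest_unique by blast

lemma uminus_sector: "uminus ` sector n x p q = sector n x q p"
  by (auto simp: sector_def image_iff) (metis minus_minus)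

lemma sector_nonempty:
  assumes "z \<in> sector n x p q"
  shows "p < n" "q < n" "p \<noteq> q"
proof -
  show pq: "p < n" "q < n" using assms by (auto simp: sector_def nearest_def)
  define k where "k = (if p = 0 then 1 else 0 :: nat)"
  have k: "k < n" "k \<noteq> p" using n by (auto simp: k_def)
  have "inner z (x k) < inner z (x p)" using assms k by (simp add: sector_def nearest_def)
  moreover have "inner z (x p) < inner z (x k)" if "p = q"
    using assms k that by (simp add: sector_def nearest_def)
  ultimately show "p \<noteq> q" by fastforce
qed

lemma region_type_sector:
  assumes "sector n x p q \<noteq> {}"
  shows "region_type n x (sector n x p q) = of_bool (far p = q) + of_bool (far q = p)"
proof -
  obtain z where "z \<in> sector n x p q" using assms by auto
  note pq = sector_nonempty[OF this]
  have "{j. j < n \<and> x j \<in> sector n x p q \<union> uminus ` sector n x p q} =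
      (if far p = q then {p} else {}) \<union> (if far q = p then {q} else {})"
    using pq by (auto simp: uminus_sector point_in_sector_iff)
  then show ?thesis using pq by (simp add: region_type_def)
qed

lemma empty_region_sector:
  assumes "sector n x p q \<noteq> {}"
  shows "empty_region n x (sector n x p q) \<longleftrightarrow> far p \<noteq> q"
proof -
  obtain z where "z \<in> sector n x p q" using assms by auto
  note pq = sector_nonempty[OF this]
  then show ?thesis by (auto simp: empty_region_def point_in_sector_iff)
qed

definition mutual_count :: nat where
  "mutual_count = card {p. p < n \<and> far (far p) = p}"

lemma sector_eqD:
  assumes "sector n x p q = sector n x p' q'" "sector n x p q \<noteq> {}"
  shows "p = p' \<and> q = q'"
  using assms sector_unique by blast

lemma sector_far: "p < n \<Longrightarrow> sector n x p (far p) \<noteq> {}" "p < n \<Longrightarrow> sector n x (far p) p \<noteq> {}"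
proof -
  show "p < n \<Longrightarrow> sector n x p (far p) \<noteq> {}" for p using point_in_sector_iff by blast
  then show "p < n \<Longrightarrow> sector n x (far p) p \<noteq> {}" using uminus_sector by blast
qed

lemma regionE:
  assumes "R \<in> regions n x"
  obtains p q where "R = sector n x p q" "sector n x p q \<noteq> {}" "p < n" "q < n"
  using assms by (auto simp: regions_eq_sectors)

lemma sector_far_region:
  assumes "p < n"
  shows "sector n x p (far p) \<in> regions n x" "sector n x (far p) p \<in> regions n x"
  using sector_far[OF assms] far_less[OF assms] assms unfolding regions_eq_sectors by blast+

lemma finite_regions: "finite (regions n x)"
proof -
  have "regions n x \<subseteq> (\<lambda>(p, q). sector n x p q) ` ({..<n} \<times> {..<n})"
    by (auto simp: regions_eq_sectors)
  then show ?thesis by (rule finite_subset) simp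
qed

lemma card_type2: "card {R \<in> regions n x. region_type n x R = 2} = mutual_count"
proof -
  have "{R \<in> regions n x. region_type n x R = 2} =
      (\<lambda>p. sector n x p (far p)) ` {p. p < n \<and> far (far p) = p}"
    (is "?L = ?R")
  proof (intro equalityI subsetI)
    fix R assume "R \<in> ?L"
    then obtain p q where R: "R = sector n x p q" "sector n x p q \<noteq> {}" "p < n" "region_type n x R = 2"
      by (auto elim!: regionE)
    then have "far p = q" "far q = p"
      by (simp_all add: region_type_sector of_bool_def split: if_splits)
    then show "R \<in> ?R" using R by blast
  next
    fix R assume "R \<in> ?R"
    then obtain p where p: "p < n" "far (far p) = p" "R = sector n x p (far p)" by auto
    then show "R \<in> ?L" using sector_far_region(1) region_type_sector[OF sector_far(1)] by simp
  qed
  moreover have "inj_on (\<lambda>p. sector n x p (far p)) {p. p < n \<and> far (far p) = p}"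
    using sector_far by (auto simp: inj_on_def dest: sector_eqD)
  ultimately show ?thesis by (simp add: card_image mutual_count_def)
qed

text \<open>Each \<open>p\<close> with \<open>far (far p) \<noteq> p\<close> yields the sector of
  \<open>p\<close> and \<open>far p\<close> and the antipodal sector. An overlap of the two families
  would make such a \<open>p\<close> mutual.\<close>

lemma card_type1: "card {R \<in> regions n x. region_type n x R = 1} = 2 * (n - mutual_count)"
proof -
  define W where "W = {p. p < n \<and> far (far p) \<noteq> p}"
  have "{R \<in> regions n x. region_type n x R = 1} =
      (\<lambda>p. sector n x p (far p)) ` W \<union> (\<lambda>p. sector n x (far p) p) ` W"
    (is "?L = ?R")
  proof (intro equalityI subsetI)
    fix R assume "R \<in> ?L"
    then obtain p q where R: "R = sector n x p q" "sector n x p q \<noteq> {}" "p < n" "q < n" "region_type n x R = 1"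
      by (auto elim!: regionE)
    then have "(far p = q \<and> far q \<noteq> p) \<or> (far p \<noteq> q \<and> far q = p)"
      by (simp add: region_type_sector of_bool_def split: if_splits)
    then show "R \<in> ?R" using R unfolding W_def by blast
  next
    fix R assume "R \<in> ?R"
    then consider p where "p \<in> W" "R = sector n x p (far p)" | p where "p \<in> W" "R = sector n x (far p) p" by auto
    then show "R \<in> ?L"
      by cases (use sector_far_region region_type_sector[OF sector_far(1)] region_type_sector[OF sector_far(2)] in \<open>auto simp: W_def\<close>)
  qed
  moreover have "inj_on (\<lambda>p. sector n x p (far p)) W" "inj_on (\<lambda>p. sector n x (far p) p) W"
    using sector_far by (auto simp: inj_on_def W_def dest: sector_eqD)
  moreover have "(\<lambda>p. sector n x p (far p)) ` W \<inter> (\<lambda>p. sector n x (far p) p) ` W = {}"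
    using sector_far by (auto simp: W_def dest: sector_eqD)
  moreover have "finite W" by (simp add: W_def)
  moreover have "card W = n - mutual_count"
  proof -
    have "W = {..<n} - {p. p < n \<and> far (far p) = p}" by (auto simp: W_def)
    then show ?thesis by (simp add: mutual_count_def card_Diff_subset subset_iff)
  qed
  ultimately show ?thesis by (simp add: card_Un_disjoint card_image)
qed

lemma mutual_count_le: "mutual_count \<le> n"
  unfolding mutual_count_def by (rule order_trans[OF card_mono[of "{..<n}"]]) auto

text \<open>What remains of the total:
  \<open>2 * n - 2 * (n - mutual_count) - mutual_count\<close>.\<close>

lemma card_type0: "card {R \<in> regions n x. region_type n x R = 0} = mutual_count"
proof -
  let ?T = "\<lambda>k. {R \<in> regions n x. region_type n x R = k}"
  have eq: "regions n x = ?T 0 \<union> ?T 1 \<union> ?T 2"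
  proof -
    have "region_type n x R \<in> {0, 1, 2}" if "R \<in> regions n x" for R
      using that by (elim regionE) (simp add: region_type_sector of_bool_def)
    then show ?thesis by blast
  qed
  have c1: "card (?T 0 \<union> ?T 1 \<union> ?T 2) = card (?T 0 \<union> ?T 1) + card (?T 2)"
    by (rule card_Un_disjoint) (use finite_regions in auto)
  have c2: "card (?T 0 \<union> ?T 1) = card (?T 0) + card (?T 1)"
    by (rule card_Un_disjoint) (use finite_regions in auto)
  show ?thesis
    using arg_cong[OF eq, of card] c1 c2 card_regions card_type1 card_type2 mutual_count_le by linarith
qed

lemma number_fractions:
  "number_fraction 0 n x = real mutual_count / real (2 * n)"
  "number_fraction 1 n x = 1 - real mutual_count / real n"
  "number_fraction 2 n x = real mutual_count / real (2 * n)"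
proof -
  have "real (2 * (n - mutual_count)) / real (2 * n) = (real n - real mutual_count) / real n"
    using mutual_count_le n by (simp add: of_nat_diff field_simps)
  also have "\<dots> = 1 - real mutual_count / real n" using n by (simp add: diff_divide_distrib)
  finally show "number_fraction 1 n x = 1 - real mutual_count / real n"
    unfolding number_fraction_def card_type1 .
qed (simp_all only: number_fraction_def card_type0 card_type2)

text \<open>The flag \<open>a\<close> records whether the region of \<open>t\<close> contains a
  sample point, which can only be \<open>x p\<close>; the flag \<open>b\<close> records the same for
  the antipodal region and \<open>x q\<close>.\<close>

definition class_set :: "bool \<Rightarrow> bool \<Rightarrow> real set" where
  "class_set a b = {t \<in> {0..<1}. \<exists>p q. cis (2 * pi * t) \<in> sector n x p q \<and> (far p = q) = a \<and> (far q = p) = b}"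

lemma arc_measurable: "open R \<Longrightarrow> {t \<in> {0..<1}. cis (2 * pi * t) \<in> R} \<in> sets lborel"
proof -
  assume "open R"
  have "continuous_on UNIV (\<lambda>t. cis (2 * pi * t))" by (intro continuous_intros)
  then have "open ((\<lambda>t. cis (2 * pi * t)) -` R)" using \<open>open R\<close> by (simp add: open_vimage)
  then have "(\<lambda>t. cis (2 * pi * t)) -` R \<inter> {0..<1} \<in> sets lborel" by auto
  moreover have "{t \<in> {0..<1}. cis (2 * pi * t) \<in> R} = (\<lambda>t. cis (2 * pi * t)) -` R \<inter> {0..<1}" by auto
  ultimately show ?thesis by simp
qed

lemma region_open: "R \<in> regions n x \<Longrightarrow> open R"
  by (auto simp: regions_eq_sectors open_sector)

lemma fmeasurable_arc: "open R \<Longrightarrow> {t \<in> {0..<1}. cis (2 * pi * t) \<in> R} \<in> fmeasurable lborel"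
proof (rule fmeasurableI2[of "{0..<1::real}"])
  show "{0..<1::real} \<in> fmeasurable lborel" by (rule fmeasurableI) simp_all
qed (use arc_measurable in auto)

lemma sum_arc_length:
  assumes "S \<subseteq> regions n x"
  shows "(\<Sum>R\<in>S. arc_length R) = measure lborel {t \<in> {0..<1}. cis (2 * pi * t) \<in> \<Union>S}"
proof -
  let ?A = "\<lambda>R. {t \<in> {0..<1}. cis (2 * pi * t) \<in> R}"
  have op: "open R" if "R \<in> S" for R using region_open subsetD[OF assms that] by blast
  have "measure lborel (\<Union>R\<in>S. ?A R) = (\<Sum>R\<in>S. measure lborel (?A R))"
  proof (rule measure_finite_Union)
    show "finite S" using assms finite_regions by (rule finite_subset)
    show "?A ` S \<subseteq> sets lborel"
      by (rule image_subsetI) (rule arc_measurable[OF op])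
    show "emeasure lborel (?A R) \<noteq> \<infinity>" if "R \<in> S" for R
      using fmeasurable_arc[OF op[OF that]] by (simp add: fmeasurable_def less_top)
    show "disjoint_family_on ?A S"
    proof (unfold disjoint_family_on_def, intro ballI impI equals0I)
      fix R Q t assume RQ: "R \<in> S" "Q \<in> S" "R \<noteq> Q" and "t \<in> ?A R \<inter> ?A Q"
      then have t: "cis (2 * pi * t) \<in> R" "cis (2 * pi * t) \<in> Q" by simp_all
      obtain p q where R: "R = sector n x p q" using RQ(1) assms by (blast elim: regionE)
      obtain p' q' where Q: "Q = sector n x p' q'" using RQ(2) assms by (blast elim: regionE)
      show False
        using sector_unique[OF t[unfolded R Q]] RQ(3) R Q by simp
    qed
  qed
  moreover have "(\<Union>R\<in>S. ?A R) = {t \<in> {0..<1}. cis (2 * pi * t) \<in> \<Union>S}" by blast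
  ultimately show ?thesis by (simp only: arc_length_def)
qed

text \<open>Selection by type and selection by emptiness both depend only on the two flags, so one
  statement with an arbitrary condition \<open>Q\<close> serves both.\<close>

lemma cis_in_Union_regions:
  assumes "\<And>p q. sector n x p q \<noteq> {} \<Longrightarrow> P (sector n x p q) \<longleftrightarrow> Q (far p = q) (far q = p)"
  shows "{t \<in> {0..<1}. cis (2 * pi * t) \<in> \<Union>{R \<in> regions n x. P R}} =
    (\<Union>(a, b)\<in>{(a, b). Q a b}. class_set a b)"
proof (intro set_eqI iffI)
  fix t assume "t \<in> {t \<in> {0..<1}. cis (2 * pi * t) \<in> \<Union>{R \<in> regions n x. P R}}"
  then obtain R where R: "R \<in> regions n x" "P R" and t: "t \<in> {0..<1}" "cis (2 * pi * t) \<in> R" by auto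
  from R(1) obtain p q where pq: "R = sector n x p q" "sector n x p q \<noteq> {}" by (rule regionE)
  then have "Q (far p = q) (far q = p)" using R assms by simp
  then show "t \<in> (\<Union>(a, b)\<in>{(a, b). Q a b}. class_set a b)"
    using t pq by (auto simp: class_set_def)
next
  fix t assume "t \<in> (\<Union>(a, b)\<in>{(a, b). Q a b}. class_set a b)"
  then obtain p q where t: "t \<in> {0..<1}" "cis (2 * pi * t) \<in> sector n x p q" and Q: "Q (far p = q) (far q = p)"
    by (auto simp: class_set_def)
  then have ne: "sector n x p q \<noteq> {}" by blast
  then have "P (sector n x p q)" using assms Q by simp
  moreover have "sector n x p q \<in> regions n x"
    using ne sector_nonempty[OF t(2)] unfolding regions_eq_sectors by blast
  ultimately show "t \<in> {t \<in> {0..<1}. cis (2 * pi * t) \<in> \<Union>{R \<in> regions n x. P R}}"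
    using t by blast
qed

lemma class_set_measurable: "class_set a b \<in> sets lborel"
proof -
  have "class_set a b = {t \<in> {0..<1}. cis (2 * pi * t) \<in>
      (\<Union>(p, q)\<in>{(p, q). (far p = q) = a \<and> (far q = p) = b}. sector n x p q)}"
    by (auto simp: class_set_def)
  also have "\<dots> \<in> sets lborel"
    by (rule arc_measurable) (auto intro: open_sector)
  finally show ?thesis .
qed

lemma class_set_fmeasurable: "class_set a b \<in> fmeasurable lborel"
proof (rule fmeasurableI2[of "{0..<1::real}"])
  show "{0..<1::real} \<in> fmeasurable lborel" by (rule fmeasurableI) simp_all
  show "class_set a b \<subseteq> {0..<1}" by (auto simp: class_set_def)
qed (rule class_set_measurable)

lemma class_set_disjoint: "t \<in> class_set a b \<Longrightarrow> t \<in> class_set a' b' \<Longrightarrow> a = a' \<and> b = b'"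
  unfolding class_set_def using sector_unique by blast

abbreviation class_length :: "bool \<Rightarrow> bool \<Rightarrow> real" where
  "class_length a b \<equiv> measure lborel (class_set a b)"

lemma class_set_finite: "emeasure lborel (class_set a b) \<noteq> \<infinity>"
  using class_set_fmeasurable[of a b] by (simp add: fmeasurable_def less_top)

lemma class_length_Un:
  assumes "(a, b) \<noteq> (a', b')"
  shows "measure lborel (class_set a b \<union> class_set a' b') = class_length a b + class_length a' b'"
proof (rule measure_Union)
  show "class_set a b \<inter> class_set a' b' = {}"
    using class_set_disjoint[of _ a b a' b'] assms by blast
qed (rule class_set_finite class_set_measurable)+

lemma length_fractions:
  "length_fraction 0 n x = class_length False False"
  "length_fraction 1 n x = class_length True False + class_length False True"
  "length_fraction 2 n x = class_length True True"
  "empty_length_fraction n x = class_length False False + class_length False True"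
proof -
  have L: "length_fraction k n x = measure lborel (\<Union>(a, b)\<in>{(a, b). of_bool a + of_bool b = k}. class_set a b)" for k
    unfolding length_fraction_def
    by (subst sum_arc_length, blast, subst cis_in_Union_regions[where Q="\<lambda>a b. of_bool a + of_bool b = k"])
       (simp_all add: region_type_sector)
  have "{(a, b). of_bool a + of_bool b = (0::nat)} = {(False, False)}"
    "{(a, b). of_bool a + of_bool b = (1::nat)} = {(True, False), (False, True)}"
    "{(a, b). of_bool a + of_bool b = (2::nat)} = {(True, True)}"
    by (auto simp: of_bool_def split: if_splits)
  then show "length_fraction 0 n x = class_length False False"
    "length_fraction 1 n x = class_length True False + class_length False True"
    "length_fraction 2 n x = class_length True True"
    unfolding L by (simp_all add: class_length_Un)
  have "empty_length_fraction n x = measure lborel (\<Union>(a, b)\<in>{(a, b). \<not> a}. class_set a b)"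
    unfolding empty_length_fraction_def
    by (subst sum_arc_length, blast, subst cis_in_Union_regions[where Q="\<lambda>a b. \<not> a"])
       (simp_all add: empty_region_sector)
  also have "{(a, b). \<not> a} = {(False, False), (False, True)}" by auto
  finally show "empty_length_fraction n x = class_length False False + class_length False True"
    by (simp add: class_length_Un)
qed

text \<open>The four sets are disjoint inside \<open>{0..<1}\<close>. The inequality is what later
  turns lower bounds for three of the lengths into an upper bound for the fourth.\<close>

lemma class_length_sum:
  "class_length False False + class_length False True + class_length True False + class_length True True \<le> 1"
proof -
  let ?U = "\<lambda>ab. class_set (fst ab) (snd ab)"
  let ?I = "{(False, False), (False, True), (True, False), (True, True)}"
  have "measure lborel (\<Union>ab\<in>?I. ?U ab) = (\<Sum>ab\<in>?I. measure lborel (?U ab))"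
  proof (rule measure_finite_Union)
    show "disjoint_family_on ?U ?I"
    proof (unfold disjoint_family_on_def, intro ballI impI equals0I)
      fix u v t assume "u \<noteq> v" "t \<in> ?U u \<inter> ?U v"
      then show False
        using class_set_disjoint[of t "fst u" "snd u" "fst v" "snd v"] by (simp add: prod_eq_iff)
    qed
    show "?U ` ?I \<subseteq> sets lborel" by (rule image_subsetI) (rule class_set_measurable)
  qed (simp, rule class_set_finite)
  moreover have "measure lborel (\<Union>ab\<in>?I. ?U ab) \<le> measure lborel {0..<1::real}"
  proof (rule measure_mono_fmeasurable)
    show "(\<Union>ab\<in>?I. ?U ab) \<subseteq> {0..<1}" by (auto simp: class_set_def)
    show "{0..<1::real} \<in> fmeasurable lborel" by (rule fmeasurableI) simp_all
    show "(\<Union>ab\<in>?I. ?U ab) \<in> sets lborel"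
      by (rule sets.finite_UN) (simp, rule class_set_measurable)
  qed
  ultimately show ?thesis by simp
qed

end

section \<open>Signed distance on the circle of length one\<close>

text \<open>The representative of \<open>t\<close> modulo 1 in \<open>{- 1/2..<1/2}\<close>; its
  absolute value is the distance from 0 on the circle of length 1.\<close>

definition wrap :: "real \<Rightarrow> real" where
  "wrap t = t - of_int \<lfloor>t + 1/2\<rfloor>"

lemma wrap_ge: "- 1/2 \<le> wrap t" and wrap_less: "wrap t < 1/2"
  unfolding wrap_def by linarith+

lemma abs_wrap_le_half: "\<bar>wrap t\<bar> \<le> 1/2"
  using wrap_ge[of t] wrap_less[of t] by linarith

lemma wrap_add_int: "wrap (t + of_int k) = wrap t"
proof -
  have "t + of_int k + 1/2 = (t + 1/2) + of_int k" by simp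
  then have "\<lfloor>t + of_int k + 1/2\<rfloor> = \<lfloor>t + 1/2\<rfloor> + k" by (simp only: floor_add_int)
  then show ?thesis by (simp add: wrap_def)
qed

lemma wrap_diff_int: "wrap (t - of_int k) = wrap t"
  using wrap_add_int[of t "- k"] by simp

lemma wrap_plus_one: "wrap (t + 1) = wrap t" and wrap_minus_one: "wrap (t - 1) = wrap t"
  using wrap_add_int[of t 1] wrap_add_int[of t "- 1"] by simp_all

lemma wrap_id: "- 1/2 \<le> t \<Longrightarrow> t < 1/2 \<Longrightarrow> wrap t = t"
  by (simp add: wrap_def floor_eq_iff)

lemma wrap_decomp: obtains k where "t = wrap t + of_int k"
  by (rule that[of "\<lfloor>t + 1/2\<rfloor>"]) (simp add: wrap_def)

text \<open>\<open>wrap t\<close> has size at most 1/2, and every other representative differs from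
  it by at least 1. Triangle inequality and symmetry of the circular distance follow from this
  minimality.\<close>

lemma abs_wrap_le: "\<bar>wrap t\<bar> \<le> \<bar>t - of_int k\<bar>"
proof -
  obtain j where j: "t = wrap t + of_int j" by (rule wrap_decomp)
  show ?thesis
  proof (cases "j = k")
    case True then show ?thesis using j by simp
  next
    case False
    then have "1 \<le> \<bar>real_of_int (j - k)\<bar>" by linarith
    moreover have "t - of_int k = wrap t + of_int (j - k)" using j by simp
    ultimately show ?thesis using abs_wrap_le_half[of t] by linarith
  qed
qed

lemma abs_wrap_add: "\<bar>wrap (s + t)\<bar> \<le> \<bar>wrap s\<bar> + \<bar>wrap t\<bar>"
proof -
  obtain j where j: "s = wrap s + of_int j" by (rule wrap_decomp)
  obtain k where k: "t = wrap t + of_int k" by (rule wrap_decomp)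
  have "s + t - of_int (j + k) = wrap s + wrap t" using j k by simp
  then show ?thesis using abs_wrap_le[of "s + t" "j + k"] by linarith
qed

lemma abs_wrap_minus: "\<bar>wrap (- t)\<bar> = \<bar>wrap t\<bar>"
proof -
  have "\<bar>wrap (- t)\<bar> \<le> \<bar>wrap t\<bar>" for t
  proof -
    obtain k where k: "t = wrap t + of_int k" by (rule wrap_decomp)
    then have "- t - of_int (- k) = - wrap t" by simp
    then show ?thesis using abs_wrap_le[of "- t" "- k"] by simp
  qed
  from this[of t] this[of "- t"] show ?thesis by simp
qed

lemma abs_wrap_commute: "\<bar>wrap (s - t)\<bar> = \<bar>wrap (t - s)\<bar>"
  using abs_wrap_minus[of "s - t"] by simp

lemma wrap_add_id:
  assumes "- 1/2 \<le> wrap s + t" "wrap s + t < 1/2"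
  shows "wrap (s + t) = wrap s + t"
proof -
  obtain k where k: "s = wrap s + of_int k" by (rule wrap_decomp)
  then have "s + t = (wrap s + t) + of_int k" by simp
  then have "wrap (s + t) = wrap (wrap s + t)" by (metis wrap_add_int)
  then show ?thesis using wrap_id[OF assms] by simp
qed

text \<open>The hypothesis keeps the interval of radius \<open>r\<close> around \<open>v\<close>
  away from the cut at 1/2, so there the shift by \<open>v\<close> commutes with wrapping.\<close>

lemma abs_wrap_diff_le_iff:
  assumes "\<bar>v\<bar> + r < 1/2"
  shows "\<bar>wrap (z - v)\<bar> \<le> r \<longleftrightarrow> \<bar>wrap z - v\<bar> \<le> r"
proof
  assume le: "\<bar>wrap (z - v)\<bar> \<le> r"
  have "wrap ((z - v) + v) = wrap (z - v) + v"
    using le assms by (intro wrap_add_id) linarith+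
  then show "\<bar>wrap z - v\<bar> \<le> r" using le by simp
next
  assume le: "\<bar>wrap z - v\<bar> \<le> r"
  obtain k where k: "z = wrap z + of_int k" by (rule wrap_decomp)
  then have "z - v - of_int k = wrap z - v" by simp
  then show "\<bar>wrap (z - v)\<bar> \<le> r" using le abs_wrap_le[of "z - v" k] by simp
qed

lemma abs_wrap_half: "\<bar>wrap (t - 1/2)\<bar> = 1/2 - \<bar>wrap t\<bar>"
proof (cases "0 \<le> wrap t")
  case True
  then have "wrap (t + - 1/2) = wrap t + - 1/2" using wrap_less[of t] by (intro wrap_add_id) auto
  then show ?thesis using True wrap_less[of t] by simp
next
  case False
  then have "wrap (t + 1/2) = wrap t + 1/2" using wrap_ge[of t] by (intro wrap_add_id) auto
  moreover have "wrap (t - 1/2) = wrap (t + 1/2)" using wrap_plus_one[of "t - 1/2"] by (simp add: add.commute)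
  ultimately show ?thesis using False wrap_ge[of t] by simp
qed

lemma cos_wrap: "cos (2 * pi * t) = cos (2 * pi * \<bar>wrap t\<bar>)"
proof -
  obtain k where k: "t = wrap t + of_int k" by (rule wrap_decomp)
  have "cos (2 * pi * (wrap t + of_int k)) = cos (2 * pi * wrap t)"
    unfolding distrib_left cos_add by simp
  moreover have "cos (2 * pi * \<bar>wrap t\<bar>) = cos (2 * pi * wrap t)" by (cases "0 \<le> wrap t") simp_all
  ultimately show ?thesis using k by simp
qed

lemma cos_less_iff_wrap: "cos (2 * pi * s) < cos (2 * pi * t) \<longleftrightarrow> \<bar>wrap t\<bar> < \<bar>wrap s\<bar>"
  unfolding cos_wrap[of s] cos_wrap[of t] using abs_wrap_le_half[of s] abs_wrap_le_half[of t]
  by (subst cos_mono_less_eq) (auto simp: field_simps)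

lemma measurable_wrap[measurable]: "wrap \<in> borel_measurable borel"
  unfolding wrap_def[abs_def] by measurable

section \<open>The uniform law and its invariance under rotation\<close>

definition unit_law :: "real measure" where
  "unit_law = uniform_measure lborel {0..<1}"

lemma prob_space_unit_law: "prob_space unit_law"
  unfolding unit_law_def by (rule prob_space_uniform_measure) simp_all

lemma sets_unit_law[simp, measurable_cong]: "sets unit_law = sets borel"
  by (simp add: unit_law_def)

lemma space_unit_law[simp]: "space unit_law = UNIV"
  by (simp add: unit_law_def)

lemma nn_integral_unit_law:
  assumes "f \<in> borel_measurable borel"
  shows "(\<integral>\<^sup>+t. f t \<partial>unit_law) = (\<integral>\<^sup>+t. f t * indicator {0..<1} t \<partial>lborel)"
  unfolding unit_law_def using assms by (subst nn_integral_uniform_measure) (auto simp: divide_ennreal_def)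

text \<open>The function \<open>wrap (t - s)\<close> jumps inside \<open>{0..<1}\<close> at
  \<open>f\<close>. Moving the piece before the jump by one period gives an interval on which the
  map is a translation onto \<open>{- 1/2..<1/2}\<close>.\<close>

lemma nn_integral_wrap:
  assumes [measurable]: "h \<in> borel_measurable borel"
  shows "(\<integral>\<^sup>+t. h (wrap (t - s)) \<partial>unit_law) = (\<integral>\<^sup>+u. h u * indicator {-1/2..<1/2} u \<partial>lborel)"
proof -
  define f where "f = frac (s - 1/2)"
  have f: "0 \<le> f" "f < 1" by (simp_all add: f_def frac_lt_1)
  define g where "g t = h (wrap (t - s))" for t
  have [measurable]: "g \<in> borel_measurable borel" unfolding g_def[abs_def] by measurable
  have per: "g (1 + t) = g t" for t using wrap_plus_one[of "t - s"] by (simp add: g_def algebra_simps)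
  have ind: "indicator {0..<1} t = (indicator {0..<f} t + indicator {f..<1} t :: ennreal)"
    "indicator {f..<1 + f} t = (indicator {f..<1} t + indicator {1..<1 + f} t :: ennreal)" for t :: real
    using f by (auto simp: indicator_def)
  have "(\<integral>\<^sup>+t. g t * indicator {1..<1 + f} t \<partial>lborel) = (\<integral>\<^sup>+t. g (1 + t) * indicator {1..<1 + f} (1 + t) \<partial>lborel)"
    by (subst nn_integral_real_affine[where t=1 and c=1]) auto
  also have "\<dots> = (\<integral>\<^sup>+t. g t * indicator {0..<f} t \<partial>lborel)"
    by (intro nn_integral_cong) (auto simp: per indicator_def)
  finally have shift: "(\<integral>\<^sup>+t. g t * indicator {1..<1 + f} t \<partial>lborel) = (\<integral>\<^sup>+t. g t * indicator {0..<f} t \<partial>lborel)" .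
  have "(\<integral>\<^sup>+t. h (wrap (t - s)) \<partial>unit_law) = (\<integral>\<^sup>+t. g t * indicator {0..<1} t \<partial>lborel)"
    unfolding g_def by (rule nn_integral_unit_law) measurable
  also have "\<dots> = (\<integral>\<^sup>+t. g t * indicator {0..<f} t \<partial>lborel) + (\<integral>\<^sup>+t. g t * indicator {f..<1} t \<partial>lborel)"
    unfolding ind distrib_left by (rule nn_integral_add) auto
  also have "\<dots> = (\<integral>\<^sup>+t. g t * indicator {f..<1} t \<partial>lborel) + (\<integral>\<^sup>+t. g t * indicator {1..<1 + f} t \<partial>lborel)"
    by (simp only: shift add.commute)
  also have "\<dots> = (\<integral>\<^sup>+t. g t * indicator {f..<1 + f} t \<partial>lborel)"
    unfolding ind distrib_left by (rule nn_integral_add[symmetric]) auto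
  also have "\<dots> = (\<integral>\<^sup>+t. g ((f + 1/2) + t) * indicator {f..<1 + f} ((f + 1/2) + t) \<partial>lborel)"
    by (subst nn_integral_real_affine[where t="f + 1/2" and c=1]) auto
  also have "\<dots> = (\<integral>\<^sup>+u. h u * indicator {-1/2..<1/2} u \<partial>lborel)"
  proof (intro nn_integral_cong)
    fix u :: real
    have "g ((f + 1/2) + u) = h u" if "-1/2 \<le> u" "u < 1/2"
    proof -
      have "(f + 1/2) + u - s = u - of_int \<lfloor>s - 1/2\<rfloor>" by (simp add: f_def frac_def)
      then show ?thesis unfolding g_def by (simp only: wrap_diff_int wrap_id[OF that])
    qed
    then show "g ((f + 1/2) + u) * indicator {f..<1 + f} ((f + 1/2) + u) = h u * indicator {-1/2..<1/2} u"
      by (auto simp: indicator_def)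
  qed
  finally show ?thesis .
qed

section \<open>Nearest points in angular coordinates\<close>

abbreviation cdist :: "real \<Rightarrow> real \<Rightarrow> real" where
  "cdist a b \<equiv> \<bar>wrap (a - b)\<bar>"

definition near :: "nat \<Rightarrow> (nat \<Rightarrow> real) \<Rightarrow> real \<Rightarrow> nat \<Rightarrow> bool" where
  "near n s t p \<longleftrightarrow> p < n \<and> (\<forall>k<n. k \<noteq> p \<longrightarrow> cdist (s p) t < cdist (s k) t)"

lemma near_nearest:
  "nearest n (\<lambda>i. cis (2 * pi * s i)) (cis (2 * pi * t)) p \<longleftrightarrow> near n s t p"
proof -
  have "inner (cis (2 * pi * t)) (cis (2 * pi * u)) = cos (2 * pi * (u - t))" for u
    unfolding right_diff_distrib cos_diff inner_complex_def by (simp add: mult.commute)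
  then show ?thesis by (simp add: nearest_def near_def cos_less_iff_wrap)
qed

lemma uminus_cis: "- cis (2 * pi * t) = cis (2 * pi * (t + 1/2))"
  by (simp add: complex_eq_iff distrib_left)

section \<open>Events determined by two points and an excluded set\<close>

text \<open>Once the points \<open>i\<close> and \<open>j\<close> are fixed, the other
  \<open>n - 2\<close> coordinates are independent and all have to avoid the same set, which
  produces the power.\<close>

lemma emeasure_PiM_pair_rest:
  fixes T :: "'a \<Rightarrow> 'a \<Rightarrow> 'a \<Rightarrow> bool" and i j :: nat
  assumes N: "prob_space N" and ij: "i < n" "j < n" "i \<noteq> j"
    and \<phi>[measurable]: "(\<lambda>(a, b). \<phi> a b) \<in> measurable (N \<Otimes>\<^sub>M N) (count_space UNIV)"
    and T[measurable]: "(\<lambda>(a, b, y). T a b y) \<in> measurable (N \<Otimes>\<^sub>M N \<Otimes>\<^sub>M N) (count_space UNIV)"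
  shows "emeasure (PiM {..<n} (\<lambda>_. N)) {s \<in> space (PiM {..<n} (\<lambda>_. N)). \<phi> (s i) (s j) \<and>
      (\<forall>k<n. k \<noteq> i \<longrightarrow> k \<noteq> j \<longrightarrow> \<not> T (s i) (s j) (s k))} =
    (\<integral>\<^sup>+a. \<integral>\<^sup>+b. indicator {b. \<phi> a b} b * emeasure N {y \<in> space N. \<not> T a b y} ^ (n - 2) \<partial>N \<partial>N)"
proof -
  interpret N: prob_space N by fact
  interpret P: product_prob_space "\<lambda>_::nat. N" UNIV by (simp add: N product_prob_spaceI)
  define K where "K = {..<n} - {i, j}"
  have K: "finite K" "i \<notin> insert j K" "j \<notin> K" "{..<n} = insert i (insert j K)" "card K = n - 2"
    using ij by (auto simp: K_def card_Diff_subset)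
  let ?P = "PiM {..<n} (\<lambda>_. N)"
  define E where "E = {s \<in> space ?P. \<phi> (s i) (s j) \<and> (\<forall>k<n. k \<noteq> i \<longrightarrow> k \<noteq> j \<longrightarrow> \<not> T (s i) (s j) (s k))}"
  have [measurable]: "(\<lambda>s. s k) \<in> measurable ?P N" if "k < n" for k
    using that by (intro measurable_component_singleton) auto
  have m1: "Measurable.pred ?P (\<lambda>s. \<phi> (s i) (s j))"
    using measurable_compose[OF measurable_Pair[of "\<lambda>s. s i" ?P N "\<lambda>s. s j" N] \<phi>] ij by simp
  have m2: "Measurable.pred ?P (\<lambda>s. T (s i) (s j) (s k))" if "k < n" for k
    using measurable_compose[OF measurable_Pair[of "\<lambda>s. s i" ?P N "\<lambda>s. (s j, s k)"] T] ij that by simp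
  have "E = {s \<in> space ?P. \<phi> (s i) (s j) \<and> (\<forall>k\<in>K. \<not> T (s i) (s j) (s k))}"
    by (auto simp: E_def K_def)
  also have "\<dots> \<in> sets ?P"
  proof -
    have "Measurable.pred ?P (\<lambda>s. \<forall>k\<in>K. \<not> T (s i) (s j) (s k))"
      using m2 K(1) by (intro pred_intros_finite pred_intros_logic) (auto simp: K_def)
    then show ?thesis using m1 by measurable
  qed
  finally have E: "E \<in> sets ?P" .
  have sec: "(\<lambda>y. indicator {y. \<not> T a b y} y :: ennreal) \<in> borel_measurable N" if "a \<in> space N" "b \<in> space N" for a b
  proof -
    have "Measurable.pred N (\<lambda>y. T a b y)"
      using measurable_compose[OF _ T, of "\<lambda>y. (a, b, y)" N] that by simp
    then show ?thesis by measurable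
  qed
  have "emeasure ?P E = (\<integral>\<^sup>+s. indicator E s \<partial>?P)"
    using E by simp
  also have "\<dots> = (\<integral>\<^sup>+a. \<integral>\<^sup>+s. indicator E (s(i := a)) \<partial>PiM (insert j K) (\<lambda>_. N) \<partial>N)"
    unfolding K(4) using K E by (intro P.product_nn_integral_insert_rev) (auto simp flip: K(4))
  also have "\<dots> = (\<integral>\<^sup>+a. \<integral>\<^sup>+b. \<integral>\<^sup>+s. indicator E (s(j := b, i := a)) \<partial>PiM K (\<lambda>_. N) \<partial>N \<partial>N)"
  proof (intro nn_integral_cong P.product_nn_integral_insert_rev)
    fix a assume "a \<in> space N"
    have "(\<lambda>s. s(i := a)) \<in> measurable (PiM (insert j K) (\<lambda>_. N)) ?P"
      unfolding K(4) using measurable_compose[OF measurable_Pair2'[OF _] measurable_add_dim]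
      using \<open>a \<in> space N\<close> by (intro measurable_fun_upd[where J="insert j K"]) auto
    from measurable_compose[OF this borel_measurable_indicator[OF E]]
    show "(\<lambda>s. indicator E (s(i := a)) :: ennreal) \<in> borel_measurable (PiM (insert j K) (\<lambda>_. N))" .
  qed (use K in auto)
  also have "\<dots> = (\<integral>\<^sup>+a. \<integral>\<^sup>+b. indicator {b. \<phi> a b} b * emeasure N {y \<in> space N. \<not> T a b y} ^ (n - 2) \<partial>N \<partial>N)"
  proof (intro nn_integral_cong)
    fix a b assume ab: "a \<in> space N" "b \<in> space N"
    have "indicator E (s(j := b, i := a)) = indicator {b. \<phi> a b} b * (\<Prod>k\<in>K. indicator {y. \<not> T a b y} (s k) :: ennreal)"
      if s: "s \<in> space (PiM K (\<lambda>_. N))" for s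
    proof -
      have "s(j := b, i := a) \<in> space ?P"
        using s ab unfolding K(4) by (auto simp: space_PiM PiE_iff extensional_def)
      moreover have "(\<forall>k<n. k \<noteq> i \<longrightarrow> k \<noteq> j \<longrightarrow> \<not> T a b (s k)) \<longleftrightarrow> (\<forall>k\<in>K. \<not> T a b (s k))"
        by (auto simp: K_def)
      moreover have "(\<Prod>k\<in>K. indicator {y. \<not> T a b y} (s k) :: ennreal) = of_bool (\<forall>k\<in>K. \<not> T a b (s k))"
        using K(1) by (induction K rule: finite_induct) (auto simp: indicator_def)
      ultimately show ?thesis
        using ij(3) by (auto simp: E_def indicator_def)
    qed
    then have "(\<integral>\<^sup>+s. indicator E (s(j := b, i := a)) \<partial>PiM K (\<lambda>_. N)) =
        (\<integral>\<^sup>+s. indicator {b. \<phi> a b} b * (\<Prod>k\<in>K. indicator {y. \<not> T a b y} (s k)) \<partial>PiM K (\<lambda>_. N))"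
      by (intro nn_integral_cong) auto
    also have "\<dots> = indicator {b. \<phi> a b} b * (\<integral>\<^sup>+s. (\<Prod>k\<in>K. indicator {y. \<not> T a b y} (s k)) \<partial>PiM K (\<lambda>_. N))"
    proof (rule nn_integral_cmult)
      show "(\<lambda>s. \<Prod>k\<in>K. indicator {y. \<not> T a b y} (s k) :: ennreal) \<in> borel_measurable (PiM K (\<lambda>_. N))"
        by (intro borel_measurable_prod_ennreal measurable_compose[OF _ sec[OF ab]] measurable_component_singleton)
    qed
    also have "(\<integral>\<^sup>+s. (\<Prod>k\<in>K. indicator {y. \<not> T a b y} (s k)) \<partial>PiM K (\<lambda>_. N)) =
        (\<Prod>k\<in>K. \<integral>\<^sup>+y. indicator {y. \<not> T a b y} y \<partial>N)"
      using K(1) sec[OF ab] by (intro P.product_nn_integral_prod) auto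
    also have "(\<integral>\<^sup>+y. indicator {y. \<not> T a b y} y \<partial>N) = emeasure N {y \<in> space N. \<not> T a b y}"
    proof -
      have "Measurable.pred N (\<lambda>y. T a b y)"
        using measurable_compose[OF _ T, of "\<lambda>y. (a, b, y)" N] ab by simp
      then have "{y \<in> space N. \<not> T a b y} \<in> sets N" by measurable
      then have "emeasure N {y \<in> space N. \<not> T a b y} = (\<integral>\<^sup>+y. indicator {y \<in> space N. \<not> T a b y} y \<partial>N)" by simp
      also have "\<dots> = (\<integral>\<^sup>+y. indicator {y. \<not> T a b y} y \<partial>N)"
        by (intro nn_integral_cong) (auto simp: indicator_def)
      finally show ?thesis by simp
    qed
    finally show "(\<integral>\<^sup>+s. indicator E (s(j := b, i := a)) \<partial>PiM K (\<lambda>_. N)) =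
        indicator {b. \<phi> a b} b * emeasure N {y \<in> space N. \<not> T a b y} ^ (n - 2)"
      unfolding prod_constant K(5) .
  qed
  finally show ?thesis by (simp only: E_def)
qed

section \<open>The limiting integrals\<close>

text \<open>The length of the smallest interval containing 0, \<open>u\<close> and
  \<open>v\<close>.\<close>

definition reach :: "real \<Rightarrow> real \<Rightarrow> real" where
  "reach u v = max 0 (max u v) - min 0 (min u v)"

text \<open>The length of the set avoided by all other points when \<open>p\<close>, at displacement \<open>u\<close> from \<open>z\<close>, is nearest
  to \<open>z\<close> and \<open>q\<close>, at displacement \<open>v\<close> from \<open>- z\<close>, is nearest to \<open>- z\<close>; with \<open>c\<close> also \<open>q\<close> is nearest to
  \<open>- p\<close>, and with \<open>d\<close> also \<open>p\<close> is nearest to \<open>- q\<close>.\<close>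

definition excluded_length :: "bool \<Rightarrow> bool \<Rightarrow> real \<Rightarrow> real \<Rightarrow> real" where
  "excluded_length c d u v = 2 * (if c then reach u v else \<bar>v\<bar>) + 2 * (if d then reach u v else \<bar>u\<bar>)"

lemma measurable_excluded_length[measurable]:
  assumes [measurable]: "f \<in> borel_measurable M" "g \<in> borel_measurable M"
  shows "(\<lambda>x. excluded_length c d (f x) (g x)) \<in> borel_measurable M"
  unfolding excluded_length_def reach_def by (cases c; cases d; simp; measurable)

lemma nn_integral_split_sign:
  fixes F :: "real \<Rightarrow> ennreal"
  assumes [measurable]: "F \<in> borel_measurable borel"
  shows "(\<integral>\<^sup>+a. F a \<partial>lborel) =
    (\<integral>\<^sup>+a. F a * indicator {0<..} a \<partial>lborel) + (\<integral>\<^sup>+a. F (- a) * indicator {0<..} a \<partial>lborel)"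
proof -
  have "(\<integral>\<^sup>+a. F a \<partial>lborel) = (\<integral>\<^sup>+a. F a * indicator {0<..} a + F a * indicator {..<0} a \<partial>lborel)"
    by (rule nn_integral_cong_AE) (use AE_lborel_singleton[of 0] in \<open>auto simp: indicator_def\<close>)
  also have "\<dots> = (\<integral>\<^sup>+a. F a * indicator {0<..} a \<partial>lborel) + (\<integral>\<^sup>+a. F a * indicator {..<0} a \<partial>lborel)"
    by (rule nn_integral_add) auto
  also have "(\<integral>\<^sup>+a. F a * indicator {..<0} a \<partial>lborel) = (\<integral>\<^sup>+a. F (- a) * indicator {..<0} (- a) \<partial>lborel)"
    by (subst nn_integral_real_affine[where t=0 and c="- 1"]) auto
  also have "\<dots> = (\<integral>\<^sup>+a. F (- a) * indicator {0<..} a \<partial>lborel)"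
    by (intro nn_integral_cong) (auto simp: indicator_def)
  finally show ?thesis .
qed

definition quadrant :: "(real \<Rightarrow> real \<Rightarrow> ennreal) \<Rightarrow> ennreal" where
  "quadrant f = (\<integral>\<^sup>+u. (\<integral>\<^sup>+v. f u v * indicator {0<..} v \<partial>lborel) * indicator {0<..} u \<partial>lborel)"

lemma nn_integral_shift_Ioi:
  fixes F :: "real \<Rightarrow> ennreal"
  assumes [measurable]: "F \<in> borel_measurable borel"
  shows "(\<integral>\<^sup>+b. F b * indicator {a<..} b \<partial>lborel) = (\<integral>\<^sup>+v. F (a + v) * indicator {0<..} v \<partial>lborel)"
proof -
  have "(\<integral>\<^sup>+b. F b * indicator {a<..} b \<partial>lborel) = (\<integral>\<^sup>+v. F (a + v) * indicator {a<..} (a + v) \<partial>lborel)"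
    by (subst nn_integral_real_affine[where t=a and c=1]) auto
  also have "\<dots> = (\<integral>\<^sup>+v. F (a + v) * indicator {0<..} v \<partial>lborel)"
    by (intro nn_integral_cong) (auto simp: indicator_def)
  finally show ?thesis .
qed

text \<open>The quadrant is cut along the diagonal and each half is sheared back onto the quadrant.
  For the half below the diagonal the order of integration is exchanged first.\<close>

lemma quadrant_cones:
  assumes f[measurable]: "(\<lambda>(u, v). f u v) \<in> borel_measurable (borel \<Otimes>\<^sub>M borel)"
  shows "quadrant f = quadrant (\<lambda>u v. f u (u + v)) + quadrant (\<lambda>u v. f (u + v) u)"
proof -
  have "quadrant f = (\<integral>\<^sup>+u. (\<integral>\<^sup>+v. f u v * indicator {u<..} v \<partial>lborel) * indicator {0<..} u +
      (\<integral>\<^sup>+v. f u v * indicator {0<..<u} v * indicator {0<..} u \<partial>lborel) \<partial>lborel)"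
    unfolding quadrant_def
  proof (intro nn_integral_cong)
    fix u :: real
    have "(\<integral>\<^sup>+v. f u v * indicator {0<..} v \<partial>lborel) * indicator {0<..} u =
        (\<integral>\<^sup>+v. f u v * indicator {0<..} v * indicator {0<..} u \<partial>lborel)"
      by (rule nn_integral_multc[symmetric]) measurable
    also have "\<dots> = (\<integral>\<^sup>+v. f u v * indicator {u<..} v * indicator {0<..} u + f u v * indicator {0<..<u} v * indicator {0<..} u \<partial>lborel)"
      by (rule nn_integral_cong_AE) (use AE_lborel_singleton[of u] in \<open>auto simp: indicator_def\<close>)
    also have "\<dots> = (\<integral>\<^sup>+v. f u v * indicator {u<..} v * indicator {0<..} u \<partial>lborel) +
        (\<integral>\<^sup>+v. f u v * indicator {0<..<u} v * indicator {0<..} u \<partial>lborel)"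
      by (rule nn_integral_add) measurable
    also have "(\<integral>\<^sup>+v. f u v * indicator {u<..} v * indicator {0<..} u \<partial>lborel) =
        (\<integral>\<^sup>+v. f u v * indicator {u<..} v \<partial>lborel) * indicator {0<..} u"
      by (rule nn_integral_multc) measurable
    finally show "(\<integral>\<^sup>+v. f u v * indicator {0<..} v \<partial>lborel) * indicator {0<..} u =
        (\<integral>\<^sup>+v. f u v * indicator {u<..} v \<partial>lborel) * indicator {0<..} u +
        (\<integral>\<^sup>+v. f u v * indicator {0<..<u} v * indicator {0<..} u \<partial>lborel)" .
  qed
  also have "\<dots> = (\<integral>\<^sup>+u. (\<integral>\<^sup>+v. f u v * indicator {u<..} v \<partial>lborel) * indicator {0<..} u \<partial>lborel) +
      (\<integral>\<^sup>+u. \<integral>\<^sup>+v. f u v * indicator {0<..<u} v * indicator {0<..} u \<partial>lborel \<partial>lborel)"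
    by (rule nn_integral_add) (simp_all add: indicator_def lborel.borel_measurable_nn_integral)
  also have "(\<integral>\<^sup>+u. (\<integral>\<^sup>+v. f u v * indicator {u<..} v \<partial>lborel) * indicator {0<..} u \<partial>lborel) = quadrant (\<lambda>u v. f u (u + v))"
    unfolding quadrant_def by (intro nn_integral_cong arg_cong2[where f="(*)"] nn_integral_shift_Ioi refl) measurable
  also have "(\<integral>\<^sup>+u. \<integral>\<^sup>+v. f u v * indicator {0<..<u} v * indicator {0<..} u \<partial>lborel \<partial>lborel) =
      (\<integral>\<^sup>+v. \<integral>\<^sup>+u. f u v * indicator {0<..<u} v * indicator {0<..} u \<partial>lborel \<partial>lborel)"
    by (rule lborel_pair.Fubini') (simp add: indicator_def)
  also have "\<dots> = (\<integral>\<^sup>+v. (\<integral>\<^sup>+u. f u v * indicator {v<..} u \<partial>lborel) * indicator {0<..} v \<partial>lborel)"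
  proof (intro nn_integral_cong)
    fix v :: real
    have "(\<integral>\<^sup>+u. f u v * indicator {0<..<u} v * indicator {0<..} u \<partial>lborel) =
        (\<integral>\<^sup>+u. f u v * indicator {v<..} u * indicator {0<..} v \<partial>lborel)"
      by (intro nn_integral_cong) (auto simp: indicator_def)
    also have "\<dots> = (\<integral>\<^sup>+u. f u v * indicator {v<..} u \<partial>lborel) * indicator {0<..} v"
      by (rule nn_integral_multc) measurable
    finally show "(\<integral>\<^sup>+u. f u v * indicator {0<..<u} v * indicator {0<..} u \<partial>lborel) =
      (\<integral>\<^sup>+u. f u v * indicator {v<..} u \<partial>lborel) * indicator {0<..} v" .
  qed
  also have "\<dots> = quadrant (\<lambda>u v. f (u + v) u)"
    unfolding quadrant_def by (intro nn_integral_cong arg_cong2[where f="(*)"] nn_integral_shift_Ioi refl) measurable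
  finally show ?thesis .
qed

text \<open>Reflection in the origin pairs the half-planes \<open>u > 0\<close> and
  \<open>u < 0\<close>. The half-plane \<open>u > 0\<close> splits into a quadrant and two cones
  because \<open>excluded_length\<close> is linear on each of these three pieces.\<close>

lemma nn_integral_plane:
  assumes f[measurable]: "(\<lambda>(u, v). f u v) \<in> borel_measurable (borel \<Otimes>\<^sub>M borel)"
    and sym: "\<And>u v. f (- u) (- v) = f u v"
  shows "(\<integral>\<^sup>+u. \<integral>\<^sup>+v. f u v \<partial>lborel \<partial>lborel) =
    2 * (quadrant (\<lambda>u v. f u (- v)) + quadrant (\<lambda>u v. f u (u + v)) + quadrant (\<lambda>u v. f (u + v) u))"
proof -
  have reflect: "(\<integral>\<^sup>+v. f (- u) v \<partial>lborel) = (\<integral>\<^sup>+v. f u v \<partial>lborel)" for u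
  proof -
    have "(\<integral>\<^sup>+v. f (- u) v \<partial>lborel) = (\<integral>\<^sup>+v. f (- u) (- v) \<partial>lborel)"
      by (subst nn_integral_real_affine[where t=0 and c="- 1"]) auto
    then show ?thesis by (simp add: sym)
  qed
  have "(\<integral>\<^sup>+u. \<integral>\<^sup>+v. f u v \<partial>lborel \<partial>lborel) =
      2 * (\<integral>\<^sup>+u. (\<integral>\<^sup>+v. f u v \<partial>lborel) * indicator {0<..} u \<partial>lborel)"
    by (subst nn_integral_split_sign) (simp_all add: reflect mult_2 lborel.borel_measurable_nn_integral)
  also have "(\<integral>\<^sup>+u. (\<integral>\<^sup>+v. f u v \<partial>lborel) * indicator {0<..} u \<partial>lborel) =
      (\<integral>\<^sup>+u. (\<integral>\<^sup>+v. f u v * indicator {0<..} v \<partial>lborel) * indicator {0<..} u +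
        (\<integral>\<^sup>+v. f u (- v) * indicator {0<..} v \<partial>lborel) * indicator {0<..} u \<partial>lborel)"
    by (intro nn_integral_cong, subst nn_integral_split_sign) (simp_all add: distrib_right)
  also have "\<dots> = quadrant f + quadrant (\<lambda>u v. f u (- v))"
    unfolding quadrant_def by (rule nn_integral_add) (simp_all add: lborel.borel_measurable_nn_integral)
  finally show ?thesis unfolding quadrant_cones[OF f] by (simp add: add_ac)
qed

lemma nn_integral_exp_Ioi:
  assumes "0 < c"
  shows "(\<integral>\<^sup>+x. ennreal (exp (- c * x)) * indicator {0<..} x \<partial>lborel) = ennreal (1 / c)"
proof -
  have "1 = (\<integral>\<^sup>+x. ennreal (exp (- x)) * indicator {0..} x \<partial>lborel)"
    using nn_intergal_power_times_exp_Ici[of 0] by simp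
  also have "\<dots> = (\<integral>\<^sup>+x. ennreal (exp (- x)) * indicator {0<..} x \<partial>lborel)"
    by (rule nn_integral_cong_AE) (use AE_lborel_singleton[of 0] in \<open>auto simp: indicator_def\<close>)
  also have "\<dots> = ennreal c * (\<integral>\<^sup>+x. ennreal (exp (- (c * x))) * indicator {0<..} (c * x) \<partial>lborel)"
    using assms by (subst nn_integral_real_affine[where t=0 and c=c]) auto
  also have "(\<integral>\<^sup>+x. ennreal (exp (- (c * x))) * indicator {0<..} (c * x) \<partial>lborel) =
      (\<integral>\<^sup>+x. ennreal (exp (- c * x)) * indicator {0<..} x \<partial>lborel)"
    using assms by (intro nn_integral_cong) (auto simp: indicator_def zero_less_mult_iff)
  finally have "ennreal (1 / c) = ennreal (1 / c) * ennreal c * (\<integral>\<^sup>+x. ennreal (exp (- c * x)) * indicator {0<..} x \<partial>lborel)"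
    by (simp add: mult.assoc flip: \<open>1 = _\<close>)
  also have "ennreal (1 / c) * ennreal c = 1"
    using assms by (simp flip: ennreal_mult)
  finally show ?thesis by simp
qed

lemma quadrant_exp:
  assumes "0 < a" "0 < b" "\<And>u v. 0 < u \<Longrightarrow> 0 < v \<Longrightarrow> f u v = ennreal (exp (- (a * u + b * v)))"
  shows "quadrant f = ennreal (1 / (a * b))"
proof -
  have "quadrant f = (\<integral>\<^sup>+u. ennreal (1 / b) * (ennreal (exp (- a * u)) * indicator {0<..} u) \<partial>lborel)"
    unfolding quadrant_def
  proof (intro nn_integral_cong)
    fix u :: real
    have "(\<integral>\<^sup>+v. f u v * indicator {0<..} v \<partial>lborel) = ennreal (exp (- a * u)) * ennreal (1 / b)" if "0 < u"
    proof -
      have "(\<integral>\<^sup>+v. f u v * indicator {0<..} v \<partial>lborel) =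
          (\<integral>\<^sup>+v. ennreal (exp (- a * u)) * (ennreal (exp (- b * v)) * indicator {0<..} v) \<partial>lborel)"
      proof (intro nn_integral_cong)
        fix v :: real
        have "ennreal (exp (- (a * u + b * v))) = ennreal (exp (- a * u)) * ennreal (exp (- b * v))"
          by (simp add: ennreal_mult[symmetric] exp_add[symmetric])
        then show "f u v * indicator {0<..} v = ennreal (exp (- a * u)) * (ennreal (exp (- b * v)) * indicator {0<..} v)"
          using that assms(3)[of u v] by (cases "0 < v") simp_all
      qed
      also have "\<dots> = ennreal (exp (- a * u)) * ennreal (1 / b)"
        by (subst nn_integral_cmult) (simp_all only: nn_integral_exp_Ioi[OF assms(2)], measurable)
      finally show ?thesis .
    qed
    then show "(\<integral>\<^sup>+v. f u v * indicator {0<..} v \<partial>lborel) * indicator {0<..} u =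
        ennreal (1 / b) * (ennreal (exp (- a * u)) * indicator {0<..} u)"
      by (cases "0 < u") (auto simp: mult_ac)
  qed
  also have "\<dots> = ennreal (1 / b) * ennreal (1 / a)"
    by (subst nn_integral_cmult) (simp_all only: nn_integral_exp_Ioi[OF assms(1)], measurable)
  finally show ?thesis using assms by (simp add: ennreal_mult[symmetric] mult.commute)
qed

text \<open>On each piece the exponent is \<open>a * u + b * v\<close> and the integral is
  \<open>1 / (a * b)\<close>. The pairs of coefficients are \<open>(?c, ?d)\<close>,
  \<open>(4, ?d)\<close> and \<open>(4, ?c)\<close>.\<close>

lemma nn_integral_exp_excluded_length:
  "(\<integral>\<^sup>+u. \<integral>\<^sup>+v. ennreal (exp (- excluded_length c d u v)) \<partial>lborel \<partial>lborel) =
    ennreal (if c then if d then 3/8 else 5/8 else if d then 5/8 else 1)"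
proof -
  let ?c = "if c then 4 else 2 :: real" and ?d = "if d then 4 else 2 :: real"
  let ?f = "\<lambda>u v. ennreal (exp (- excluded_length c d u v))"
  have 1: "quadrant (\<lambda>u v. ?f u (- v)) = ennreal (1 / (?c * ?d))"
    by (rule quadrant_exp) (auto simp: excluded_length_def reach_def algebra_simps)
  have 2: "quadrant (\<lambda>u v. ?f u (u + v)) = ennreal (1 / (4 * ?d))"
    by (rule quadrant_exp) (auto simp: excluded_length_def reach_def algebra_simps)
  have 3: "quadrant (\<lambda>u v. ?f (u + v) u) = ennreal (1 / (4 * ?c))"
    by (rule quadrant_exp) (auto simp: excluded_length_def reach_def algebra_simps)
  have "(\<integral>\<^sup>+u. \<integral>\<^sup>+v. ?f u v \<partial>lborel \<partial>lborel) = 2 * (ennreal (1 / (?c * ?d)) + ennreal (1 / (4 * ?d)) + ennreal (1 / (4 * ?c)))"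
    unfolding 1[symmetric] 2[symmetric] 3[symmetric]
  proof (rule nn_integral_plane)
    show "?f (- u) (- v) = ?f u v" for u v
      by (auto simp: excluded_length_def reach_def max_def min_def)
  qed measurable
  also have "\<dots> = ennreal (2 * (1 / (?c * ?d) + 1 / (4 * ?d) + 1 / (4 * ?c)))"
  proof -
    have "2 * (ennreal x + ennreal y + ennreal z) = ennreal (2 * (x + y + z))"
      if "0 \<le> x" "0 \<le> y" "0 \<le> z" for x y z
      using that by (simp add: ennreal_mult)
    then show ?thesis by simp
  qed
  also have "\<dots> = ennreal (if c then if d then 3/8 else 5/8 else if d then 5/8 else 1)"
    by (rule arg_cong[where f=ennreal]) auto
  finally show ?thesis .
qed

lemma excluded_length_nonneg: "0 \<le> excluded_length c d u v"
  by (auto simp: excluded_length_def reach_def)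

lemma excluded_length_le:
  assumes "\<bar>u\<bar> \<le> w" "\<bar>v\<bar> \<le> w"
  shows "excluded_length c d u v \<le> 8 * w"
  using assms by (auto simp: excluded_length_def reach_def)

lemma excluded_length_scale: "0 \<le> r \<Longrightarrow> excluded_length c d (r * u) (r * v) = r * excluded_length c d u v"
  by (auto simp: excluded_length_def reach_def abs_mult max_def min_def mult_le_0_iff zero_le_mult_iff
      algebra_simps mult_le_cancel_left)

text \<open>The base is at least 1/2, so dropping two of the \<open>n\<close> factors costs at most
  a factor 4. This provides the dominating function for the scaled integrals.\<close>

lemma power_minus_two_bound:
  fixes x :: real
  assumes "0 \<le> x" "x \<le> real n / 2" "2 \<le> n"
  shows "(1 - x / n) ^ (n - 2) \<le> 4 * exp (- x)"
proof -
  have n: "0 < real n" using assms by simp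
  define t where "t = 1 - x / n"
  have t: "1/2 \<le> t" using assms n by (simp add: t_def field_simps)
  have "t \<le> exp (- (x / n))" unfolding t_def using exp_ge_add_one_self[of "- (x / n)"] by simp
  then have "t ^ n \<le> exp (- (x / n)) ^ n" using t by (intro power_mono) auto
  also have "\<dots> = exp (- x)" using n by (simp flip: exp_of_nat_mult)
  finally have "t ^ n \<le> exp (- x)" .
  moreover have "t ^ n = t ^ (n - 2) * t ^ 2" using assms(3) by (metis le_add_diff_inverse2 power_add)
  moreover have "t ^ (n - 2) * (1/4) \<le> t ^ (n - 2) * t ^ 2"
    using t power_mono[of "1/2" t 2] by (intro mult_left_mono) (auto simp: power2_eq_square)
  ultimately show ?thesis unfolding t_def by linarith
qed

lemma power_minus_two_limit: "(\<lambda>n. (1 - x / real n) ^ (n - 2)) \<longlonglongrightarrow> exp (- x)" for x :: real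
proof -
  have 1: "(\<lambda>n. (1 + (- x) / real n) ^ n) \<longlonglongrightarrow> exp (- x)"
    by (rule tendsto_exp_limit_sequentially)
  have 0: "(\<lambda>n. 1 - x / real n) \<longlonglongrightarrow> 1 - 0"
    by (intro tendsto_diff tendsto_const lim_const_over_n)
  have "(\<lambda>n. (1 + (- x) / real n) ^ n / (1 - x / real n) ^ 2) \<longlonglongrightarrow> exp (- x) / (1 - 0) ^ 2"
    by (intro tendsto_divide tendsto_power 0 1) simp
  moreover have "\<forall>\<^sub>F n in sequentially. (1 + (- x) / real n) ^ n / (1 - x / real n) ^ 2 = (1 - x / real n) ^ (n - 2)"
  proof -
    have "\<forall>\<^sub>F n in sequentially. 0 < 1 - x / real n" using order_tendstoD(1)[OF 0, of 0] by simp
    with eventually_ge_at_top[of 2] show ?thesis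
    proof eventually_elim
      fix n :: nat assume n: "2 \<le> n" "0 < 1 - x / real n"
      have e: "(1 - x / real n) ^ n = (1 - x / real n) ^ (n - 2) * (1 - x / real n) ^ 2"
        using n(1) by (metis le_add_diff_inverse2 power_add)
      have t: "1 + (- x) / real n = 1 - x / real n" by simp
      show "(1 + (- x) / real n) ^ n / (1 - x / real n) ^ 2 = (1 - x / real n) ^ (n - 2)"
        unfolding t e by (rule nonzero_mult_div_cancel_right) (use n in \<open>auto simp: field_simps\<close>)
    qed
  qed
  ultimately show ?thesis by (simp add: tendsto_cong)
qed

text \<open>The substitution \<open>u = a / n\<close>, \<open>v = b / n\<close> absorbs the factor
  \<open>real n ^ 2\<close>, since \<open>excluded_length\<close> is homogeneous of degree 1. The
  scaled box exhausts the plane because \<open>n * w n\<close> tends to infinity.\<close>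

lemma box_integral_limit:
  fixes w :: "nat \<Rightarrow> real"
  assumes w: "\<And>n. w n \<le> 1/16" and wn: "filterlim (\<lambda>n. real n * w n) at_top sequentially"
  shows "(\<lambda>n. ennreal (real n ^ 2) * (\<integral>\<^sup>+u. \<integral>\<^sup>+v. ennreal ((1 - excluded_length c d u v) ^ (n - 2)) *
      indicator {- w n..w n} u * indicator {- w n..w n} v \<partial>lborel \<partial>lborel)) \<longlonglongrightarrow>
    ennreal (if c then if d then 3/8 else 5/8 else if d then 5/8 else 1)"
proof -
  let ?S = "excluded_length c d"
  define h where "h n = (\<lambda>(a, b). ennreal ((1 - ?S a b / real n) ^ (n - 2)) *
      indicator {- (real n * w n)..real n * w n} a * indicator {- (real n * w n)..real n * w n} b)" for n
  define f where "f = (\<lambda>(a, b). ennreal (exp (- ?S a b)))"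
  have [measurable]: "h n \<in> borel_measurable (lborel \<Otimes>\<^sub>M lborel)" for n
    unfolding h_def by measurable
  have fm[measurable]: "f \<in> borel_measurable (lborel \<Otimes>\<^sub>M lborel)"
    unfolding f_def by measurable
  have If: "integral\<^sup>N (lborel \<Otimes>\<^sub>M lborel) f = ennreal (if c then if d then 3/8 else 5/8 else if d then 5/8 else 1)"
    unfolding lborel.nn_integral_fst[OF fm, symmetric] by (simp add: f_def nn_integral_exp_excluded_length)
  \<comment> \<open>Shifting the index by 2 makes \<open>power_minus_two_bound\<close> available for
    every term.\<close>
  have "(\<lambda>n. integral\<^sup>N (lborel \<Otimes>\<^sub>M lborel) (h (n + 2))) \<longlonglongrightarrow> integral\<^sup>N (lborel \<Otimes>\<^sub>M lborel) f"
  proof (rule nn_integral_dominated_convergence[where w="\<lambda>p. 4 * f p"])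
    show "(\<integral>\<^sup>+p. 4 * f p \<partial>(lborel \<Otimes>\<^sub>M lborel)) < \<infinity>"
      by (subst nn_integral_cmult) (simp_all add: If ennreal_mult_less_top)
    show "AE p in lborel \<Otimes>\<^sub>M lborel. h (n + 2) p \<le> 4 * f p" for n
    proof (rule AE_I2)
      fix p :: "real \<times> real"
      obtain a b where p: "p = (a, b)" by (cases p)
      let ?m = "real (n + 2)"
      show "h (n + 2) p \<le> 4 * f p"
      proof (cases "\<bar>a\<bar> \<le> ?m * w (n + 2) \<and> \<bar>b\<bar> \<le> ?m * w (n + 2)")
        case True
        \<comment> \<open>The bound 1/16 on \<open>w\<close> fits exactly here: 8 times 1/16 is the
          1/2 that \<open>power_minus_two_bound\<close> asks for.\<close>
        have "?S a b \<le> 8 * (?m * w (n + 2))" using True by (intro excluded_length_le) auto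
        also have "\<dots> \<le> ?m / 2" using mult_left_mono[OF w[of "n + 2"], of ?m] by simp
        finally have "(1 - ?S a b / ?m) ^ (n + 2 - 2) \<le> 4 * exp (- ?S a b)"
          by (intro power_minus_two_bound excluded_length_nonneg) auto
        then have "ennreal ((1 - ?S a b / ?m) ^ (n + 2 - 2)) \<le> ennreal (4 * exp (- ?S a b))"
          by (rule ennreal_leI)
        then show ?thesis using True by (simp add: p h_def f_def ennreal_mult indicator_def abs_le_iff)
      next
        case False
        then show ?thesis by (auto simp: p h_def indicator_def abs_le_iff)
      qed
    qed
    show "AE p in lborel \<Otimes>\<^sub>M lborel. (\<lambda>n. h (n + 2) p) \<longlonglongrightarrow> f p"
    proof (rule AE_I2)
      fix p :: "real \<times> real"
      obtain a b where p: "p = (a, b)" by (cases p)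
      have "\<forall>\<^sub>F n in sequentially. max \<bar>a\<bar> \<bar>b\<bar> \<le> real n * w n"
        using wn unfolding filterlim_at_top by (rule spec)
      then have "\<forall>\<^sub>F n in sequentially. ennreal ((1 - ?S a b / real n) ^ (n - 2)) = h n p"
        by eventually_elim (auto simp: p h_def indicator_def abs_le_iff)
      moreover have "(\<lambda>n. ennreal ((1 - ?S a b / real n) ^ (n - 2))) \<longlonglongrightarrow> ennreal (exp (- ?S a b))"
        by (intro tendsto_ennrealI power_minus_two_limit)
      ultimately have "(\<lambda>n. h n p) \<longlonglongrightarrow> f p" by (simp add: p f_def tendsto_cong)
      then show "(\<lambda>n. h (n + 2) p) \<longlonglongrightarrow> f p" by (rule LIMSEQ_ignore_initial_segment)
    qed
  qed measurable
  then have lim: "(\<lambda>n. integral\<^sup>N (lborel \<Otimes>\<^sub>M lborel) (h n)) \<longlonglongrightarrow> integral\<^sup>N (lborel \<Otimes>\<^sub>M lborel) f"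
    by (rule LIMSEQ_offset)
  have "\<forall>\<^sub>F n in sequentially. integral\<^sup>N (lborel \<Otimes>\<^sub>M lborel) (h n) =
    ennreal (real n ^ 2) * (\<integral>\<^sup>+u. \<integral>\<^sup>+v. ennreal ((1 - ?S u v) ^ (n - 2)) *
      indicator {- w n..w n} u * indicator {- w n..w n} v \<partial>lborel \<partial>lborel)"
    using eventually_gt_at_top[of 0]
  proof eventually_elim
    fix n :: nat assume n: "0 < n"
    let ?g = "\<lambda>u v. ennreal ((1 - ?S u v) ^ (n - 2)) * indicator {- w n..w n} u * indicator {- w n..w n} v"
    have g: "h n (a, b) = ?g ((1 / n) * a) ((1 / n) * b)" for a b
    proof -
      have "?S ((1 / n) * a) ((1 / n) * b) = ?S a b / n"
        using excluded_length_scale[of "1 / n" c d a b] by simp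
      moreover have "indicator {- w n..w n} ((1 / n) * a) = (indicator {- (real n * w n)..real n * w n} a :: ennreal)" for a
        using n by (auto simp: indicator_def field_simps)
      ultimately show ?thesis by (simp add: h_def)
    qed
    have inner: "(\<integral>\<^sup>+v. ?g u v \<partial>lborel) = ennreal (1 / n) * (\<integral>\<^sup>+b. ?g u ((1 / n) * b) \<partial>lborel)" for u
      using n by (subst nn_integral_real_affine[where t=0 and c="1 / n"]) auto
    have "(\<integral>\<^sup>+u. \<integral>\<^sup>+v. ?g u v \<partial>lborel \<partial>lborel) =
        ennreal (1 / n) * (\<integral>\<^sup>+a. \<integral>\<^sup>+v. ?g ((1 / n) * a) v \<partial>lborel \<partial>lborel)"
      using n by (subst nn_integral_real_affine[where t=0 and c="1 / n"]) auto
    also have "\<dots> = ennreal (1 / n) * (\<integral>\<^sup>+a. ennreal (1 / n) * (\<integral>\<^sup>+b. h n (a, b) \<partial>lborel) \<partial>lborel)"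
      unfolding inner g ..
    also have "\<dots> = ennreal (1 / n) * (ennreal (1 / n) * integral\<^sup>N (lborel \<Otimes>\<^sub>M lborel) (h n))"
      by (subst nn_integral_cmult) (simp_all add: lborel.nn_integral_fst)
    also have "\<dots> = ennreal (1 / real n ^ 2) * integral\<^sup>N (lborel \<Otimes>\<^sub>M lborel) (h n)"
      by (simp add: mult.assoc[symmetric] ennreal_mult[symmetric] power2_eq_square)
    finally have "ennreal (real n ^ 2) * (\<integral>\<^sup>+u. \<integral>\<^sup>+v. ?g u v \<partial>lborel \<partial>lborel) =
        (ennreal (real n ^ 2) * ennreal (1 / real n ^ 2)) * integral\<^sup>N (lborel \<Otimes>\<^sub>M lborel) (h n)"
      by (simp only: mult.assoc)
    also have "ennreal (real n ^ 2) * ennreal (1 / real n ^ 2) = 1"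
      using n by (simp flip: ennreal_mult)
    finally show "integral\<^sup>N (lborel \<Otimes>\<^sub>M lborel) (h n) =
        ennreal (real n ^ 2) * (\<integral>\<^sup>+u. \<integral>\<^sup>+v. ?g u v \<partial>lborel \<partial>lborel)" by simp
  qed
  from Lim_transform_eventually[OF lim this] show ?thesis unfolding If .
qed

lemma interval_power_integral:
  fixes w :: real
  assumes "0 \<le> w" "w \<le> 1/4"
  shows "(\<integral>\<^sup>+v. ennreal ((1 - 4 * \<bar>v\<bar>) ^ m) * indicator {- w..w} v \<partial>lborel) =
    ennreal ((1 - (1 - 4 * w) ^ Suc m) / (2 * real (Suc m)))"
proof -
  let ?f = "\<lambda>v. (1 - 4 * v) ^ m"
  have "(\<integral>\<^sup>+v. ennreal ((1 - 4 * \<bar>v\<bar>) ^ m) * indicator {- w..w} v \<partial>lborel) =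
      2 * (\<integral>\<^sup>+v. ennreal ((1 - 4 * \<bar>v\<bar>) ^ m) * indicator {- w..w} v * indicator {0<..} v \<partial>lborel)"
  proof -
    have "indicator {- w..w} (- v) = (indicator {- w..w} v :: ennreal)" for v
      by (auto simp: indicator_def)
    then show ?thesis by (subst nn_integral_split_sign) (simp_all add: mult_2)
  qed
  also have "(\<integral>\<^sup>+v. ennreal ((1 - 4 * \<bar>v\<bar>) ^ m) * indicator {- w..w} v * indicator {0<..} v \<partial>lborel) =
      (\<integral>\<^sup>+v. ennreal (?f v) * indicator {0..w} v \<partial>lborel)"
    by (rule nn_integral_cong_AE) (use AE_lborel_singleton[of 0] in \<open>auto simp: indicator_def\<close>)
  also have "\<dots> = ennreal (- ((1 - 4 * w) ^ Suc m) / (4 * real (Suc m)) - - ((1 - 4 * 0) ^ Suc m) / (4 * real (Suc m)))"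
  proof (rule nn_integral_FTC_Icc)
    fix x assume x: "x \<in> {0..w}"
    show "DERIV (\<lambda>x. - ((1 - 4 * x) ^ Suc m) / (4 * real (Suc m))) x :> ?f x"
    proof -
      have "DERIV (\<lambda>x. (1 - 4 * x) ^ Suc m) x :> real (Suc m) * (- 4) * (1 - 4 * x) ^ m"
        by ((rule derivative_eq_intros refl | simp)+, simp add: algebra_simps)
      from DERIV_cmult[OF this, of "- (1 / (4 * real (Suc m)))"] show ?thesis
        by (simp del: of_nat_Suc power_Suc)
    qed
    show "0 \<le> ?f x" using x assms by simp
  qed (use assms in auto)
  also have "2 * \<dots> = ennreal ((1 - (1 - 4 * w) ^ Suc m) / (2 * real (Suc m)))"
  proof -
    have "(1 - 4 * w) ^ Suc m \<le> 1" using assms by (intro power_le_one) auto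
    then have "0 \<le> - ((1 - 4 * w) ^ Suc m) / (4 * real (Suc m)) - - ((1 - 4 * 0) ^ Suc m) / (4 * real (Suc m))"
      by (simp add: field_simps)
    then show ?thesis
      by (subst ennreal_numeral[symmetric], subst ennreal_mult[symmetric]) (auto simp: field_simps)
  qed
  finally show ?thesis .
qed

section \<open>Probabilities of local configurations\<close>

text \<open>Positions \<open>y\<close> of a further point that would spoil one of the required
  nearest-point statements. The inequalities are weak because a tie spoils them as well.\<close>

definition excluded :: "bool \<Rightarrow> bool \<Rightarrow> real \<Rightarrow> real \<Rightarrow> real \<Rightarrow> real \<Rightarrow> bool" where
  "excluded c d t a b y \<longleftrightarrow> cdist y t \<le> cdist a t \<or>
    cdist y (t + 1/2) \<le> cdist b (t + 1/2) \<or>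
    c \<and> cdist y (a + 1/2) \<le> cdist b (a + 1/2) \<or>
    d \<and> cdist y (b + 1/2) \<le> cdist a (b + 1/2)"

lemma emeasure_unit_law_wrap:
  assumes [measurable]: "I \<in> sets borel" and I: "I \<subseteq> {-1/2..<1/2}"
  shows "emeasure unit_law {y. wrap (y - t) \<in> I} = emeasure lborel I"
proof -
  have [measurable]: "{y. wrap (y - t) \<in> I} \<in> sets borel" by measurable
  have "emeasure unit_law {y. wrap (y - t) \<in> I} = (\<integral>\<^sup>+y. indicator {y. wrap (y - t) \<in> I} y \<partial>unit_law)"
    by (subst nn_integral_indicator) auto
  also have "\<dots> = (\<integral>\<^sup>+y. indicator I (wrap (y - t)) \<partial>unit_law)"
    by (intro nn_integral_cong) (simp add: indicator_def)
  also have "\<dots> = (\<integral>\<^sup>+u. indicator I u * indicator {-1/2..<1/2} u \<partial>lborel)"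
    by (rule nn_integral_wrap) measurable
  also have "\<dots> = (\<integral>\<^sup>+u. indicator I u \<partial>lborel)"
    using I by (intro nn_integral_cong) (auto simp: indicator_def)
  finally show ?thesis by simp
qed

text \<open>One connected half of the excluded set, in coordinates centred at \<open>t\<close> or at
  its antipode. The first interval protects the point at \<open>u\<close> as nearest to the centre;
  the second protects it as nearest to the antipode, at \<open>v\<close>, of the opposite
  point.\<close>

definition arm :: "bool \<Rightarrow> real \<Rightarrow> real \<Rightarrow> real set" where
  "arm d u v = {- \<bar>u\<bar>..\<bar>u\<bar>} \<union> (if d then {v - \<bar>u - v\<bar>..v + \<bar>u - v\<bar>} else {})"

text \<open>Both intervals have \<open>u\<close> as an endpoint, so their union is an interval. The
  other endpoints are the mirror images of \<open>u\<close> in 0 and in \<open>v\<close>, which is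
  why the hull of 0, \<open>u\<close> and \<open>v\<close> is counted twice.\<close>

lemma emeasure_arm: "emeasure lborel (arm d u v) = ennreal (2 * (if d then reach u v else \<bar>u\<bar>))"
proof (cases d)
  case True
  let ?l = "min (- \<bar>u\<bar>) (v - \<bar>u - v\<bar>)" and ?h = "max \<bar>u\<bar> (v + \<bar>u - v\<bar>)"
  have "arm d u v = {?l..?h}" using True by (auto simp: arm_def)
  moreover have "?h - ?l = 2 * reach u v" "?l \<le> ?h"
    unfolding reach_def by (simp_all add: max_def min_def abs_if)
  ultimately show ?thesis using True by simp
qed (simp add: arm_def)

lemma arm_bound:
  assumes "\<bar>u\<bar> \<le> w" "\<bar>v\<bar> \<le> w" "e \<in> arm d u v"
  shows "\<bar>e\<bar> \<le> 3 * w"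
  using assms by (auto simp: arm_def split: if_splits)

lemma arm_iff: "e \<in> arm d u v \<longleftrightarrow> \<bar>e\<bar> \<le> \<bar>u\<bar> \<or> d \<and> \<bar>e - v\<bar> \<le> \<bar>u - v\<bar>"
  by (cases d) (simp_all add: arm_def abs_le_iff, linarith+)

lemma arm_measurable[measurable]: "arm d u v \<in> sets borel"
  by (simp add: arm_def)

text \<open>Seen from \<open>t\<close> the antipode of \<open>b\<close> has displacement
  \<open>v\<close>, and seen from \<open>t + 1/2\<close> the antipode of \<open>a\<close> has
  displacement \<open>u\<close>. Hence \<open>d\<close> acts near \<open>t\<close> and
  \<open>c\<close> near \<open>t + 1/2\<close>; with \<open>w \<le> 1/16\<close> nothing wraps
  around.\<close>

lemma excluded_iff:
  assumes "cdist a t \<le> w" "cdist b (t + 1/2) \<le> w" "w \<le> 1/16"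
  shows "excluded c d t a b y \<longleftrightarrow>
    wrap (y - t) \<in> arm d (wrap (a - t)) (wrap (b - (t + 1/2))) \<or>
    wrap (y - (t + 1/2)) \<in> arm c (wrap (b - (t + 1/2))) (wrap (a - t))"
proof -
  define u where "u = wrap (a - t)"
  define v where "v = wrap (b - (t + 1/2))"
  obtain j where j: "a - t = u + of_int j" unfolding u_def by (rule wrap_decomp)
  obtain k where k: "b - (t + 1/2) = v + of_int k" unfolding v_def by (rule wrap_decomp)
  have uv: "\<bar>u\<bar> \<le> w" "\<bar>v\<bar> \<le> w" using assms by (simp_all add: u_def v_def)
  have D: "cdist z (b + 1/2) = cdist (z - t) v" for z
  proof -
    have "z - (b + 1/2) = (z - t) - v - of_int (k + 1)" using k by simp
    then show ?thesis by (simp only: wrap_diff_int)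
  qed
  have C: "cdist z (a + 1/2) = cdist (z - (t + 1/2)) u" for z
  proof -
    have "z - (a + 1/2) = (z - (t + 1/2)) - u - of_int j" using j by simp
    then show ?thesis by (simp only: wrap_diff_int)
  qed
  have "wrap ((a - t) + - v) = wrap (a - t) + - v"
    by (rule wrap_add_id) (use uv assms(3) in \<open>auto simp: u_def\<close>)
  then have Da: "cdist a (b + 1/2) = \<bar>u - v\<bar>" using D[of a] by (simp add: u_def)
  have "wrap ((b - (t + 1/2)) + - u) = wrap (b - (t + 1/2)) + - u"
    by (rule wrap_add_id) (use uv assms(3) in \<open>auto simp: v_def\<close>)
  then have Cb: "cdist b (a + 1/2) = \<bar>u - v\<bar>" using C[of b] by (simp add: v_def abs_minus_commute)
  have "cdist y (b + 1/2) \<le> cdist a (b + 1/2) \<longleftrightarrow> \<bar>wrap (y - t) - v\<bar> \<le> \<bar>u - v\<bar>"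
    unfolding D[of y] Da using uv assms(3) by (intro abs_wrap_diff_le_iff) linarith
  moreover have "cdist y (a + 1/2) \<le> cdist b (a + 1/2) \<longleftrightarrow> \<bar>wrap (y - (t + 1/2)) - u\<bar> \<le> \<bar>u - v\<bar>"
    unfolding C[of y] Cb using uv assms(3) by (intro abs_wrap_diff_le_iff) linarith
  ultimately show ?thesis
    unfolding excluded_def u_def[symmetric] v_def[symmetric] arm_iff abs_minus_commute[of v u] by blast
qed

lemma wrap_antipodal: "cdist y (t + 1/2) = 1/2 - cdist y t"
  using abs_wrap_half[of "y - t"] by (simp add: diff_diff_eq)

lemma wrap_antipodal_commute: "cdist a (b + 1/2) = cdist b (a + 1/2)"
  unfolding wrap_antipodal using abs_wrap_commute[of a b] by simp

text \<open>The two arms stay within \<open>3 * w\<close> of \<open>t\<close> and of its antipode,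
  so they are disjoint and their lengths add.\<close>

lemma emeasure_not_excluded:
  assumes "cdist a t \<le> w" "cdist b (t + 1/2) \<le> w" "w \<le> 1/16"
  shows "emeasure unit_law {y. \<not> excluded c d t a b y} =
    ennreal (1 - excluded_length c d (wrap (a - t)) (wrap (b - (t + 1/2))))"
proof -
  interpret prob_space unit_law by (rule prob_space_unit_law)
  let ?u = "wrap (a - t)" and ?v = "wrap (b - (t + 1/2))"
  let ?A = "{y. wrap (y - t) \<in> arm d ?u ?v}" and ?B = "{y. wrap (y - (t + 1/2)) \<in> arm c ?v ?u}"
  have [measurable]: "?A \<in> sets borel" "?B \<in> sets borel" by measurable
  then have AB: "?A \<union> ?B \<in> sets unit_law" by (simp add: sets.Un)
  have eq: "{y. \<not> excluded c d t a b y} = space unit_law - (?A \<union> ?B)"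
    using excluded_iff[OF assms] by auto
  have "emeasure unit_law {y. \<not> excluded c d t a b y} = 1 - emeasure unit_law (?A \<union> ?B)"
  proof -
    have "emeasure unit_law (?A \<union> ?B) \<noteq> \<infinity>"
      unfolding infinity_ennreal_def by (rule emeasure_finite)
    from emeasure_compl[OF AB this] show ?thesis unfolding emeasure_space_1 eq .
  qed
  also have "emeasure unit_law (?A \<union> ?B) = emeasure unit_law ?A + emeasure unit_law ?B"
  proof (rule plus_emeasure[symmetric])
    have "False" if "y \<in> ?A" "y \<in> ?B" for y
    proof -
      have "cdist y t \<le> 3 * w" "cdist y (t + 1/2) \<le> 3 * w"
        using that assms by (auto intro: arm_bound)
      then show False using assms(3) wrap_antipodal[of y t] by linarith
    qed
    then show "?A \<inter> ?B = {}" by blast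
  qed auto
  also have "emeasure unit_law ?A = ennreal (2 * (if d then reach ?u ?v else \<bar>?u\<bar>))"
  proof (subst emeasure_unit_law_wrap)
    show "arm d ?u ?v \<subseteq> {- 1/2..<1/2}"
      using arm_bound[OF assms(1,2)] assms(3) by (force simp: abs_le_iff)
  qed (simp_all add: emeasure_arm)
  also have "emeasure unit_law ?B = ennreal (2 * (if c then reach ?u ?v else \<bar>?v\<bar>))"
  proof (subst emeasure_unit_law_wrap)
    show "arm c ?v ?u \<subseteq> {- 1/2..<1/2}"
      using arm_bound[OF assms(2,1)] assms(3) by (force simp: abs_le_iff)
    have "reach ?v ?u = reach ?u ?v" by (simp add: reach_def max.commute min.commute)
    then show "emeasure lborel (arm c ?v ?u) = ennreal (2 * (if c then reach ?u ?v else \<bar>?v\<bar>))"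
      by (simp add: emeasure_arm)
  qed simp
  also have "ennreal (2 * (if d then reach ?u ?v else \<bar>?u\<bar>)) + ennreal (2 * (if c then reach ?u ?v else \<bar>?v\<bar>)) =
      ennreal (excluded_length c d ?u ?v)"
    by (subst ennreal_plus[symmetric]) (auto simp: excluded_length_def reach_def)
  also have "1 - \<dots> = ennreal (1 - excluded_length c d ?u ?v)"
    by (simp add: ennreal_minus excluded_length_nonneg flip: ennreal_1)
  finally show ?thesis .
qed

lemma excluded_measurable[measurable]:
  assumes [measurable]: "t \<in> borel_measurable M" "a \<in> borel_measurable M" "b \<in> borel_measurable M" "y \<in> borel_measurable M"
  shows "Measurable.pred M (\<lambda>x. excluded c d (t x) (a x) (b x) (y x))"
  unfolding excluded_def by measurable

text \<open>The flags require conditions but never forbid them, so the event says that all other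
  points avoid one set. Prescribed truth values are obtained as differences of such events.\<close>

definition class_event :: "bool \<Rightarrow> bool \<Rightarrow> real \<Rightarrow> nat \<Rightarrow> (nat \<Rightarrow> real) \<Rightarrow> real \<Rightarrow> nat \<Rightarrow> nat \<Rightarrow> bool" where
  "class_event c d w n s t p q \<longleftrightarrow> near n s t p \<and> near n s (t + 1/2) q \<and>
    cdist (s p) t \<le> w \<and> cdist (s q) (t + 1/2) \<le> w \<and>
    (c \<longrightarrow> near n s (s p + 1/2) q) \<and> (d \<longrightarrow> near n s (s q + 1/2) p)"

lemma abs_wrap_neg_half: "cdist y (y + 1/2) = 1/2"
  using wrap_antipodal[of y y] wrap_id[of 0] by simp

lemma abs_wrap_points:
  "cdist b (a + 1/2) \<le> cdist a t + cdist b (t + 1/2)"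
  using abs_wrap_add[of "b - (t + 1/2)" "t - a"] abs_wrap_commute[of t a] by (simp add: algebra_simps)

text \<open>Inside the window \<open>p\<close> is close to \<open>t\<close> and \<open>q\<close> to
  its antipode, so all comparisons between \<open>p\<close> and \<open>q\<close> come out right and
  only the other points impose conditions.\<close>

lemma class_event_iff:
  assumes pq: "p < n" "q < n" "p \<noteq> q" and w: "w \<le> 1/16"
  shows "class_event c d w n s t p q \<longleftrightarrow>
    (cdist (s p) t \<le> w \<and> cdist (s q) (t + 1/2) \<le> w) \<and>
    (\<forall>k<n. k \<noteq> p \<longrightarrow> k \<noteq> q \<longrightarrow> \<not> excluded c d t (s p) (s q) (s k))"
proof (cases "cdist (s p) t \<le> w \<and> cdist (s q) (t + 1/2) \<le> w")
  case True
  have small: "cdist (s q) (s p + 1/2) < 1/2" "cdist (s p) (s q + 1/2) < 1/2"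
  proof -
    show "cdist (s q) (s p + 1/2) < 1/2" using abs_wrap_points[of "s q" "s p" t] True w by linarith
    moreover have "cdist (s p) (s q + 1/2) = cdist (s q) (s p + 1/2)"
      by (rule wrap_antipodal_commute)
    ultimately show "cdist (s p) (s q + 1/2) < 1/2" by simp
  qed
  have "cdist (s p) t < cdist (s q) t" "cdist (s q) (t + 1/2) < cdist (s p) (t + 1/2)"
    using True w wrap_antipodal[of "s q" t] wrap_antipodal[of "s p" t] by linarith+
  moreover have "cdist (s q) (s p + 1/2) < cdist (s p) (s p + 1/2)"
    "cdist (s p) (s q + 1/2) < cdist (s q) (s q + 1/2)"
    using small by (simp_all only: abs_wrap_neg_half)
  ultimately show ?thesis
    using True pq unfolding class_event_def near_def excluded_def not_le[symmetric] by blast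
qed (auto simp: class_event_def)

definition box_probability :: "bool \<Rightarrow> bool \<Rightarrow> real \<Rightarrow> nat \<Rightarrow> ennreal" where
  "box_probability c d w n = (\<integral>\<^sup>+u. \<integral>\<^sup>+v. ennreal ((1 - excluded_length c d u v) ^ (n - 2)) *
      indicator {- w..w} u * indicator {- w..w} v \<partial>lborel \<partial>lborel)"

abbreviation sample :: "nat \<Rightarrow> (nat \<Rightarrow> real) measure" where
  "sample n \<equiv> PiM {..<n} (\<lambda>_. unit_law)"

lemma emeasure_class_event:
  assumes pq: "p < n" "q < n" "p \<noteq> q" and w: "w \<le> 1/16"
  shows "emeasure (sample n) {s \<in> space (sample n). class_event c d w n s t p q} = box_probability c d w n"
proof -
  let ?\<phi> = "\<lambda>a b. cdist a t \<le> w \<and> cdist b (t + 1/2) \<le> w"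
  define g where "g u v = ennreal ((1 - excluded_length c d u v) ^ (n - 2)) *
      indicator {- w..w} u * indicator {- w..w} v" for u v
  have g0: "g u v * indicator {- 1/2..<1/2} v = g u v" "g u v * indicator {- 1/2..<1/2} u = g u v" for u v
    using w by (auto simp: g_def indicator_def)
  have [measurable]: "(\<lambda>(u, v). g u v) \<in> borel_measurable (borel \<Otimes>\<^sub>M borel)" unfolding g_def by measurable
  have "emeasure (sample n) {s \<in> space (sample n). class_event c d w n s t p q} =
      (\<integral>\<^sup>+a. \<integral>\<^sup>+b. indicator {b. ?\<phi> a b} b * emeasure unit_law {y \<in> space unit_law. \<not> excluded c d t a b y} ^ (n - 2) \<partial>unit_law \<partial>unit_law)"
    unfolding class_event_iff[OF assms]
    by (rule emeasure_PiM_pair_rest[OF prob_space_unit_law pq]) measurable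
  also have "\<dots> = (\<integral>\<^sup>+a. \<integral>\<^sup>+b. g (wrap (a - t)) (wrap (b - (t + 1/2))) \<partial>unit_law \<partial>unit_law)"
  proof (intro nn_integral_cong)
    fix a b
    show "indicator {b. ?\<phi> a b} b * emeasure unit_law {y \<in> space unit_law. \<not> excluded c d t a b y} ^ (n - 2) =
      g (wrap (a - t)) (wrap (b - (t + 1/2)))"
    proof (cases "?\<phi> a b")
      case True
      have "0 \<le> 1 - excluded_length c d (wrap (a - t)) (wrap (b - (t + 1/2)))"
        using excluded_length_le[of "wrap (a - t)" w "wrap (b - (t + 1/2))" c d] True w by linarith
      then show ?thesis
        using True emeasure_not_excluded[of a t w b c d] w
        by (simp add: g_def ennreal_power indicator_def abs_le_iff)
    qed (auto simp: g_def indicator_def abs_le_iff)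
  qed
  also have "\<dots> = (\<integral>\<^sup>+a. \<integral>\<^sup>+v. g (wrap (a - t)) v \<partial>lborel \<partial>unit_law)"
    by (intro nn_integral_cong) (subst nn_integral_wrap, measurable, simp only: g0)
  also have "\<dots> = (\<integral>\<^sup>+u. (\<integral>\<^sup>+v. g u v \<partial>lborel) * indicator {- 1/2..<1/2} u \<partial>lborel)"
    by (rule nn_integral_wrap) measurable
  also have "\<dots> = (\<integral>\<^sup>+u. \<integral>\<^sup>+v. g u v * indicator {- 1/2..<1/2} u \<partial>lborel \<partial>lborel)"
    by (intro nn_integral_cong nn_integral_multc[symmetric]) measurable
  also have "\<dots> = box_probability c d w n"
    unfolding g0 unfolding box_probability_def g_def ..
  finally show ?thesis .
qed

section \<open>Probability of a mutually farthest pair\<close>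

definition mutual :: "real \<Rightarrow> nat \<Rightarrow> (nat \<Rightarrow> real) \<Rightarrow> nat \<Rightarrow> nat \<Rightarrow> bool" where
  "mutual w n s p q \<longleftrightarrow> near n s (s p + 1/2) q \<and> near n s (s q + 1/2) p \<and> cdist (s q) (s p + 1/2) \<le> w"

text \<open>This is the configuration above with \<open>t = s p\<close>. A point coinciding with
  \<open>t\<close> would be as close to the antipode of \<open>q\<close> as \<open>p\<close> is, so
  the clause around \<open>t\<close> is implied by the clause around that antipode.\<close>

lemma mutual_iff:
  assumes pq: "p < n" "q < n" "p \<noteq> q" and w: "w \<le> 1/16"
  shows "mutual w n s p q \<longleftrightarrow> cdist (s q) (s p + 1/2) \<le> w \<and>
    (\<forall>k<n. k \<noteq> p \<longrightarrow> k \<noteq> q \<longrightarrow> \<not> excluded True True (s p) (s p) (s q) (s k))"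
proof (cases "cdist (s q) (s p + 1/2) \<le> w")
  case True
  have sym: "cdist (s p) (s q + 1/2) = cdist (s q) (s p + 1/2)"
    by (rule wrap_antipodal_commute)
  have "cdist (s q) (s p + 1/2) < cdist (s p) (s p + 1/2)" "cdist (s p) (s q + 1/2) < cdist (s q) (s q + 1/2)"
    using True w unfolding sym abs_wrap_neg_half by linarith+
  moreover have "excluded True True (s p) (s p) (s q) y \<longleftrightarrow> cdist y (s p + 1/2) \<le> cdist (s q) (s p + 1/2) \<or>
      cdist y (s q + 1/2) \<le> cdist (s p) (s q + 1/2)" for y
  proof -
    have "cdist y (s q + 1/2) \<le> cdist (s p) (s q + 1/2)" if "cdist y (s p) \<le> cdist (s p) (s p)"
      using abs_wrap_add[of "y - s p" "s p - (s q + 1/2)"] that wrap_id[of 0] by (simp add: algebra_simps)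
    then show ?thesis unfolding excluded_def by blast
  qed
  ultimately show ?thesis
    using True pq unfolding mutual_def near_def not_le[symmetric] by blast
qed (auto simp: mutual_def)

text \<open>The displacement of \<open>p\<close> is 0, so the excluded length is
  \<open>4 * \<bar>v\<bar>\<close> and the integral is elementary. The probability is therefore
  exact for each \<open>n\<close>.\<close>

lemma emeasure_mutual:
  assumes pq: "p < n" "q < n" "p \<noteq> q" and w: "0 \<le> w" "w \<le> 1/16"
  shows "emeasure (sample n) {s \<in> space (sample n). mutual w n s p q} =
    ennreal ((1 - (1 - 4 * w) ^ Suc (n - 2)) / (2 * real (Suc (n - 2))))"
proof -
  let ?\<phi> = "\<lambda>a b. cdist b (a + 1/2) \<le> w"
  define g where "g v = ennreal ((1 - 4 * \<bar>v\<bar>) ^ (n - 2)) * indicator {- w..w} v" for v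
  have [measurable]: "g \<in> borel_measurable borel" unfolding g_def by measurable
  have g0: "g v * indicator {- 1/2..<1/2} v = g v" for v
    using w by (auto simp: g_def indicator_def)
  have "emeasure (sample n) {s \<in> space (sample n). mutual w n s p q} =
      (\<integral>\<^sup>+a. \<integral>\<^sup>+b. indicator {b. ?\<phi> a b} b * emeasure unit_law {y \<in> space unit_law. \<not> excluded True True a a b y} ^ (n - 2) \<partial>unit_law \<partial>unit_law)"
    unfolding mutual_iff[OF pq w(2)]
    by (rule emeasure_PiM_pair_rest[OF prob_space_unit_law pq]) measurable
  also have "\<dots> = (\<integral>\<^sup>+a. \<integral>\<^sup>+b. g (wrap (b - (a + 1/2))) \<partial>unit_law \<partial>unit_law)"
  proof (intro nn_integral_cong)
    fix a b
    show "indicator {b. ?\<phi> a b} b * emeasure unit_law {y \<in> space unit_law. \<not> excluded True True a a b y} ^ (n - 2) =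
      g (wrap (b - (a + 1/2)))"
    proof (cases "?\<phi> a b")
      case True
      have "wrap (a - a) = 0" using wrap_id[of 0] by simp
      moreover have p0: "0 \<le> 1 - 4 * cdist b (a + 1/2)" using True w by linarith
      moreover have "excluded_length True True 0 v = 4 * \<bar>v\<bar>" for v by (auto simp: excluded_length_def reach_def)
      ultimately show ?thesis
        using True emeasure_not_excluded[of a a w b True True] w
        by (simp add: g_def ennreal_power[OF p0] indicator_def abs_le_iff)
    qed (auto simp: g_def indicator_def abs_le_iff)
  qed
  also have "\<dots> = (\<integral>\<^sup>+a. \<integral>\<^sup>+v. g v \<partial>lborel \<partial>unit_law)"
    by (intro nn_integral_cong) (subst nn_integral_wrap, measurable, simp only: g0)
  also have "\<dots> = (\<integral>\<^sup>+v. g v \<partial>lborel)"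
  proof -
    interpret prob_space unit_law by (rule prob_space_unit_law)
    show ?thesis by (simp add: emeasure_space_1[simplified])
  qed
  also have "\<dots> = ennreal ((1 - (1 - 4 * w) ^ Suc (n - 2)) / (2 * real (Suc (n - 2))))"
    unfolding g_def using w by (intro interval_power_integral) auto
  finally show ?thesis .
qed

section \<open>Localized lengths\<close>

lemma near_measurable:
  assumes s: "\<And>k. k < n \<Longrightarrow> (\<lambda>x. s x k) \<in> borel_measurable M" and [measurable]: "t \<in> borel_measurable M"
  shows "Measurable.pred M (\<lambda>x. near n (s x) (t x) p)"
proof (cases "p < n")
  case True
  have "Measurable.pred M (\<lambda>x. \<forall>k\<in>{..<n} - {p}. cdist (s x p) (t x) < cdist (s x k) (t x))"
  proof (rule pred_intros_finite(3)[OF finite_Diff[OF finite_lessThan]])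
    fix k assume "k \<in> {..<n} - {p}"
    then have [measurable]: "(\<lambda>x. s x k) \<in> borel_measurable M" "(\<lambda>x. s x p) \<in> borel_measurable M" using s True by auto
    show "Measurable.pred M (\<lambda>x. cdist (s x p) (t x) < cdist (s x k) (t x))" by measurable
  qed
  moreover have "near n (s x) (t x) p \<longleftrightarrow> (\<forall>k\<in>{..<n} - {p}. cdist (s x p) (t x) < cdist (s x k) (t x))" for x
    unfolding near_def using True by blast
  ultimately show ?thesis by presburger
qed (simp add: near_def)

lemma near_less: "near n s t p \<Longrightarrow> p < n"
  by (simp add: near_def)

lemma near_unique:
  assumes "near n s t p" "near n s t p'"
  shows "p = p'"
proof (rule ccontr)
  assume "p \<noteq> p'"
  then have "cdist (s p) t < cdist (s p') t" "cdist (s p') t < cdist (s p) t"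
    using assms unfolding near_def by blast+
  then show False by linarith
qed

lemma near_upd:
  assumes "i \<noteq> p" "cdist (s p) t < cdist (s i) t" "cdist (s p) t < cdist y t"
  shows "near n (s(i := y)) t p \<longleftrightarrow> near n s t p"
proof -
  have "cdist (s p) t < cdist ((s(i := y)) k) t \<longleftrightarrow> cdist (s p) t < cdist (s k) t" for k
    using assms by (cases "k = i") simp_all
  moreover have "(s(i := y)) p = s p" using assms(1) by simp
  ultimately show ?thesis unfolding near_def by presburger
qed

definition pair_class :: "bool \<Rightarrow> bool \<Rightarrow> real \<Rightarrow> nat \<Rightarrow> (nat \<Rightarrow> real) \<Rightarrow> real \<Rightarrow> nat \<Rightarrow> nat \<Rightarrow> bool" where
  "pair_class a b w n s t p q \<longleftrightarrow> near n s t p \<and> near n s (t + 1/2) q \<and>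
    cdist (s p) t \<le> w \<and> cdist (s q) (t + 1/2) \<le> w \<and>
    near n s (s p + 1/2) q = a \<and> near n s (s q + 1/2) p = b"

lemma pair_class_event:
  "pair_class True True w n s t p q \<longleftrightarrow> class_event True True w n s t p q"
  "pair_class True False w n s t p q \<longleftrightarrow> class_event True False w n s t p q \<and> \<not> class_event True True w n s t p q"
  "pair_class False True w n s t p q \<longleftrightarrow> class_event False True w n s t p q \<and> \<not> class_event True True w n s t p q"
  "pair_class False False w n s t p q \<longleftrightarrow> class_event False False w n s t p q \<and>
    \<not> (class_event True False w n s t p q \<or> class_event False True w n s t p q)"
  unfolding pair_class_def class_event_def by (simp_all only: simp_thms) blast+

definition local_class :: "bool \<Rightarrow> bool \<Rightarrow> real \<Rightarrow> nat \<Rightarrow> (nat \<Rightarrow> real) \<Rightarrow> real \<Rightarrow> bool" where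
  "local_class a b w n s t \<longleftrightarrow> (\<exists>p<n. \<exists>q<n. pair_class a b w n s t p q)"

definition local_length :: "bool \<Rightarrow> bool \<Rightarrow> real \<Rightarrow> nat \<Rightarrow> (nat \<Rightarrow> real) \<Rightarrow> real" where
  "local_length a b w n s = measure unit_law {t. local_class a b w n s t}"

lemma pair_class_measurable:
  assumes s: "\<And>k. k < n \<Longrightarrow> (\<lambda>x. s x k) \<in> borel_measurable M" and [measurable]: "t \<in> borel_measurable M"
  shows "Measurable.pred M (\<lambda>x. pair_class a b w n (s x) (t x) p q)"
proof (cases "p < n \<and> q < n")
  case True
  then have [measurable]: "(\<lambda>x. s x p) \<in> borel_measurable M" "(\<lambda>x. s x q) \<in> borel_measurable M" using s by auto
  have [measurable]: "Measurable.pred M (\<lambda>x. near n (s x) (t x) p)" "Measurable.pred M (\<lambda>x. near n (s x) (t x + 1/2) q)"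
    "Measurable.pred M (\<lambda>x. near n (s x) (s x p + 1/2) q)" "Measurable.pred M (\<lambda>x. near n (s x) (s x q + 1/2) p)"
    by (rule near_measurable; use s in measurable)+
  show ?thesis unfolding pair_class_def by measurable
next
  case False
  then have "\<not> pair_class a b w n (s x) (t x) p q" for x
    unfolding pair_class_def using near_less by blast
  then show ?thesis by simp
qed

lemma class_event_measurable:
  assumes s: "\<And>k. k < n \<Longrightarrow> (\<lambda>x. s x k) \<in> borel_measurable M" and [measurable]: "t \<in> borel_measurable M"
  shows "Measurable.pred M (\<lambda>x. class_event a b w n (s x) (t x) p q)"
proof (cases "p < n \<and> q < n")
  case True
  then have [measurable]: "(\<lambda>x. s x p) \<in> borel_measurable M" "(\<lambda>x. s x q) \<in> borel_measurable M" using s by auto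
  have [measurable]: "Measurable.pred M (\<lambda>x. near n (s x) (t x) p)" "Measurable.pred M (\<lambda>x. near n (s x) (t x + 1/2) q)"
    "Measurable.pred M (\<lambda>x. near n (s x) (s x p + 1/2) q)" "Measurable.pred M (\<lambda>x. near n (s x) (s x q + 1/2) p)"
    by (rule near_measurable; use s in measurable)+
  show ?thesis unfolding class_event_def by measurable
next
  case False
  then have "\<not> class_event a b w n (s x) (t x) p q" for x
    unfolding class_event_def using near_less by blast
  then show ?thesis by simp
qed

lemma local_class_measurable:
  assumes s: "\<And>k. k < n \<Longrightarrow> (\<lambda>x. s x k) \<in> borel_measurable M" and [measurable]: "t \<in> borel_measurable M"
  shows "Measurable.pred M (\<lambda>x. local_class a b w n (s x) (t x))"
proof -
  have [measurable]: "Measurable.pred M (\<lambda>x. pair_class a b w n (s x) (t x) p q)" for p q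
    by (rule pair_class_measurable; use s in measurable)
  show ?thesis unfolding local_class_def by measurable
qed

lemma sample_component:
  assumes "k < n"
  shows "(\<lambda>s. s k) \<in> borel_measurable (sample n)"
proof -
  have "(\<lambda>s. s k) \<in> measurable (sample n) unit_law"
    using assms by (intro measurable_component_singleton) simp
  then show ?thesis unfolding measurable_cong_sets[OF refl sets_unit_law] .
qed

lemma sets_local_class: "{t. local_class a b w n s t} \<in> sets borel"
proof -
  have "Measurable.pred borel (\<lambda>t. local_class a b w n s t)"
    by (rule local_class_measurable[where s="\<lambda>_. s"]) simp_all
  then show ?thesis unfolding pred_def by simp
qed

text \<open>The winning distances in \<open>pair_class\<close> are at most \<open>2 * w\<close>, and
  the centres lie within \<open>w\<close> of \<open>t\<close> or of its antipode. A point more than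
  \<open>3 * w\<close> away from both is never the nearest one, before or after the move.\<close>

lemma local_class_stable:
  assumes w: "w \<le> 1/16" and cl: "pair_class a b w n s t p q"
    and i: "3 * w < cdist (s i) t" "3 * w < cdist (s i) (t + 1/2)"
    and y: "3 * w < cdist y t" "3 * w < cdist y (t + 1/2)"
  shows "pair_class a b w n (s(i := y)) t p q"
proof -
  have pq: "cdist (s p) t \<le> w" "cdist (s q) (t + 1/2) \<le> w"
    using cl unfolding pair_class_def by blast+
  have w0: "0 \<le> w" using pq(1) by linarith
  have ne: "i \<noteq> p" "i \<noteq> q" using i pq w0 by force+
  have close: "cdist (s q) (s p + 1/2) \<le> 2 * w" "cdist (s p) (s q + 1/2) \<le> 2 * w"
    using abs_wrap_points[of "s q" "s p" t] pq unfolding wrap_antipodal_commute[of "s p"] by linarith+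
  have far: "2 * w < cdist z (s p + 1/2)" "2 * w < cdist z (s q + 1/2)"
    if "3 * w < cdist z t" "3 * w < cdist z (t + 1/2)" for z
  proof -
    have "cdist z (t + 1/2) \<le> cdist z (s p + 1/2) + cdist (s p) t"
      using abs_wrap_add[of "z - (s p + 1/2)" "s p - t"] by (simp add: algebra_simps)
    then show "2 * w < cdist z (s p + 1/2)" using that pq by linarith
    have "(z - (s q + 1/2)) + (s q - (t + 1/2)) = z - t - 1" by simp
    then have "cdist z t \<le> cdist z (s q + 1/2) + cdist (s q) (t + 1/2)"
      using abs_wrap_add[of "z - (s q + 1/2)" "s q - (t + 1/2)"] wrap_minus_one[of "z - t"] by metis
    then show "2 * w < cdist z (s q + 1/2)" using that pq by linarith
  qed
  have "near n (s(i := y)) t p \<longleftrightarrow> near n s t p"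
    by (rule near_upd[OF ne(1)]) (use pq w0 i y in linarith)+
  moreover have "near n (s(i := y)) (t + 1/2) q \<longleftrightarrow> near n s (t + 1/2) q"
    by (rule near_upd[OF ne(2)]) (use pq w0 i y in linarith)+
  moreover have "near n (s(i := y)) (s p + 1/2) q \<longleftrightarrow> near n s (s p + 1/2) q"
    by (rule near_upd[OF ne(2)]) (use close far[OF i] far[OF y] in linarith)+
  moreover have "near n (s(i := y)) (s q + 1/2) p \<longleftrightarrow> near n s (s q + 1/2) p"
    by (rule near_upd[OF ne(1)]) (use close far[OF i] far[OF y] in linarith)+
  ultimately show ?thesis using cl ne by (simp add: pair_class_def)
qed

lemma emeasure_close:
  assumes "0 \<le> r" "r < 1/2"
  shows "measure unit_law {t. cdist x t \<le> r} = 2 * r" "{t. cdist x t \<le> r} \<in> sets borel"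
proof -
  have eq: "{t. cdist x t \<le> r} = {t. wrap (t - x) \<in> {- r..r}}"
    unfolding abs_wrap_commute[of x] by (auto simp: abs_le_iff)
  have "emeasure unit_law {t. wrap (t - x) \<in> {- r..r}} = emeasure lborel {- r..r}"
    using assms by (intro emeasure_unit_law_wrap) auto
  then show "measure unit_law {t. cdist x t \<le> r} = 2 * r"
    using assms unfolding eq by (simp add: measure_def)
  show "{t. cdist x t \<le> r} \<in> sets borel" by measurable
qed

text \<open>A location can leave its class only within \<open>3 * w\<close> of the old or the new
  position of point \<open>i\<close>, or of one of their antipodes: four arcs of length
  \<open>6 * w\<close>.\<close>

lemma local_length_upd_le:
  assumes w: "0 \<le> w" "w \<le> 1/16"
  shows "local_length a b w n s \<le> local_length a b w n (s(i := y)) + 24 * w"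
proof -
  interpret prob_space unit_law by (rule prob_space_unit_law)
  define C where "C z = {t. cdist z t \<le> 3 * w}" for z
  have C: "C z \<in> sets unit_law" "prob (C z) = 6 * w" for z
    using emeasure_close[of "3 * w" z] w by (simp_all add: C_def)
  define L where "L s = {t. local_class a b w n s t}" for s
  have L: "L s \<in> sets unit_law" for s by (simp add: L_def sets_local_class)
  let ?Z = "{s i, s i - 1/2, y, y - 1/2}"
  have "L s \<subseteq> L (s(i := y)) \<union> \<Union> (C ` ?Z)"
  proof
    fix t assume "t \<in> L s"
    then obtain p q where pq: "p < n" "q < n" "pair_class a b w n s t p q" by (auto simp: L_def local_class_def)
    show "t \<in> L (s(i := y)) \<union> \<Union> (C ` ?Z)"
    proof (cases "t \<in> \<Union> (C ` ?Z)")
      case False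
      then have "pair_class a b w n (s(i := y)) t p q"
        by (intro local_class_stable[OF w(2) pq(3)]) (auto simp: C_def not_le algebra_simps)
      then show ?thesis using pq by (auto simp: L_def local_class_def)
    qed simp
  qed
  then have "prob (L s) \<le> prob (L (s(i := y)) \<union> \<Union> (C ` ?Z))"
    using L C by (intro finite_measure_mono) auto
  also have "\<dots> \<le> prob (L (s(i := y))) + prob (\<Union> (C ` ?Z))"
    using L C by (intro measure_Un_le) auto
  also have "prob (\<Union> (C ` ?Z)) \<le> (\<Sum>z\<in>?Z. prob (C z))"
    using C by (intro finite_measure_subadditive_finite) auto
  also have "\<dots> \<le> real (card ?Z) * (6 * w)" by (simp only: C) simp
  also have "\<dots> \<le> 4 * (6 * w)"
  proof (intro mult_right_mono)
    show "real (card ?Z) \<le> 4" by (simp add: card_insert_if)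
  qed (use w in simp)
  finally show ?thesis unfolding local_length_def L_def[symmetric] by linarith
qed

lemma local_length_upd:
  assumes w: "0 \<le> w" "w \<le> 1/16"
  shows "\<bar>local_length a b w n (s(i := y)) - local_length a b w n s\<bar> \<le> 24 * w"
proof -
  have eq: "(s(i := y))(i := s i) = s" by simp
  have "local_length a b w n (s(i := y)) \<le> local_length a b w n s + 24 * w"
    using local_length_upd_le[OF w, of a b n "s(i := y)" i "s i"] unfolding eq .
  then show ?thesis using local_length_upd_le[OF w, of a b n s i y] by linarith
qed

lemma prob_space_sample: "prob_space (sample n)"
  by (intro prob_space_PiM prob_space_unit_law)

lemma local_class_sample_measurable:
  "(\<lambda>(s, t). local_class a b w n s t) \<in> measurable (sample n \<Otimes>\<^sub>M unit_law) (count_space UNIV)"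
proof -
  have "Measurable.pred (sample n \<Otimes>\<^sub>M unit_law) (\<lambda>x. local_class a b w n (fst x) (snd x))"
  proof (rule local_class_measurable)
    show "(\<lambda>x. fst x k) \<in> borel_measurable (sample n \<Otimes>\<^sub>M unit_law)" if "k < n" for k
      using measurable_compose[OF measurable_fst sample_component[OF that]] .
    show "snd \<in> borel_measurable (sample n \<Otimes>\<^sub>M unit_law)"
      using measurable_snd[of "sample n" unit_law] by (simp add: measurable_cong_sets[OF refl sets_unit_law])
  qed
  then show ?thesis by (simp add: case_prod_beta')
qed

lemma local_length_measurable: "local_length a b w n \<in> borel_measurable (sample n)"
proof -
  interpret prob_space unit_law by (rule prob_space_unit_law)
  define E where "E = {x \<in> space (sample n \<Otimes>\<^sub>M unit_law). case x of (s, t) \<Rightarrow> local_class a b w n s t}"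
  have "E \<in> sets (sample n \<Otimes>\<^sub>M unit_law)"
    using local_class_sample_measurable unfolding E_def pred_def .
  from measurable_emeasure_Pair[OF this]
  have m: "(\<lambda>s. enn2real (emeasure unit_law (Pair s -` E))) \<in> borel_measurable (sample n)"
    by measurable
  have eq: "local_length a b w n s = enn2real (emeasure unit_law (Pair s -` E))" if "s \<in> space (sample n)" for s
  proof -
    have "Pair s -` E = {t. local_class a b w n s t}" using that by (simp add: E_def vimage_def space_pair_measure)
    then show ?thesis by (simp only: local_length_def measure_def)
  qed
  have "local_length a b w n \<in> borel_measurable (sample n) \<longleftrightarrow>
      (\<lambda>s. enn2real (emeasure unit_law (Pair s -` E))) \<in> borel_measurable (sample n)"
    by (rule measurable_cong) (rule eq)
  with m show ?thesis by blast
qed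

section \<open>Concentration and expectation of the local lengths\<close>

lemma concentration_tendsto_in_prob:
  fixes f :: "nat \<Rightarrow> (nat \<Rightarrow> real) \<Rightarrow> real"
  assumes m: "\<And>n. f n \<in> borel_measurable (sample n)"
    and B: "\<And>n s. \<bar>f n s\<bar> \<le> B n"
    and c: "\<And>n s i y. \<bar>f n (s(i := y)) - f n s\<bar> \<le> c n"
    and cn: "(\<lambda>n. real n * (c n)\<^sup>2) \<longlonglongrightarrow> 0"
    and E: "(\<lambda>n. \<integral>s. f n s \<partial>sample n) \<longlonglongrightarrow> L"
  shows "tendsto_in_prob sample f L"
  unfolding tendsto_in_prob_def
proof (intro allI impI)
  fix \<epsilon> \<delta> :: real assume \<epsilon>: "0 < \<epsilon>" and \<delta>: "0 < \<delta>"
  let ?m = "\<lambda>n. \<integral>s. f n s \<partial>sample n"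
  have "\<forall>\<^sub>F n in sequentially. dist (?m n) L < \<epsilon> / 2" using E \<epsilon> by (intro tendstoD) auto
  moreover have "\<forall>\<^sub>F n in sequentially. real n * (c n)\<^sup>2 < \<delta> * (\<epsilon> / 2)\<^sup>2"
    using cn \<epsilon> \<delta> by (intro order_tendstoD(2)) auto
  ultimately show "\<forall>\<^sub>F n in sequentially. \<exists>E\<in>sets (sample n).
      {s \<in> space (sample n). \<epsilon> < \<bar>f n s - L\<bar>} \<subseteq> E \<and> measure (sample n) E < \<delta>"
  proof eventually_elim
    fix n assume n: "dist (?m n) L < \<epsilon> / 2" "real n * (c n)\<^sup>2 < \<delta> * (\<epsilon> / 2)\<^sup>2"
    define E where "E = {s \<in> space (sample n). \<epsilon> / 2 \<le> \<bar>f n s - ?m n\<bar>}"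
    have "E \<in> sets (sample n)" using m[of n] unfolding E_def by measurable
    moreover have "{s \<in> space (sample n). \<epsilon> < \<bar>f n s - L\<bar>} \<subseteq> E"
    proof
      fix s assume s: "s \<in> {s \<in> space (sample n). \<epsilon> < \<bar>f n s - L\<bar>}"
      have "\<bar>f n s - L\<bar> \<le> \<bar>f n s - ?m n\<bar> + dist (?m n) L" unfolding dist_real_def by linarith
      then have "\<epsilon> / 2 \<le> \<bar>f n s - ?m n\<bar>" using s n(1) by simp
      then show "s \<in> E" using s by (simp add: E_def)
    qed
    moreover have "measure (sample n) E \<le> real (card {..<n}) * (c n)\<^sup>2 / (\<epsilon> / 2)\<^sup>2"
      unfolding E_def using \<epsilon> by (intro bounded_differences_Chebyshev[where B="B n"] prob_space_unit_law m B c) auto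
    moreover have "real (card {..<n}) * (c n)\<^sup>2 / (\<epsilon> / 2)\<^sup>2 < \<delta>"
      using n(2) \<epsilon> by (simp add: divide_less_eq)
    ultimately show "\<exists>E\<in>sets (sample n). {s \<in> space (sample n). \<epsilon> < \<bar>f n s - L\<bar>} \<subseteq> E \<and> measure (sample n) E < \<delta>"
      by (intro bexI[of _ E]) auto
  qed
qed

abbreviation box_prob :: "bool \<Rightarrow> bool \<Rightarrow> real \<Rightarrow> nat \<Rightarrow> real" where
  "box_prob c d w n \<equiv> enn2real (box_probability c d w n)"

text \<open>Inclusion-exclusion over the flags of \<open>class_event\<close>.\<close>

definition pair_prob :: "bool \<Rightarrow> bool \<Rightarrow> real \<Rightarrow> nat \<Rightarrow> real" where
  "pair_prob a b w n =
    (if a then if b then box_prob True True w n else box_prob True False w n - box_prob True True w n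
     else if b then box_prob False True w n - box_prob True True w n
     else box_prob False False w n - (box_prob True False w n + box_prob False True w n - box_prob True True w n))"

lemma measure_pair_class:
  assumes pq: "p < n" "q < n" "p \<noteq> q" and w: "w \<le> 1/16"
  shows "measure (sample n) {s \<in> space (sample n). pair_class a b w n s t p q} = pair_prob a b w n"
proof -
  interpret P: prob_space "sample n" by (rule prob_space_sample)
  define E where "E c d = {s \<in> space (sample n). class_event c d w n s t p q}" for c d
  have E: "E c d \<in> sets (sample n)" for c d
    using class_event_measurable[of n "\<lambda>s. s" "sample n" "\<lambda>_. t" c d w p q] sample_component
    unfolding E_def pred_def by simp
  have mE: "P.prob (E c d) = box_prob c d w n" for c d
    using emeasure_class_event[OF assms, of c d t] by (simp add: E_def measure_def)
  have sub: "E True True \<subseteq> E True False" "E True True \<subseteq> E False True" "E True False \<union> E False True \<subseteq> E False False"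
    "E False True - E True False = E False True - E True True"
    by (auto simp: E_def class_event_def)
  have un: "P.prob (E True False \<union> E False True) = box_prob True False w n + (box_prob False True w n - box_prob True True w n)"
    using P.finite_measure_Union'[OF E E, of True False False True] P.finite_measure_Diff[OF E E sub(2)]
    by (simp add: sub(4) mE)
  have *: "{s \<in> space (sample n). pair_class a b w n s t p q} =
    (if a then if b then E True True else E True False - E True True
     else if b then E False True - E True True else E False False - (E True False \<union> E False True))"
    by (cases a; cases b) (auto simp: E_def pair_class_event)
  have "P.prob (E True False - E True True) = box_prob True False w n - box_prob True True w n"
    "P.prob (E False True - E True True) = box_prob False True w n - box_prob True True w n"
    "P.prob (E False False - (E True False \<union> E False True)) =
      box_prob False False w n - (box_prob True False w n + (box_prob False True w n - box_prob True True w n))"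
    using P.finite_measure_Diff[OF E E sub(1)] P.finite_measure_Diff[OF E E sub(2)]
      P.finite_measure_Diff[OF E sets.Un[OF E E] sub(3)] un by (simp_all add: mE)
  then show ?thesis unfolding * pair_prob_def using mE[of True True] by simp
qed

lemma card_ordered_pairs: "card (SIGMA p:{..<n}. {..<n} - {p}) = n * (n - 1)"
proof -
  have "card (SIGMA p:{..<n}. {..<n} - {p}) = (\<Sum>p<n. card ({..<n} - {p}))"
    by (rule card_SigmaI) auto
  also have "\<dots> = (\<Sum>p<n. n - 1)" by (intro sum.cong) simp_all
  finally show ?thesis by simp
qed

text \<open>A location determines its ordered pair, so the events of different pairs are disjoint.
  Their probability depends neither on the pair nor on \<open>t\<close>.\<close>

lemma measure_local_class:
  assumes w: "w \<le> 1/16"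
  shows "measure (sample n) {s \<in> space (sample n). local_class a b w n s t} = real (n * (n - 1)) * pair_prob a b w n"
proof -
  interpret P: prob_space "sample n" by (rule prob_space_sample)
  let ?I = "SIGMA p:{..<n}. {..<n} - {p}"
  let ?A = "\<lambda>pq. {s \<in> space (sample n). pair_class a b w n s t (fst pq) (snd pq)}"
  have "\<not> pair_class a b w n s t p p" for s p
    using wrap_antipodal[of "s p" t] w unfolding pair_class_def by linarith
  then have "{s \<in> space (sample n). local_class a b w n s t} = (\<Union>pq\<in>?I. ?A pq)"
    unfolding local_class_def by fastforce
  also have "P.prob \<dots> = (\<Sum>pq\<in>?I. P.prob (?A pq))"
  proof (rule P.finite_measure_finite_Union)
    show "?A ` ?I \<subseteq> sets (sample n)"
    proof (rule image_subsetI)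
      fix pq
      show "?A pq \<in> sets (sample n)"
        using pair_class_measurable[of n "\<lambda>s. s" "sample n" "\<lambda>_. t" a b w "fst pq" "snd pq"] sample_component
        unfolding pred_def by simp
    qed
    show "disjoint_family_on ?A ?I"
    proof (unfold disjoint_family_on_def, intro ballI impI equals0I)
      fix u v s assume "u \<noteq> v" and "s \<in> ?A u \<inter> ?A v"
      then have "near n s t (fst u)" "near n s t (fst v)" "near n s (t + 1/2) (snd u)" "near n s (t + 1/2) (snd v)"
        by (simp_all add: pair_class_def)
      then have "fst u = fst v" "snd u = snd v" using near_unique by blast+
      then show False using \<open>u \<noteq> v\<close> by (simp add: prod_eq_iff)
    qed
  qed simp
  also have "\<dots> = (\<Sum>pq\<in>?I. pair_prob a b w n)"
    using w by (intro sum.cong refl measure_pair_class) auto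
  also have "\<dots> = real (n * (n - 1)) * pair_prob a b w n"
    by (simp only: sum_constant card_ordered_pairs)
  finally show ?thesis .
qed

text \<open>By Fubini the mean length is the average over \<open>t\<close> of the probability in
  \<open>measure_local_class\<close>, which is constant in \<open>t\<close>.\<close>

lemma integral_local_length:
  assumes w: "w \<le> 1/16"
  shows "(\<integral>s. local_length a b w n s \<partial>sample n) = real (n * (n - 1)) * pair_prob a b w n"
proof -
  interpret P: prob_space "sample n" by (rule prob_space_sample)
  interpret U: prob_space unit_law by (rule prob_space_unit_law)
  interpret PU: pair_sigma_finite "sample n" unit_law ..
  let ?c = "real (n * (n - 1)) * pair_prob a b w n"
  have c: "0 \<le> ?c" unfolding measure_local_class[OF w, symmetric, where t=0] by simp
  define E where "E = {x \<in> space (sample n \<Otimes>\<^sub>M unit_law). case x of (s, t) \<Rightarrow> local_class a b w n s t}"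
  have E: "E \<in> sets (sample n \<Otimes>\<^sub>M unit_law)"
    using local_class_sample_measurable unfolding E_def pred_def .
  have "(\<integral>\<^sup>+s. ennreal (local_length a b w n s) \<partial>sample n) = (\<integral>\<^sup>+s. \<integral>\<^sup>+t. indicator E (s, t) \<partial>unit_law \<partial>sample n)"
  proof (intro nn_integral_cong)
    fix s assume s: "s \<in> space (sample n)"
    have "(\<integral>\<^sup>+t. indicator E (s, t) \<partial>unit_law) = (\<integral>\<^sup>+t. indicator {t. local_class a b w n s t} t \<partial>unit_law)"
      using s by (intro nn_integral_cong) (simp add: E_def indicator_def space_pair_measure)
    also have "\<dots> = emeasure unit_law {t. local_class a b w n s t}"
      by (rule nn_integral_indicator) (simp add: sets_local_class)
    finally show "ennreal (local_length a b w n s) = (\<integral>\<^sup>+t. indicator E (s, t) \<partial>unit_law)"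
      by (simp add: local_length_def U.emeasure_eq_measure)
  qed
  also have "\<dots> = (\<integral>\<^sup>+t. \<integral>\<^sup>+s. indicator E (s, t) \<partial>sample n \<partial>unit_law)"
    using E by (intro PU.Fubini'[symmetric]) (simp add: case_prod_beta')
  also have "\<dots> = (\<integral>\<^sup>+t. ennreal ?c \<partial>unit_law)"
  proof (intro nn_integral_cong)
    fix t
    have m: "{s \<in> space (sample n). local_class a b w n s t} \<in> sets (sample n)"
      using local_class_measurable[of n "\<lambda>s. s" "sample n" "\<lambda>_. t" a b w] sample_component
      unfolding pred_def by simp
    have "(\<integral>\<^sup>+s. indicator E (s, t) \<partial>sample n) = (\<integral>\<^sup>+s. indicator {s \<in> space (sample n). local_class a b w n s t} s \<partial>sample n)"
      by (intro nn_integral_cong) (simp add: E_def indicator_def space_pair_measure)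
    also have "\<dots> = emeasure (sample n) {s \<in> space (sample n). local_class a b w n s t}"
      by (rule nn_integral_indicator[OF m])
    also have "\<dots> = ennreal ?c"
      unfolding P.emeasure_eq_measure measure_local_class[OF w] ..
    finally show "(\<integral>\<^sup>+s. indicator E (s, t) \<partial>sample n) = ennreal ?c" .
  qed
  also have "\<dots> = ennreal ?c"
    by (simp only: nn_integral_const U.emeasure_space_1 mult_1_right)
  finally have I: "(\<integral>\<^sup>+s. ennreal (local_length a b w n s) \<partial>sample n) = ennreal ?c" .
  have "0 \<le> local_length a b w n s" for s by (simp add: local_length_def)
  then have "(\<integral>s. local_length a b w n s \<partial>sample n) = enn2real (\<integral>\<^sup>+s. ennreal (local_length a b w n s) \<partial>sample n)"
    by (intro integral_eq_nn_integral local_length_measurable AE_I2)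
  then show ?thesis unfolding I using c by simp
qed

text \<open>The power takes over for large \<open>n\<close>; the cap 1/16 makes the geometric lemmas
  apply for every \<open>n\<close>.\<close>

definition window :: "nat \<Rightarrow> real" where
  "window n = min (1/16) (real n powr (- 3/4))"

lemma window: "0 \<le> window n" "window n \<le> 1/16"
  by (simp_all add: window_def)

lemma window_limit: "(\<lambda>n. real n * (24 * window n)\<^sup>2) \<longlonglongrightarrow> 0"
proof -
  have "(\<lambda>n. real n * (24 * min (1/16) (real n powr (- 3/4)))\<^sup>2) \<longlonglongrightarrow> 0" by real_asymp
  then show ?thesis by (simp add: window_def)
qed

lemma window_at_top: "filterlim (\<lambda>n. real n * window n) at_top sequentially"
proof -
  have "filterlim (\<lambda>n. real n * min (1/16) (real n powr (- 3/4))) at_top sequentially" by real_asymp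
  then show ?thesis by (simp add: window_def)
qed

text \<open>The values arise as \<open>3/8\<close>, twice \<open>5/8 - 3/8\<close>, and
  \<open>1 - (5/8 + 5/8 - 3/8)\<close>.\<close>

definition class_limit :: "bool \<Rightarrow> bool \<Rightarrow> real" where
  "class_limit a b = (if a then if b then 3/8 else 1/4 else if b then 1/4 else 1/8)"

lemma box_prob_limit:
  "(\<lambda>n. real (n * (n - 1)) * box_prob c d (window n) n) \<longlonglongrightarrow> (if c then if d then 3/8 else 5/8 else if d then 5/8 else 1)"
proof -
  let ?k = "if c then if d then 3/8 else 5/8 else if d then 5/8 else 1 :: real"
  have "(\<lambda>n. ennreal (real n ^ 2) * box_probability c d (window n) n) \<longlonglongrightarrow> ennreal ?k"
    unfolding box_probability_def by (rule box_integral_limit[OF window(2) window_at_top])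
  then have "(\<lambda>n. enn2real (ennreal (real n ^ 2) * box_probability c d (window n) n)) \<longlonglongrightarrow> ?k"
    by (rule tendsto_enn2real) simp
  then have 1: "(\<lambda>n. real n ^ 2 * box_prob c d (window n) n) \<longlonglongrightarrow> ?k" by (simp add: enn2real_mult)
  have "(\<lambda>n. (real n - 1) / real n) \<longlonglongrightarrow> 1" by real_asymp
  from tendsto_mult[OF this 1]
  have "(\<lambda>n. (real n - 1) / real n * (real n ^ 2 * box_prob c d (window n) n)) \<longlonglongrightarrow> ?k" by simp
  moreover have "\<forall>\<^sub>F n in sequentially. (real n - 1) / real n * (real n ^ 2 * box_prob c d (window n) n) =
      real (n * (n - 1)) * box_prob c d (window n) n"
    using eventually_gt_at_top[of 0]
    by eventually_elim (simp add: of_nat_diff power2_eq_square)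
  ultimately show ?thesis by (rule Lim_transform_eventually)
qed

lemma pair_prob_limit: "(\<lambda>n. real (n * (n - 1)) * pair_prob a b (window n) n) \<longlonglongrightarrow> class_limit a b"
proof -
  have "(\<lambda>n. real (n * (n - 1)) * pair_prob True True (window n) n) \<longlonglongrightarrow> 3/8"
    using box_prob_limit[of True True] by (simp add: pair_prob_def)
  moreover have "(\<lambda>n. real (n * (n - 1)) * pair_prob True False (window n) n) \<longlonglongrightarrow> 5/8 - 3/8"
    using tendsto_diff[OF box_prob_limit[of True False] box_prob_limit[of True True]]
    by (simp only: pair_prob_def right_diff_distrib if_True if_False)
  moreover have "(\<lambda>n. real (n * (n - 1)) * pair_prob False True (window n) n) \<longlonglongrightarrow> 5/8 - 3/8"
    using tendsto_diff[OF box_prob_limit[of False True] box_prob_limit[of True True]]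
    by (simp only: pair_prob_def right_diff_distrib if_True if_False)
  moreover have "(\<lambda>n. real (n * (n - 1)) * pair_prob False False (window n) n) \<longlonglongrightarrow> 1 - (5/8 + 5/8 - 3/8)"
    using tendsto_diff[OF box_prob_limit[of False False] tendsto_diff[OF
        tendsto_add[OF box_prob_limit[of True False] box_prob_limit[of False True]] box_prob_limit[of True True]]]
    by (simp only: pair_prob_def right_diff_distrib distrib_left if_True if_False)
  ultimately show ?thesis by (cases a; cases b) (simp_all add: class_limit_def)
qed

lemma local_length_tendsto: "tendsto_in_prob sample (\<lambda>n. local_length a b (window n) n) (class_limit a b)"
proof (rule concentration_tendsto_in_prob)
  show "\<bar>local_length a b (window n) n s\<bar> \<le> 1" for n s
  proof -
    interpret prob_space unit_law by (rule prob_space_unit_law)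
    show ?thesis by (simp add: local_length_def)
  qed
  show "(\<lambda>n. \<integral>s. local_length a b (window n) n s \<partial>sample n) \<longlonglongrightarrow> class_limit a b"
    unfolding integral_local_length[OF window(2)] by (rule pair_prob_limit)
qed (rule local_length_measurable local_length_upd window window_limit)+

section \<open>Mutually farthest points\<close>

text \<open>An arbitrary index set allows a point to be deleted; moving a point is treated as a
  deletion followed by an insertion.\<close>

definition near_in :: "nat set \<Rightarrow> (nat \<Rightarrow> real) \<Rightarrow> real \<Rightarrow> nat \<Rightarrow> bool" where
  "near_in I s t p \<longleftrightarrow> p \<in> I \<and> (\<forall>k\<in>I. k \<noteq> p \<longrightarrow> cdist (s p) t < cdist (s k) t)"

definition mutual_in :: "nat set \<Rightarrow> real \<Rightarrow> (nat \<Rightarrow> real) \<Rightarrow> nat \<Rightarrow> nat \<Rightarrow> bool" where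
  "mutual_in I w s p q \<longleftrightarrow> near_in I s (s p + 1/2) q \<and> near_in I s (s q + 1/2) p \<and> cdist (s q) (s p + 1/2) \<le> w"

definition matched_in :: "nat set \<Rightarrow> real \<Rightarrow> (nat \<Rightarrow> real) \<Rightarrow> nat set" where
  "matched_in I w s = {p. \<exists>q. mutual_in I w s p q}"

lemma near_in_lessThan: "near_in {..<n} s t p \<longleftrightarrow> near n s t p"
  by (simp add: near_in_def near_def Ball_def)

lemma mutual_in_lessThan: "mutual_in {..<n} w s p q \<longleftrightarrow> mutual w n s p q"
  by (simp add: mutual_in_def mutual_def near_in_lessThan)

lemma near_in_unique:
  assumes "near_in I s t p" "near_in I s t p'"
  shows "p = p'"
proof (rule ccontr)
  assume ne: "p \<noteq> p'"
  have "p \<in> I" "p' \<in> I" using assms unfolding near_in_def by blast+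
  then have "cdist (s p) t < cdist (s p') t" "cdist (s p') t < cdist (s p) t"
    using assms ne ne[symmetric] unfolding near_in_def by simp_all
  then show False by linarith
qed

lemma near_in_delete:
  assumes "near_in (I - {i}) s t q" "cdist (s q) t < cdist (s i) t"
  shows "near_in I s t q"
  unfolding near_in_def
proof (intro conjI ballI impI)
  fix k assume "k \<in> I" "k \<noteq> q"
  then show "cdist (s q) t < cdist (s k) t"
    using assms by (cases "k = i") (simp_all add: near_in_def)
qed (use assms in \<open>simp add: near_in_def\<close>)

lemma mutual_in_sym: "mutual_in I w s p q \<Longrightarrow> mutual_in I w s q p"
  unfolding mutual_in_def wrap_antipodal_commute[of "s q" "s p"] by blast

lemma mutual_in_mem: "mutual_in I w s p q \<Longrightarrow> p \<in> I \<and> q \<in> I"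
  unfolding mutual_in_def near_in_def by blast

lemma matched_in_subset: "matched_in I w s \<subseteq> I"
  unfolding matched_in_def using mutual_in_mem by blast

lemma mutual_in_unique: "mutual_in I w s p q \<Longrightarrow> mutual_in I w s p' q \<Longrightarrow> p = p'"
  unfolding mutual_in_def using near_in_unique by blast

lemma card_mutual_partner: "finite I \<Longrightarrow> card {p. mutual_in I w s p q} \<le> 1"
proof -
  assume "finite I"
  moreover have "{p. mutual_in I w s p q} \<subseteq> I" using mutual_in_mem by blast
  ultimately have "finite {p. mutual_in I w s p q}" by (rule rev_finite_subset)
  then show ?thesis unfolding One_nat_def card_le_Suc0_iff_eq[OF \<open>finite {p. mutual_in I w s p q}\<close>]
    using mutual_in_unique by blast
qed

text \<open>A mutual pair \<open>(a, b)\<close> destroyed by a new point \<open>y\<close> that is too close to the antipode of \<open>a\<close> has no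
  other point between \<open>y\<close> and \<open>b\<close>. So \<open>b\<close> is one of the two neighbours of \<open>y\<close>.\<close>

definition blocked :: "nat set \<Rightarrow> real \<Rightarrow> (nat \<Rightarrow> real) \<Rightarrow> real \<Rightarrow> nat set" where
  "blocked I w s y = {b. \<exists>a. mutual_in I w s a b \<and> cdist y (s a + 1/2) \<le> cdist (s b) (s a + 1/2)}"

text \<open>Relative to the antipode \<open>c\<close> of \<open>a\<close>, the point
  \<open>b\<close> sits at \<open>g\<close> and \<open>y\<close> at \<open>e\<close> with
  \<open>\<bar>e\<bar> \<le> \<bar>g\<bar>\<close>. A point between \<open>y\<close> and
  \<open>b\<close> has displacement between \<open>e\<close> and \<open>g\<close>, so it is no
  farther from \<open>c\<close> than \<open>b\<close> is, while \<open>b\<close> is the unique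
  nearest point to \<open>c\<close>.\<close>

lemma blocked_between:
  assumes w: "w \<le> 1/16" and b: "b \<in> blocked I w s y" and k: "k \<in> I"
    and btw: "0 \<le> wrap (s k - y) \<and> wrap (s k - y) \<le> wrap (s b - y) \<or>
      wrap (s b - y) \<le> wrap (s k - y) \<and> wrap (s k - y) \<le> 0"
  shows "k = b"
proof (rule ccontr)
  assume "k \<noteq> b"
  obtain a where a: "mutual_in I w s a b" "cdist y (s a + 1/2) \<le> cdist (s b) (s a + 1/2)"
    using b by (auto simp: blocked_def)
  define c where "c = s a + 1/2"
  define g where "g = wrap (s b - c)"
  define e where "e = wrap (y - c)"
  have g: "\<bar>g\<bar> \<le> w" using a(1) by (simp add: mutual_in_def g_def c_def)
  have e: "\<bar>e\<bar> \<le> \<bar>g\<bar>" using a(2) by (simp add: e_def g_def c_def)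
  have bd: "- w \<le> g" "g \<le> w" "- w \<le> e" "e \<le> w" using g e by linarith+
  obtain j where j: "y - c = e + of_int j" unfolding e_def by (rule wrap_decomp)
  have e1: "wrap ((s b - c) + - e) = wrap (s b - c) + - e"
    by (rule wrap_add_id; unfold g_def[symmetric]; use bd w in linarith)
  have e2: "s b - y = (s b - c) + - e - of_int j" using j by simp
  have \<beta>: "wrap (s b - y) = g - e" unfolding e2 wrap_diff_int e1 g_def by simp
  have e3: "wrap ((s k - y) + e) = wrap (s k - y) + e"
    by (rule wrap_add_id) (use bd w btw \<beta> in linarith)+
  have e4: "s k - c = (s k - y) + e + of_int j" using j by simp
  have "wrap (s k - c) = wrap (s k - y) + e" unfolding e4 wrap_add_int e3 ..
  then have "cdist (s k) c \<le> \<bar>g\<bar>" using e btw \<beta> by linarith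
  moreover have "\<bar>g\<bar> < cdist (s k) c"
    using a(1) k \<open>k \<noteq> b\<close> unfolding mutual_in_def near_in_def g_def c_def by blast
  ultimately show False by linarith
qed

text \<open>Of two blocked points on the same side of \<open>y\<close>, one lies between
  \<open>y\<close> and the other, so they coincide. There are two sides.\<close>

lemma card_blocked:
  assumes "finite I" "w \<le> 1/16"
  shows "card (blocked I w s y) \<le> 2" "blocked I w s y \<subseteq> I"
proof -
  show sub: "blocked I w s y \<subseteq> I" unfolding blocked_def using mutual_in_mem by blast
  then have fin: "finite (blocked I w s y)" using assms(1) by (rule finite_subset)
  let ?P = "{b \<in> blocked I w s y. 0 \<le> wrap (s b - y)}" and ?N = "{b \<in> blocked I w s y. wrap (s b - y) \<le> 0}"
  have eq: "b = b'" if "b \<in> ?P" "b' \<in> ?P" for b b'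
    using blocked_between[OF assms(2), of b I s y b'] blocked_between[OF assms(2), of b' I s y b] that sub
    by (cases "wrap (s b - y) \<le> wrap (s b' - y)") auto
  have eq': "b = b'" if "b \<in> ?N" "b' \<in> ?N" for b b'
    using blocked_between[OF assms(2), of b I s y b'] blocked_between[OF assms(2), of b' I s y b] that sub
    by (cases "wrap (s b - y) \<le> wrap (s b' - y)") auto
  have "card ?P \<le> 1" "card ?N \<le> 1"
    using fin eq eq' by (simp_all add: card_le_Suc0_iff_eq)
  moreover have "card (blocked I w s y) \<le> card (?P \<union> ?N)"
  proof (rule card_mono)
    show "finite (?P \<union> ?N)" using fin by simp
    show "blocked I w s y \<subseteq> ?P \<union> ?N" by force
  qed
  moreover have "card (?P \<union> ?N) \<le> card ?P + card ?N" by (rule card_Un_le)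
  ultimately show "card (blocked I w s y) \<le> 2" by linarith
qed

text \<open>Deleting a point unmatches at most that point and its partner, hence 2. Inserting one
  unmatches only blocked points and their partners: two blocked points with one partner each, hence
  4.\<close>

lemma card_matched_delete:
  assumes I: "finite I" "i \<in> I" and w: "w \<le> 1/16"
  shows "card (matched_in I w s) \<le> card (matched_in (I - {i}) w s) + 2"
    "card (matched_in (I - {i}) w s) \<le> card (matched_in I w s) + 4"
proof -
  let ?A = "matched_in I w s" and ?B = "matched_in (I - {i}) w s" and ?H = "blocked (I - {i}) w s (s i)"
  have fin: "finite ?A" "finite ?B"
    using I matched_in_subset[of I w s] matched_in_subset[of "I - {i}" w s] by (auto intro: finite_subset)
  have keep: "mutual_in (I - {i}) w s p q" if "mutual_in I w s p q" "p \<noteq> i" "q \<noteq> i" for p q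
    using that by (auto simp: mutual_in_def near_in_def)
  have "?A \<subseteq> ?B \<union> ({i} \<union> {p. mutual_in I w s p i})"
    using keep unfolding matched_in_def by blast
  then have "card ?A \<le> card (?B \<union> ({i} \<union> {p. mutual_in I w s p i}))"
    using fin I by (intro card_mono) (auto dest: mutual_in_mem intro: finite_subset[of _ I])
  also have "\<dots> \<le> card ?B + (card {i} + card {p. mutual_in I w s p i})"
    by (intro order_trans[OF card_Un_le] add_left_mono card_Un_le)
  finally show "card ?A \<le> card ?B + 2" using card_mutual_partner[OF I(1), of w s i] by simp
  have H: "card ?H \<le> 2" "?H \<subseteq> I - {i}" using card_blocked[of "I - {i}" w s "s i"] I w by auto
  let ?K = "\<Union>q\<in>?H. {p. mutual_in (I - {i}) w s p q}"
  have finH: "finite ?H" using H(2) I(1) by (auto intro: finite_subset)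
  have "?B \<subseteq> ?A \<union> (?H \<union> ?K)"
  proof
    fix p assume "p \<in> ?B"
    then obtain q where q: "mutual_in (I - {i}) w s p q" by (auto simp: matched_in_def)
    show "p \<in> ?A \<union> (?H \<union> ?K)"
    proof (cases "mutual_in I w s p q")
      case False
      from False q have "\<not> near_in I s (s p + 1/2) q \<or> \<not> near_in I s (s q + 1/2) p"
        unfolding mutual_in_def by blast
      then have "cdist (s i) (s p + 1/2) \<le> cdist (s q) (s p + 1/2) \<or> cdist (s i) (s q + 1/2) \<le> cdist (s p) (s q + 1/2)"
        using q near_in_delete[of I i s] unfolding mutual_in_def not_less[symmetric] by blast
      then have "q \<in> ?H \<or> p \<in> ?H"
        unfolding blocked_def using q mutual_in_sym[OF q] by blast
      then show ?thesis using q by blast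
    qed (auto simp: matched_in_def)
  qed
  moreover have "finite ?K" using finH I(1) mutual_in_mem by (intro finite_UN_I) (auto intro: finite_subset[of _ I] dest: mutual_in_mem)
  ultimately have "card ?B \<le> card (?A \<union> (?H \<union> ?K))"
    using fin finH by (intro card_mono) auto
  also have "\<dots> \<le> card ?A + (card ?H + card ?K)"
    by (intro order_trans[OF card_Un_le] add_left_mono card_Un_le)
  also have "card ?K \<le> (\<Sum>q\<in>?H. card {p. mutual_in (I - {i}) w s p q})" by (rule card_UN_le[OF finH])
  also have "\<dots> \<le> (\<Sum>q\<in>?H. 1)" using I by (intro sum_mono card_mutual_partner) simp
  finally show "card ?B \<le> card ?A + 4" using H(1) by simp
qed

lemma matched_in_upd: "i \<notin> I \<Longrightarrow> matched_in I w (s(i := y)) = matched_in I w s"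
proof -
  assume i: "i \<notin> I"
  have near: "near_in I (s(i := y)) t p \<longleftrightarrow> near_in I s t p" for t p
    unfolding near_in_def using i by (metis fun_upd_other)
  have "mutual_in I w (s(i := y)) p q \<longleftrightarrow> mutual_in I w s p q" for p q
  proof (cases "p \<in> I \<and> q \<in> I")
    case True
    then have "(s(i := y)) p = s p" "(s(i := y)) q = s q" using i by auto
    then show ?thesis unfolding mutual_in_def near by simp
  next
    case False
    then show ?thesis using mutual_in_mem by blast
  qed
  then show ?thesis by (simp add: matched_in_def)
qed

section \<open>The fraction of mutually farthest points\<close>

definition mutual_fraction :: "real \<Rightarrow> nat \<Rightarrow> (nat \<Rightarrow> real) \<Rightarrow> real" where
  "mutual_fraction w n s = real (card {p. \<exists>q. mutual w n s p q}) / real n"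

lemma mutual_less: "mutual w n s p q \<Longrightarrow> p < n \<and> q < n"
  unfolding mutual_def using near_less by blast

text \<open>Passing through the configuration without point \<open>i\<close> costs at most 2 + 4
  matched points, rounded up to 8. The bound does not involve \<open>w\<close>, so a fixed window is
  good enough for concentration.\<close>

lemma mutual_fraction_upd:
  assumes w: "w \<le> 1/16"
  shows "\<bar>mutual_fraction w n (s(i := y)) - mutual_fraction w n s\<bar> \<le> 8 / real n"
proof -
  have eq: "{p. \<exists>q. mutual w n s p q} = matched_in {..<n} w s" for s
    by (simp add: matched_in_def mutual_in_lessThan)
  have "\<bar>real (card (matched_in {..<n} w (s(i := y)))) - real (card (matched_in {..<n} w s))\<bar> \<le> 8"
  proof (cases "i < n")
    case True
    note d = card_matched_delete[of "{..<n}" i w, OF _ _ w]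
    show ?thesis
      using d[of s] d[of "s(i := y)"] True matched_in_upd[of i "{..<n} - {i}" w s y] by simp
  qed (simp add: matched_in_upd)
  then show ?thesis
    unfolding mutual_fraction_def eq diff_divide_distrib[symmetric] abs_divide by (simp add: divide_right_mono)
qed

lemma mutual_measurable: "Measurable.pred (sample n) (\<lambda>s. mutual w n s p q)"
proof (cases "p < n \<and> q < n")
  case True
  then have [measurable]: "(\<lambda>s. s p) \<in> borel_measurable (sample n)" "(\<lambda>s. s q) \<in> borel_measurable (sample n)"
    by (simp_all add: sample_component)
  have nm: "Measurable.pred (sample n) (\<lambda>s. near n s (t s) k)" if "t \<in> borel_measurable (sample n)" for t k
    by (rule near_measurable[where s="\<lambda>s. s", OF sample_component that])
  have [measurable]: "Measurable.pred (sample n) (\<lambda>s. near n s (s p + 1/2) q)"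
    by (rule nm) measurable
  have [measurable]: "Measurable.pred (sample n) (\<lambda>s. near n s (s q + 1/2) p)"
    by (rule nm) measurable
  show ?thesis unfolding mutual_def by measurable
next
  case False
  then have "\<not> mutual w n s p q" for s using mutual_less by blast
  then show ?thesis by simp
qed

lemma mutual_fraction_sum:
  "mutual_fraction w n s = (\<Sum>p<n. indicator {s. \<exists>q. mutual w n s p q} s) / real n"
proof -
  have "{p. \<exists>q. mutual w n s p q} = {p \<in> {..<n}. \<exists>q. mutual w n s p q}" using mutual_less by blast
  moreover have "(\<Sum>p<n. indicator {s. \<exists>q. mutual w n s p q} s) = (\<Sum>p\<in>{p \<in> {..<n}. \<exists>q. mutual w n s p q}. 1 :: real)"
    by (rule sum.mono_neutral_cong_right) (auto simp: indicator_def)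
  ultimately show ?thesis by (simp add: mutual_fraction_def)
qed

lemma exists_mutual_measurable: "{s \<in> space (sample n). \<exists>q. mutual w n s p q} \<in> sets (sample n)"
proof -
  have [measurable]: "Measurable.pred (sample n) (\<lambda>s. mutual w n s p q)" for q by (rule mutual_measurable)
  show ?thesis by measurable
qed

lemma mutual_fraction_measurable: "mutual_fraction w n \<in> borel_measurable (sample n)"
proof -
  have "indicator {s. \<exists>q. mutual w n s p q} \<in> borel_measurable (sample n)" for p
  proof -
    have "Measurable.pred (sample n) (\<lambda>s. \<exists>q. mutual w n s p q)"
      using exists_mutual_measurable unfolding pred_def .
    then show ?thesis by measurable
  qed
  then have "(\<lambda>s. (\<Sum>p<n. indicator {s. \<exists>q. mutual w n s p q} s) / real n) \<in> borel_measurable (sample n)"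
    by (intro borel_measurable_divide borel_measurable_sum borel_measurable_const)
  then show ?thesis by (simp add: mutual_fraction_sum[abs_def])
qed

text \<open>The partner of \<open>p\<close> is unique, so the \<open>n - 1\<close> candidate events
  are disjoint and equally likely.\<close>

lemma measure_exists_mutual:
  assumes p: "p < n" and w: "0 \<le> w" "w \<le> 1/16"
  shows "measure (sample n) {s \<in> space (sample n). \<exists>q. mutual w n s p q} =
    real (n - 1) * ((1 - (1 - 4 * w) ^ Suc (n - 2)) / (2 * real (Suc (n - 2))))"
proof -
  interpret P: prob_space "sample n" by (rule prob_space_sample)
  let ?c = "(1 - (1 - 4 * w) ^ Suc (n - 2)) / (2 * real (Suc (n - 2)))"
  have "(1 - 4 * w) ^ Suc (n - 2) \<le> 1" using w by (intro power_le_one) auto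
  then have c: "0 \<le> ?c" by simp
  let ?A = "\<lambda>q. {s \<in> space (sample n). mutual w n s p q}"
  have irrefl: "\<not> mutual w n s p p" for s
    using w abs_wrap_neg_half[of "s p"] unfolding mutual_def by linarith
  have "{s \<in> space (sample n). \<exists>q. mutual w n s p q} = (\<Union>q\<in>{..<n} - {p}. ?A q)"
  proof (intro equalityI subsetI)
    fix s assume "s \<in> {s \<in> space (sample n). \<exists>q. mutual w n s p q}"
    then obtain q where q: "s \<in> space (sample n)" "mutual w n s p q" by blast
    then have "q \<in> {..<n} - {p}" using mutual_less[OF q(2)] irrefl by auto
    then show "s \<in> (\<Union>q\<in>{..<n} - {p}. ?A q)" using q by blast
  qed blast
  also have "P.prob \<dots> = (\<Sum>q\<in>{..<n} - {p}. P.prob (?A q))"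
  proof (rule P.finite_measure_finite_Union)
    show "?A ` ({..<n} - {p}) \<subseteq> sets (sample n)"
      by (rule image_subsetI) (use mutual_measurable in \<open>simp add: pred_def\<close>)
    show "disjoint_family_on ?A ({..<n} - {p})"
    proof (unfold disjoint_family_on_def, intro ballI impI equals0I)
      fix u v s assume "u \<noteq> v" "s \<in> ?A u \<inter> ?A v"
      then show False using near_unique[of n s "s p + 1/2" u v] by (simp add: mutual_def)
    qed
  qed simp
  also have "\<dots> = (\<Sum>q\<in>{..<n} - {p}. ?c)"
  proof (intro sum.cong refl)
    fix q assume "q \<in> {..<n} - {p}"
    then have q: "q < n" "p \<noteq> q" by auto
    show "P.prob (?A q) = ?c"
      unfolding measure_def emeasure_mutual[OF p q w] by (rule enn2real_ennreal[OF c])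
  qed
  also have "\<dots> = real (card ({..<n} - {p})) * ?c" by (rule sum_constant)
  also have "card ({..<n} - {p}) = n - 1" using p by simp
  finally show ?thesis .
qed

text \<open>The \<open>n - 1\<close> candidates cancel the denominator from
  \<open>emeasure_mutual\<close>. What is left tends to 1/2, the source of the fractions 1/4, 1/2
  and 1/4.\<close>

lemma integral_mutual_fraction:
  assumes n: "2 \<le> n" and w: "0 \<le> w" "w \<le> 1/16"
  shows "(\<integral>s. mutual_fraction w n s \<partial>sample n) = (1 - (1 - 4 * w) ^ (n - 1)) / 2"
proof -
  interpret P: prob_space "sample n" by (rule prob_space_sample)
  let ?A = "\<lambda>p. {s \<in> space (sample n). \<exists>q. mutual w n s p q}"
  have "(\<integral>s. mutual_fraction w n s \<partial>sample n) = (\<integral>s. (\<Sum>p<n. indicator (?A p) s) / real n \<partial>sample n)"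
    by (rule Bochner_Integration.integral_cong) (simp_all add: mutual_fraction_sum indicator_def)
  also have "\<dots> = (\<Sum>p<n. \<integral>s. indicator (?A p) s \<partial>sample n) / real n"
    using exists_mutual_measurable
    by (subst Bochner_Integration.integral_divide_zero, subst Bochner_Integration.integral_sum) (auto intro!: integrable_real_indicator simp: P.emeasure_eq_measure)
  also have "\<dots> = (\<Sum>p<n. P.prob (?A p)) / real n"
    using exists_mutual_measurable by simp
  also have "\<dots> = (\<Sum>p<n. real (n - 1) * ((1 - (1 - 4 * w) ^ Suc (n - 2)) / (2 * real (Suc (n - 2))))) / real n"
    using w by (intro arg_cong2[where f="(/)"] sum.cong refl measure_exists_mutual) auto
  also have "\<dots> = real (n - 1) * ((1 - (1 - 4 * w) ^ (n - 1)) / (2 * real (n - 1)))"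
    using n Suc_diff_Suc[of 1 n] by (simp add: numeral_2_eq_2)
  also have "\<dots> = (1 - (1 - 4 * w) ^ (n - 1)) / 2"
  proof -
    have "real m * (X / (2 * real m)) = X / 2" if "m \<noteq> 0" for m :: nat and X by (simp add: that)
    from this[of "n - 1"] show ?thesis using n by simp
  qed
  finally show ?thesis .
qed

lemma mutual_fraction_tendsto: "tendsto_in_prob sample (mutual_fraction (1/16)) (1/2)"
proof (rule concentration_tendsto_in_prob)
  show "\<bar>mutual_fraction (1/16) n s\<bar> \<le> 1" for n s
  proof -
    have "card {p. \<exists>q. mutual (1/16) n s p q} \<le> card {..<n}"
      using mutual_less by (intro card_mono) auto
    then show ?thesis by (cases "n = 0") (simp_all add: mutual_fraction_def divide_le_eq_1)
  qed
  show "\<bar>mutual_fraction (1/16) n (s(i := y)) - mutual_fraction (1/16) n s\<bar> \<le> 8 / real n" for n s i y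
    by (rule mutual_fraction_upd) simp
  show "(\<lambda>n. real n * (8 / real n)\<^sup>2) \<longlonglongrightarrow> 0" by real_asymp
  have "(\<lambda>n. (1 - (1 - 4 * (1/16)) ^ (n - 1)) / 2) \<longlonglongrightarrow> (1/2 :: real)"
  proof (rule LIMSEQ_offset[where k=1])
    show "(\<lambda>n. (1 - (1 - 4 * (1/16)) ^ (n + 1 - 1)) / 2) \<longlonglongrightarrow> (1/2 :: real)" by simp real_asymp
  qed
  moreover have "\<forall>\<^sub>F n in sequentially. (1 - (1 - 4 * (1/16)) ^ (n - 1)) / 2 = (\<integral>s. mutual_fraction (1/16) n s \<partial>sample n)"
    using eventually_ge_at_top[of 2] by eventually_elim (subst integral_mutual_fraction, simp_all)
  ultimately show "(\<lambda>n. \<integral>s. mutual_fraction (1/16) n s \<partial>sample n) \<longlonglongrightarrow> 1/2"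
    by (rule Lim_transform_eventually)
qed (rule mutual_fraction_measurable)

section \<open>Convergence for uniform coordinates\<close>

abbreviation rare :: "'a measure \<Rightarrow> real \<Rightarrow> 'a set \<Rightarrow> bool" where
  "rare N \<delta> B \<equiv> \<exists>E \<in> sets N. B \<subseteq> E \<and> measure N E < \<delta>"

definition whp :: "(nat \<Rightarrow> 'a measure) \<Rightarrow> (nat \<Rightarrow> 'a \<Rightarrow> bool) \<Rightarrow> bool" where
  "whp M Q \<longleftrightarrow> (\<forall>\<delta>>0. \<forall>\<^sub>F n in sequentially. rare (M n) \<delta> {\<omega> \<in> space (M n). \<not> Q n \<omega>})"

lemma tendsto_in_prob_whp:
  "tendsto_in_prob M Y c \<longleftrightarrow> (\<forall>\<epsilon>>0. whp M (\<lambda>n \<omega>. \<bar>Y n \<omega> - c\<bar> \<le> \<epsilon>))"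
  by (simp add: tendsto_in_prob_def whp_def not_le)

lemma whp_mono:
  assumes "whp M Q" "\<forall>\<^sub>F n in sequentially. \<forall>\<omega>\<in>space (M n). Q n \<omega> \<longrightarrow> Q' n \<omega>"
  shows "whp M Q'"
  unfolding whp_def
proof (intro allI impI)
  fix \<delta> :: real assume "0 < \<delta>"
  then have "\<forall>\<^sub>F n in sequentially. rare (M n) \<delta> {\<omega> \<in> space (M n). \<not> Q n \<omega>}"
    using assms(1) unfolding whp_def by blast
  with assms(2) show "\<forall>\<^sub>F n in sequentially. rare (M n) \<delta> {\<omega> \<in> space (M n). \<not> Q' n \<omega>}"
    by eventually_elim blast
qed

lemma whp_conj:
  assumes "whp M Q" "whp M Q'"
  shows "whp M (\<lambda>n \<omega>. Q n \<omega> \<and> Q' n \<omega>)"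
  unfolding whp_def
proof (intro allI impI)
  fix \<delta> :: real assume "0 < \<delta>"
  then have "0 < \<delta> / 2" by simp
  then have "\<forall>\<^sub>F n in sequentially. rare (M n) (\<delta> / 2) {\<omega> \<in> space (M n). \<not> Q n \<omega>}"
    "\<forall>\<^sub>F n in sequentially. rare (M n) (\<delta> / 2) {\<omega> \<in> space (M n). \<not> Q' n \<omega>}"
    using assms unfolding whp_def by blast+
  then show "\<forall>\<^sub>F n in sequentially. rare (M n) \<delta> {\<omega> \<in> space (M n). \<not> (Q n \<omega> \<and> Q' n \<omega>)}"
  proof eventually_elim
    fix n
    assume "rare (M n) (\<delta> / 2) {\<omega> \<in> space (M n). \<not> Q n \<omega>}"
      and "rare (M n) (\<delta> / 2) {\<omega> \<in> space (M n). \<not> Q' n \<omega>}"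
    then obtain E E' where E: "E \<in> sets (M n)" "{\<omega> \<in> space (M n). \<not> Q n \<omega>} \<subseteq> E" "measure (M n) E < \<delta> / 2"
      and E': "E' \<in> sets (M n)" "{\<omega> \<in> space (M n). \<not> Q' n \<omega>} \<subseteq> E'" "measure (M n) E' < \<delta> / 2" by blast
    have "measure (M n) (E \<union> E') \<le> measure (M n) E + measure (M n) E'" using E E' by (intro measure_Un_le)
    then have "measure (M n) (E \<union> E') < \<delta>" using E(3) E'(3) by linarith
    moreover have "{\<omega> \<in> space (M n). \<not> (Q n \<omega> \<and> Q' n \<omega>)} \<subseteq> E \<union> E'" using E(2) E'(2) by blast
    ultimately show "rare (M n) \<delta> {\<omega> \<in> space (M n). \<not> (Q n \<omega> \<and> Q' n \<omega>)}"
      using E(1) E'(1) by blast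
  qed
qed

text \<open>With the other coordinates fixed, coordinate \<open>a\<close> would have to hit a single
  point modulo 1. This works because \<open>a\<close> differs from \<open>b\<close>,
  \<open>c\<close> and \<open>d\<close>, as in the definition of \<open>generic\<close>.\<close>

lemma emeasure_collision:
  assumes "a < n" "b < n" "c < n" "d < n" "a \<noteq> b" "a \<noteq> c" "a \<noteq> d"
  shows "emeasure (sample n) {s \<in> space (sample n). wrap (s a - (s c + s d - s b)) = 0} = 0"
    "{s \<in> space (sample n). wrap (s a - (s c + s d - s b)) = 0} \<in> sets (sample n)"
proof -
  interpret P: product_prob_space "\<lambda>_::nat. unit_law" UNIV by (simp add: prob_space_unit_law product_prob_spaceI)
  let ?E = "{s \<in> space (sample n). wrap (s a - (s c + s d - s b)) = 0}"
  have [measurable]: "(\<lambda>s. s a) \<in> borel_measurable (sample n)" "(\<lambda>s. s b) \<in> borel_measurable (sample n)"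
    "(\<lambda>s. s c) \<in> borel_measurable (sample n)" "(\<lambda>s. s d) \<in> borel_measurable (sample n)"
    using assms by (simp_all add: sample_component)
  have "Measurable.pred (sample n) (\<lambda>s. wrap (s a - (s c + s d - s b)) = 0)" by measurable
  then show E: "?E \<in> sets (sample n)" unfolding pred_def .
  define K where "K = {..<n} - {a}"
  have K: "finite K" "a \<notin> K" "{..<n} = insert a K" using assms by (auto simp: K_def)
  have "emeasure (sample n) ?E = (\<integral>\<^sup>+s. indicator ?E s \<partial>sample n)"
    using E by simp
  also have "\<dots> = (\<integral>\<^sup>+s. \<integral>\<^sup>+y. indicator ?E (s(a := y)) \<partial>unit_law \<partial>PiM K (\<lambda>_. unit_law))"
    unfolding K(3) by (rule P.product_nn_integral_insert[OF K(1,2)]) (use E in \<open>simp add: K(3)[symmetric]\<close>)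
  also have "\<dots> = (\<integral>\<^sup>+s. 0 \<partial>PiM K (\<lambda>_. unit_law))"
  proof (intro nn_integral_cong)
    fix s assume s: "s \<in> space (PiM K (\<lambda>_. unit_law))"
    let ?r = "s c + s d - s b"
    have "s(a := y) \<in> space (sample n)" for y
      using s unfolding K(3) by (auto simp: space_PiM PiE_iff extensional_def)
    then have "(\<integral>\<^sup>+y. indicator ?E (s(a := y)) \<partial>unit_law) = (\<integral>\<^sup>+y. indicator {y. wrap (y - ?r) \<in> {0}} y \<partial>unit_law)"
      using assms by (intro nn_integral_cong) (simp add: indicator_def)
    also have "\<dots> = emeasure unit_law {y. wrap (y - ?r) \<in> {0}}"
      by (rule nn_integral_indicator) (simp, measurable)
    also have "\<dots> = 0" by (subst emeasure_unit_law_wrap) auto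
    finally show "(\<integral>\<^sup>+y. indicator ?E (s(a := y)) \<partial>unit_law) = 0" .
  qed
  finally show "emeasure (sample n) ?E = 0" by simp
qed

lemma cis_eq_imp_wrap:
  assumes "cis (2 * pi * u) = cis (2 * pi * v)"
  shows "wrap (u - v) = 0"
proof (rule ccontr)
  assume "wrap (u - v) \<noteq> 0"
  then have "\<bar>wrap 0\<bar> < cdist u v" using wrap_id[of 0] by simp
  then have "cos (2 * pi * (u - v)) < cos (2 * pi * 0)" unfolding cos_less_iff_wrap .
  moreover have "cis (2 * pi * (u - v)) = 1"
    using assms by (simp add: right_diff_distrib flip: cis_divide)
  then have "cos (2 * pi * (u - v)) = 1" by (metis cis.sel(1) one_complex.sel(1))
  ultimately show False by simp
qed

lemma whp_generic: "whp sample (\<lambda>n s. generic n (\<lambda>i. cis (2 * pi * s i)))"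
  unfolding whp_def
proof (intro allI impI always_eventually)
  fix \<delta> :: real and n :: nat assume "0 < \<delta>"
  define I where "I = {(a, b, c, d). a < n \<and> b < n \<and> c < n \<and> d < n \<and> a \<noteq> b \<and> a \<noteq> c \<and> a \<noteq> d}"
  define A where "A = (\<lambda>(a, b, c, d). {s \<in> space (sample n). wrap (s a - (s c + s d - s b)) = 0})"
  have "I \<subseteq> {..<n} \<times> {..<n} \<times> {..<n} \<times> {..<n}" by (auto simp: I_def)
  then have fin: "finite I" by (rule finite_subset) simp
  have A: "A i \<in> null_sets (sample n)" if "i \<in> I" for i
    using that emeasure_collision by (auto simp: I_def A_def null_sets_def)
  then have "(\<Union>i\<in>I. A i) \<in> null_sets (sample n)" using fin by (intro null_sets.finite_UN) auto
  then have "(\<Union>i\<in>I. A i) \<in> sets (sample n)" "measure (sample n) (\<Union>i\<in>I. A i) < \<delta>"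
    using \<open>0 < \<delta>\<close> by (auto simp: null_sets_def measure_def)
  moreover have "{s \<in> space (sample n). \<not> generic n (\<lambda>i. cis (2 * pi * s i))} \<subseteq> (\<Union>i\<in>I. A i)"
  proof
    fix s assume s: "s \<in> {s \<in> space (sample n). \<not> generic n (\<lambda>i. cis (2 * pi * s i))}"
    then obtain a b c d where abcd: "(a, b, c, d) \<in> I"
      and eq: "cis (2 * pi * s a) * cis (2 * pi * s b) = cis (2 * pi * s c) * cis (2 * pi * s d)"
      by (auto simp: generic_def I_def)
    have "cis (2 * pi * (s a + s b)) = cis (2 * pi * (s c + s d))"
      using eq by (simp add: cis_mult distrib_left)
    from cis_eq_imp_wrap[OF this] have "wrap (s a - (s c + s d - s b)) = 0" by (simp add: algebra_simps)
    then have "s \<in> A (a, b, c, d)" using s by (simp add: A_def)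
    then show "s \<in> (\<Union>i\<in>I. A i)" using abcd by blast
  qed
  ultimately show "rare (sample n) \<delta> {s \<in> space (sample n). \<not> generic n (\<lambda>i. cis (2 * pi * s i))}"
    by blast
qed

section \<open>Samples without large gaps\<close>

definition cell :: "nat \<Rightarrow> real set" where
  "cell m = {real m / 16..<(real m + 1) / 16}"

text \<open>Every location then has a sample point within 1/16, so the cap 1/16 in
  \<open>mutual\<close> loses no mutual pair.\<close>

definition well_spread :: "nat \<Rightarrow> (nat \<Rightarrow> real) \<Rightarrow> bool" where
  "well_spread n s \<longleftrightarrow> (\<forall>m<16. \<exists>i<n. s i \<in> cell m)"

lemma well_spread_near:
  assumes "well_spread n s" "near n s t q"
  shows "cdist (s q) t \<le> 1/16"
proof -
  define f where "f = frac t"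
  define m where "m = nat \<lfloor>16 * f\<rfloor>"
  have f: "0 \<le> f" "f < 1" by (simp_all add: f_def frac_lt_1)
  have m: "real m \<le> 16 * f" "16 * f < real m + 1" unfolding m_def using f by linarith+
  then have "m < 16" using f by linarith
  then obtain i where i: "i < n" "s i \<in> cell m" using assms(1) by (auto simp: well_spread_def)
  have "cdist (s i) t \<le> \<bar>s i - t - of_int (- \<lfloor>t\<rfloor>)\<bar>" by (rule abs_wrap_le)
  also have "s i - t - of_int (- \<lfloor>t\<rfloor>) = s i - f" by (simp add: f_def frac_def)
  also have "\<bar>s i - f\<bar> \<le> 1/16"
  proof -
    have "real m / 16 \<le> s i" "s i < (real m + 1) / 16" using i(2) by (simp_all only: cell_def atLeastLessThan_iff)
    then have "real m \<le> 16 * s i" "16 * s i < real m + 1" by (simp_all add: field_simps)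
    then have "s i - f \<le> 1/16" "- (s i - f) \<le> 1/16" using m by linarith+
    then show ?thesis by (rule abs_leI)
  qed
  finally have "cdist (s i) t \<le> 1/16" .
  moreover have "cdist (s q) t \<le> cdist (s i) t"
    using assms(2) i(1) unfolding near_def by (cases "i = q") auto
  ultimately show ?thesis by linarith
qed

lemma measure_avoid_cell:
  assumes "m < 16"
  shows "measure (sample n) (PiE {..<n} (\<lambda>_. - cell m)) = (15/16) ^ n"
proof -
  interpret prob_space unit_law by (rule prob_space_unit_law)
  interpret P: product_prob_space "\<lambda>_::nat. unit_law" "{..<n}" by (simp add: prob_space_unit_law product_prob_spaceI)
  have c: "cell m \<in> sets borel" by (simp add: cell_def)
  have "prob (cell m) = measure lborel ({0..<1} \<inter> cell m) / measure lborel {0..<1::real}"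
    unfolding unit_law_def using c by (intro measure_uniform_measure) simp_all
  also have "{0..<1} \<inter> cell m = {real m / 16..<(real m + 1) / 16}"
    using assms by (auto simp: cell_def)
  finally have "prob (cell m) = 1/16" by (simp add: field_simps)
  moreover have "prob (space unit_law - cell m) = 1 - prob (cell m)" by (rule prob_compl) (simp add: c)
  ultimately have "prob (- cell m) = 15/16" by (simp add: Compl_eq_Diff_UNIV)
  then have "emeasure unit_law (- cell m) = ennreal (15/16)" by (simp add: emeasure_eq_measure)
  moreover have "emeasure (sample n) (PiE {..<n} (\<lambda>_. - cell m)) = (\<Prod>i<n. emeasure unit_law (- cell m))"
    using c by (intro P.emeasure_PiM) auto
  ultimately have "emeasure (sample n) (PiE {..<n} (\<lambda>_. - cell m)) = ennreal ((15/16) ^ n)"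
    by (simp only: prod_constant card_lessThan ennreal_power[of "15/16"] divide_nonneg_pos zero_le_numeral zero_less_numeral)
  then show ?thesis by (simp add: measure_def)
qed

lemma whp_well_spread: "whp sample well_spread"
  unfolding whp_def
proof (intro allI impI)
  fix \<delta> :: real assume "0 < \<delta>"
  have "(\<lambda>n. 16 * (15/16 :: real) ^ n) \<longlonglongrightarrow> 0" by real_asymp
  then have "\<forall>\<^sub>F n in sequentially. 16 * (15/16) ^ n < \<delta>"
    using \<open>0 < \<delta>\<close> by (intro order_tendstoD(2))
  then show "\<forall>\<^sub>F n in sequentially. rare (sample n) \<delta> {s \<in> space (sample n). \<not> well_spread n s}"
  proof eventually_elim
    fix n assume n: "16 * (15/16) ^ n < \<delta>"
    define B where "B m = PiE {..<n} (\<lambda>_. - cell m)" for m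
    have B: "B m \<in> sets (sample n)" for m
      unfolding B_def by (intro sets_PiM_I_finite) (auto simp: cell_def)
    have "measure (sample n) (\<Union>m<16. B m) \<le> (\<Sum>m<16. measure (sample n) (B m))"
      using B by (intro measure_UNION_le) auto
    also have "\<dots> = (\<Sum>m<(16::nat). (15/16) ^ n)"
      unfolding B_def by (intro sum.cong refl measure_avoid_cell) simp
    finally have "measure (sample n) (\<Union>m<16. B m) < \<delta>" using n by simp
    moreover have "{s \<in> space (sample n). \<not> well_spread n s} \<subseteq> (\<Union>m<16. B m)"
    proof
      fix s assume s: "s \<in> {s \<in> space (sample n). \<not> well_spread n s}"
      then obtain m where "m < 16" "\<forall>i<n. s i \<notin> cell m" by (auto simp: well_spread_def)
      then have "s \<in> B m" using s by (simp add: B_def space_PiM PiE_iff)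
      then show "s \<in> (\<Union>m<16. B m)" using \<open>m < 16\<close> by blast
    qed
    moreover have "(\<Union>m<16. B m) \<in> sets (sample n)" using B by auto
    ultimately show "rare (sample n) \<delta> {s \<in> space (sample n). \<not> well_spread n s}"
      by blast
  qed
qed

lemma generic_config_cis:
  assumes "3 \<le> n" "generic n (\<lambda>i. cis (2 * pi * s i))"
  shows "generic_config n (\<lambda>i. cis (2 * pi * s i))"
proof unfold_locales
  let ?x = "\<lambda>i. cis (2 * pi * s i)"
  show "inj_on ?x {..<n}"
  proof (rule inj_onI, rule ccontr)
    fix i j assume "i \<in> {..<n}" "j \<in> {..<n}" "?x i = ?x j" "i \<noteq> j"
    then show False using genericD[OF assms(2), of i j j j] by simp
  qed
qed (use assms in auto)

text \<open>Bundling all seven estimates allows a single transfer from angles to points on the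
  circle.\<close>

definition fractions_within :: "real \<Rightarrow> nat \<Rightarrow> (nat \<Rightarrow> complex) \<Rightarrow> bool" where
  "fractions_within e n x \<longleftrightarrow>
    \<bar>number_fraction 0 n x - 1/4\<bar> \<le> e \<and> \<bar>number_fraction 1 n x - 1/2\<bar> \<le> e \<and>
    \<bar>number_fraction 2 n x - 1/4\<bar> \<le> e \<and> \<bar>length_fraction 0 n x - 1/8\<bar> \<le> e \<and>
    \<bar>length_fraction 1 n x - 1/2\<bar> \<le> e \<and> \<bar>length_fraction 2 n x - 3/8\<bar> \<le> e \<and>
    \<bar>empty_length_fraction n x - 3/8\<bar> \<le> e"

section \<open>Comparison of the fractions with the concentrated functionals\<close>

context
  fixes n :: nat and s :: "nat \<Rightarrow> real"
  assumes n: "3 \<le> n" and gen: "generic n (\<lambda>i. cis (2 * pi * s i))"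
begin

interpretation generic_config n "\<lambda>i. cis (2 * pi * s i)"
  using n gen by (rule generic_config_cis)

lemma in_sector_iff: "cis (2 * pi * t) \<in> sector n (\<lambda>i. cis (2 * pi * s i)) p q \<longleftrightarrow> near n s t p \<and> near n s (t + 1/2) q"
  unfolding sector_def mem_Collect_eq uminus_cis near_nearest ..

lemma far_iff: "p < n \<Longrightarrow> far p = q \<longleftrightarrow> near n s (s p + 1/2) q"
  using nearest_antipode_iff[of p q] unfolding uminus_cis near_nearest by simp

lemma local_length_le: "local_length a b w n s \<le> class_length a b"
proof -
  have "local_length a b w n s = measure lborel ({0..<1} \<inter> {t. local_class a b w n s t}) / measure lborel {0..<1::real}"
    unfolding local_length_def unit_law_def using sets_local_class by (intro measure_uniform_measure) simp_all
  also have "\<dots> = measure lborel ({0..<1} \<inter> {t. local_class a b w n s t})" by simp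
  also have "\<dots> \<le> class_length a b"
  proof (rule measure_mono_fmeasurable)
    show "{0..<1} \<inter> {t. local_class a b w n s t} \<subseteq> class_set a b"
    proof
      fix t assume t: "t \<in> {0..<1} \<inter> {t. local_class a b w n s t}"
      then obtain p q where pq: "p < n" "q < n" "pair_class a b w n s t p q" by (auto simp: local_class_def)
      then have "cis (2 * pi * t) \<in> sector n (\<lambda>i. cis (2 * pi * s i)) p q" "(far p = q) = a" "(far q = p) = b"
        by (simp_all add: pair_class_def in_sector_iff far_iff)
      then show "t \<in> class_set a b" using t unfolding class_set_def by blast
    qed
    show "{0..<1} \<inter> {t. local_class a b w n s t} \<in> sets lborel" using sets_local_class[of a b w n s] by simp
    show "class_set a b \<in> fmeasurable lborel" by (rule class_set_fmeasurable)
  qed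
  finally show ?thesis .
qed

lemma mutual_fraction_eq:
  assumes "well_spread n s"
  shows "real mutual_count / real n = mutual_fraction (1/16) n s"
proof -
  have "p < n \<and> far (far p) = p \<longleftrightarrow> (\<exists>q. mutual (1/16) n s p q)" for p
  proof
    assume p: "p < n \<and> far (far p) = p"
    then have "near n s (s p + 1/2) (far p)" "near n s (s (far p) + 1/2) p"
      using far_iff[of p "far p"] far_iff[of "far p" p] far_less[of p] by auto
    then show "\<exists>q. mutual (1/16) n s p q"
      using well_spread_near[OF assms] unfolding mutual_def by blast
  next
    assume "\<exists>q. mutual (1/16) n s p q"
    then obtain q where q: "mutual (1/16) n s p q" by blast
    then have "p < n" "q < n" using mutual_less by blast+
    then show "p < n \<and> far (far p) = p" using q far_iff[of p q] far_iff[of q p] by (simp add: mutual_def)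
  qed
  then show ?thesis by (simp add: mutual_count_def mutual_fraction_def)
qed

text \<open>Lower bounds with error \<open>e\<close> on four lengths whose limits add up to 1,
  combined with \<open>class_length_sum\<close>, give upper bounds with error \<open>3 * e\<close>.
  The factor 6 leaves room.\<close>

lemma fractions_close:
  assumes L: "\<And>a b. \<bar>local_length a b w n s - class_limit a b\<bar> \<le> e"
    and F: "\<bar>mutual_fraction (1/16) n s - 1/2\<bar> \<le> e" and sp: "well_spread n s"
  shows "fractions_within (6 * e) n (\<lambda>i. cis (2 * pi * s i))"
proof -
  have half: "real mutual_count / real (2 * n) = mutual_fraction (1/16) n s / 2"
    using mutual_fraction_eq[OF sp] by simp
  have lower: "class_limit a b - e \<le> class_length a b" for a b
    using L[of a b] local_length_le[of a b w] by linarith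
  have "1/8 - e \<le> class_length False False" "1/4 - e \<le> class_length False True"
    "1/4 - e \<le> class_length True False" "3/8 - e \<le> class_length True True"
    using lower[of False False] lower[of False True] lower[of True False] lower[of True True]
    by (simp_all add: class_limit_def)
  then show ?thesis
    unfolding fractions_within_def number_fractions half mutual_fraction_eq[OF sp] length_fractions
    using class_length_sum F by (intro conjI; linarith)
qed

end

lemma whp_fractions:
  assumes \<epsilon>: "0 < \<epsilon>"
  shows "whp sample (\<lambda>n s. fractions_within \<epsilon> n (\<lambda>i. cis (2 * pi * s i)))"
proof -
  define e where "e = \<epsilon> / 6"
  have e: "0 < e" "6 * e = \<epsilon>" using \<epsilon> by (simp_all add: e_def)
  have L: "whp sample (\<lambda>n s. \<bar>local_length a b (window n) n s - class_limit a b\<bar> \<le> e)" for a b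
    using local_length_tendsto[of a b] e(1) unfolding tendsto_in_prob_whp by blast
  have F: "whp sample (\<lambda>n s. \<bar>mutual_fraction (1/16) n s - 1/2\<bar> \<le> e)"
    using mutual_fraction_tendsto e(1) unfolding tendsto_in_prob_whp by blast
  note all = whp_conj[OF L[of False False] whp_conj[OF L[of False True] whp_conj[OF L[of True False]
    whp_conj[OF L[of True True] whp_conj[OF F whp_conj[OF whp_generic whp_well_spread]]]]]]
  show ?thesis
  proof (rule whp_mono[OF all], use eventually_ge_at_top[of 3] in eventually_elim, intro ballI impI)
    fix n s assume n: "3 \<le> n" and *: "\<bar>local_length False False (window n) n s - class_limit False False\<bar> \<le> e \<and>
      \<bar>local_length False True (window n) n s - class_limit False True\<bar> \<le> e \<and>
      \<bar>local_length True False (window n) n s - class_limit True False\<bar> \<le> e \<and>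
      \<bar>local_length True True (window n) n s - class_limit True True\<bar> \<le> e \<and>
      \<bar>mutual_fraction (1/16) n s - 1/2\<bar> \<le> e \<and> generic n (\<lambda>i. cis (2 * pi * s i)) \<and> well_spread n s"
    then have l: "\<bar>local_length a b (window n) n s - class_limit a b\<bar> \<le> e" for a b by (cases a; cases b) simp_all
    have "\<bar>mutual_fraction (1/16) n s - 1/2\<bar> \<le> e" "generic n (\<lambda>i. cis (2 * pi * s i))" "well_spread n s"
      using * by blast+
    from fractions_close[OF n this(2) l this(1,3)]
    show "fractions_within \<epsilon> n (\<lambda>i. cis (2 * pi * s i))" unfolding e(2) .
  qed
qed

section \<open>Transfer to points on the circle\<close>

text \<open>\<open>Arg2pi\<close> is continuous off the nonnegative reals and vanishes on them, so
  masking this closed ray with an indicator returns the same function.\<close>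

lemma measurable_Arg2pi: "Arg2pi \<in> borel_measurable borel"
proof -
  let ?S = "\<real>\<^sub>\<ge>\<^sub>0 :: complex set"
  have "(\<lambda>z. indicator (- ?S) z *\<^sub>R Arg2pi z) \<in> borel_measurable borel"
  proof (rule borel_measurable_continuous_on_indicator)
    show "- ?S \<in> sets borel" using closed_nonneg_Reals_complex by (intro borel_comp borel_closed)
    show "continuous_on (- ?S) Arg2pi"
      by (intro continuous_at_imp_continuous_on ballI continuous_at_Arg2pi) simp
  qed
  moreover have "(\<lambda>z. indicator (- ?S) z *\<^sub>R Arg2pi z) = Arg2pi"
  proof
    fix z
    show "indicator (- ?S) z *\<^sub>R Arg2pi z = Arg2pi z"
      using Arg2pi_eq_0[of z] by (auto simp: indicator_def complex_nonneg_Reals_iff complex_is_Real_iff)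
  qed
  ultimately show ?thesis by simp
qed

definition angle :: "complex \<Rightarrow> real" where
  "angle z = Arg2pi z / (2 * pi)"

lemma measurable_angle[measurable]: "angle \<in> borel_measurable borel"
  using measurable_Arg2pi unfolding angle_def[abs_def] by measurable

lemma cis_angle: "norm z = 1 \<Longrightarrow> cis (2 * pi * angle z) = z"
  using Arg2pi_eq[of z] by (simp add: angle_def cis_conv_exp)

lemma angle_cis:
  assumes "0 \<le> t" "t < 1"
  shows "angle (cis (2 * pi * t)) = t"
proof -
  have "Arg2pi (cis (2 * pi * t)) = 2 * pi * t"
    by (rule Arg2pi_unique[where r=1]) (use assms in \<open>auto simp: cis_conv_exp\<close>)
  then show ?thesis by (simp add: angle_def)
qed

lemma measurable_cis_turn: "(\<lambda>t. cis (2 * pi * t)) \<in> borel_measurable borel"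
  by (intro borel_measurable_continuous_onI continuous_intros)

lemma measurable_cis_turn_unit_law: "(\<lambda>t. cis (2 * pi * t)) \<in> borel_measurable unit_law"
  unfolding measurable_cong_sets[OF sets_unit_law refl] by (rule measurable_cis_turn)

lemma uniform_circle_eq: "uniform_circle = distr unit_law borel (\<lambda>t. cis (2 * pi * t))"
  by (simp add: uniform_circle_def unit_law_def)

text \<open>\<open>angle\<close> inverts the parametrisation of the circle on
  \<open>{0..<1}\<close>, a set of full measure.\<close>

lemma distr_angle: "distr uniform_circle borel angle = unit_law"
proof (rule measure_eqI)
  fix A assume "A \<in> sets (distr uniform_circle borel angle)"
  then have A[measurable]: "A \<in> sets borel" by simp
  have [measurable]: "(\<lambda>t. cis (2 * pi * t)) \<in> borel_measurable unit_law" by (rule measurable_cis_turn_unit_law)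
  have "emeasure (distr uniform_circle borel angle) A = emeasure unit_law ((\<lambda>t. cis (2 * pi * t)) -` (angle -` A))"
    by (simp add: uniform_circle_eq emeasure_distr measurable_sets_borel[OF measurable_angle])
  also have "\<dots> = emeasure unit_law A"
  proof (rule emeasure_eq_AE)
    have "AE t in unit_law. t \<in> {0..<1}"
      unfolding unit_law_def by (rule AE_uniform_measureI) auto
    then show "AE t in unit_law. t \<in> (\<lambda>t. cis (2 * pi * t)) -` (angle -` A) \<longleftrightarrow> t \<in> A"
      by eventually_elim (simp add: angle_cis)
    show "(\<lambda>t. cis (2 * pi * t)) -` (angle -` A) \<in> sets unit_law"
      using measurable_sets_borel[OF measurable_cis_turn measurable_sets_borel[OF measurable_angle A]] by simp
  qed simp
  finally show "emeasure (distr uniform_circle borel angle) A = emeasure unit_law A" .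
qed simp

text \<open>The restriction to \<open>{..<n}\<close> places the values in the extensional product
  space underlying \<open>sample n\<close>.\<close>

definition angles :: "nat \<Rightarrow> (nat \<Rightarrow> 'a \<Rightarrow> complex) \<Rightarrow> 'a \<Rightarrow> nat \<Rightarrow> real" where
  "angles n X \<omega> = (\<lambda>i\<in>{..<n}. angle (X i \<omega>))"

text \<open>Independence makes the joint law of the angles a product. The random points lie on the
  unit circle only almost surely, and off it the angle does not determine the point; hence the null
  set.\<close>

lemma indep_uniform_circle_angles:
  assumes N: "prob_space N" and n: "0 < n"
    and indep: "prob_space.indep_vars N (\<lambda>_. borel) X {..<n}"
    and unif: "\<And>i. i < n \<Longrightarrow> distr N borel (X i) = uniform_circle"
  shows "angles n X \<in> measurable N (sample n)" "distr N (sample n) (angles n X) = sample n"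
    "{\<omega> \<in> space N. \<exists>i<n. norm (X i \<omega>) \<noteq> 1} \<in> null_sets N"
proof -
  interpret prob_space N by fact
  have X[measurable]: "X i \<in> borel_measurable N" if "i < n" for i
    using indep that unfolding indep_vars_def by simp
  have sets: "sets (PiM {..<n} (\<lambda>_. borel :: real measure)) = sets (sample n)"
    by (rule sets_PiM_cong) simp_all
  have "angles n X \<in> measurable N (PiM {..<n} (\<lambda>_. borel))"
    unfolding angles_def[abs_def] by (rule measurable_restrict) (use X in measurable)
  then show "angles n X \<in> measurable N (sample n)" unfolding measurable_cong_sets[OF refl sets] .
  have "indep_vars (\<lambda>_. borel) (\<lambda>i \<omega>. angle (X i \<omega>)) {..<n}"
    by (rule indep_vars_compose2[OF indep]) simp
  moreover have "indep_vars (\<lambda>_. borel) (\<lambda>i \<omega>. angle (X i \<omega>)) {..<n} \<longleftrightarrow>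
      distr N (PiM {..<n} (\<lambda>_. borel)) (\<lambda>\<omega>. \<lambda>i\<in>{..<n}. angle (X i \<omega>)) = PiM {..<n} (\<lambda>i. distr N borel (\<lambda>\<omega>. angle (X i \<omega>)))"
    using n X by (intro indep_vars_iff_distr_eq_PiM') (auto simp: lessThan_empty_iff)
  ultimately have "distr N (PiM {..<n} (\<lambda>_. borel)) (angles n X) = PiM {..<n} (\<lambda>i. distr N borel (\<lambda>\<omega>. angle (X i \<omega>)))"
    unfolding angles_def[abs_def] by blast
  also have "\<dots> = sample n"
  proof (rule PiM_cong[OF refl])
    fix i assume "i \<in> {..<n}"
    then have "distr N borel (\<lambda>\<omega>. angle (X i \<omega>)) = distr (distr N borel (X i)) borel angle"
      using X by (subst distr_distr) (auto simp: comp_def)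
    then show "distr N borel (\<lambda>\<omega>. angle (X i \<omega>)) = unit_law"
      using unif \<open>i \<in> {..<n}\<close> by (simp add: distr_angle)
  qed
  finally show "distr N (sample n) (angles n X) = sample n"
    using distr_cong[OF refl sets, of N "angles n X" "angles n X"] by simp
  have "{\<omega> \<in> space N. norm (X i \<omega>) \<noteq> 1} \<in> null_sets N" if i: "i < n" for i
  proof -
    have C: "{z :: complex. norm z \<noteq> 1} \<in> sets borel" by measurable
    have "emeasure N {\<omega> \<in> space N. norm (X i \<omega>) \<noteq> 1} = emeasure (distr N borel (X i)) {z. norm z \<noteq> 1}"
      using X[OF i] C by (subst emeasure_distr) (auto intro!: arg_cong[where f="emeasure N"])
    also have "\<dots> = emeasure unit_law ((\<lambda>t. cis (2 * pi * t)) -` {z. norm z \<noteq> 1} \<inter> space unit_law)"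
      unfolding unif[OF i] uniform_circle_eq using C by (subst emeasure_distr) (auto simp: measurable_cis_turn_unit_law)
    also have "(\<lambda>t. cis (2 * pi * t)) -` {z. norm z \<noteq> 1} \<inter> space unit_law = {}" by auto
    finally have "emeasure N {\<omega> \<in> space N. norm (X i \<omega>) \<noteq> 1} = 0" by simp
    moreover have "{\<omega> \<in> space N. norm (X i \<omega>) \<noteq> 1} \<in> sets N" using X[OF i] by measurable
    ultimately show ?thesis by (simp add: null_sets_def)
  qed
  then have "(\<Union>i\<in>{..<n}. {\<omega> \<in> space N. norm (X i \<omega>) \<noteq> 1}) \<in> null_sets N"
    by (intro null_sets.finite_UN) auto
  moreover have "(\<Union>i\<in>{..<n}. {\<omega> \<in> space N. norm (X i \<omega>) \<noteq> 1}) = {\<omega> \<in> space N. \<exists>i<n. norm (X i \<omega>) \<noteq> 1}" by blast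
  ultimately show "{\<omega> \<in> space N. \<exists>i<n. norm (X i \<omega>) \<noteq> 1} \<in> null_sets N" by simp
qed

section \<open>Dependence on the first \<open>n\<close> points only\<close>

lemma regions_cong: "(\<And>i. i < n \<Longrightarrow> x i = x' i) \<Longrightarrow> regions n x = regions n x'"
proof -
  assume "\<And>i. i < n \<Longrightarrow> x i = x' i"
  then have "map x [0..<n] = map x' [0..<n]" by simp
  then show ?thesis by (simp only: regions_def cyclic_label_def)
qed

lemma region_type_cong: "(\<And>i. i < n \<Longrightarrow> x i = x' i) \<Longrightarrow> region_type n x = region_type n x'"
  unfolding region_type_def by (intro ext arg_cong[where f=card]) auto

lemma empty_region_cong: "(\<And>i. i < n \<Longrightarrow> x i = x' i) \<Longrightarrow> empty_region n x = empty_region n x'"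
  unfolding empty_region_def by (intro ext) auto

lemma fractions_cong:
  assumes "\<And>i. i < n \<Longrightarrow> x i = x' i"
  shows "number_fraction k n x = number_fraction k n x'" "length_fraction k n x = length_fraction k n x'"
    "empty_length_fraction n x = empty_length_fraction n x'"
proof -
  note c = regions_cong[of n x x', OF assms] region_type_cong[of n x x', OF assms] empty_region_cong[of n x x', OF assms]
  show "number_fraction k n x = number_fraction k n x'" "length_fraction k n x = length_fraction k n x'"
    "empty_length_fraction n x = empty_length_fraction n x'"
    by (simp_all add: number_fraction_def length_fraction_def empty_length_fraction_def c)
qed

text \<open>The covering event is pulled back along \<open>angles\<close>, and the null set of
  samples leaving the circle is added to it. The points rebuilt from the angles agree with
  \<open>X n\<close> only for indices below \<open>n\<close>, which is why \<open>cong\<close> is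
  assumed.\<close>

lemma whp_transfer:
  fixes M :: "nat \<Rightarrow> 'a measure" and X :: "nat \<Rightarrow> nat \<Rightarrow> 'a \<Rightarrow> complex"
  assumes prob: "\<And>n. n \<ge> 3 \<Longrightarrow> prob_space (M n)"
    and indep: "\<And>n. n \<ge> 3 \<Longrightarrow> prob_space.indep_vars (M n) (\<lambda>_. borel) (X n) {..<n}"
    and unif: "\<And>n i. n \<ge> 3 \<Longrightarrow> i < n \<Longrightarrow> distr (M n) borel (X n i) = uniform_circle"
    and Q: "whp sample (\<lambda>n s. Q n (\<lambda>i. cis (2 * pi * s i)))"
    and cong: "\<And>n x x'. (\<And>i. i < n \<Longrightarrow> x i = x' i) \<Longrightarrow> Q n x \<longleftrightarrow> Q n x'"
  shows "whp M (\<lambda>n \<omega>. Q n (\<lambda>i. X n i \<omega>))"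
  unfolding whp_def
proof (intro allI impI)
  fix \<delta> :: real assume "0 < \<delta>"
  then have "\<forall>\<^sub>F n in sequentially. rare (sample n) \<delta> {s \<in> space (sample n). \<not> Q n (\<lambda>i. cis (2 * pi * s i))}"
    using Q unfolding whp_def by blast
  then show "\<forall>\<^sub>F n in sequentially. rare (M n) \<delta> {\<omega> \<in> space (M n). \<not> Q n (\<lambda>i. X n i \<omega>)}"
    using eventually_ge_at_top[of 3]
  proof eventually_elim
    fix n :: nat
    assume "rare (sample n) \<delta> {s \<in> space (sample n). \<not> Q n (\<lambda>i. cis (2 * pi * s i))}"
      and n: "3 \<le> n"
    then obtain E where E: "E \<in> sets (sample n)" "measure (sample n) E < \<delta>"
      and sub: "{s \<in> space (sample n). \<not> Q n (\<lambda>i. cis (2 * pi * s i))} \<subseteq> E" by blast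
    have "0 < n" using n by simp
    note law = indep_uniform_circle_angles[OF prob[OF n] this indep[OF n] unif[OF n]]
    let ?N = "{\<omega> \<in> space (M n). \<exists>i<n. norm (X n i \<omega>) \<noteq> 1}"
    let ?A = "angles n (X n) -` E \<inter> space (M n)"
    have A: "?A \<in> sets (M n)" using law(1) E(1) by (rule measurable_sets)
    have "measure (M n) (?A \<union> ?N) \<le> measure (M n) ?A + measure (M n) ?N"
      by (rule measure_Un_le[OF A null_setsD2[OF law(3)]])
    also have "measure (M n) ?N = 0" by (rule measure_eq_0_null_sets[OF law(3)])
    also have "measure (M n) ?A = measure (distr (M n) (sample n) (angles n (X n))) E"
      by (rule measure_distr[OF law(1) E(1), symmetric])
    also have "\<dots> = measure (sample n) E" by (simp only: law(2))
    finally have "measure (M n) (?A \<union> ?N) < \<delta>" using E(2) by simp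
    moreover have "{\<omega> \<in> space (M n). \<not> Q n (\<lambda>i. X n i \<omega>)} \<subseteq> ?A \<union> ?N"
    proof
      fix \<omega> assume \<omega>: "\<omega> \<in> {\<omega> \<in> space (M n). \<not> Q n (\<lambda>i. X n i \<omega>)}"
      then have \<omega>': "\<omega> \<in> space (M n)" "\<not> Q n (\<lambda>i. X n i \<omega>)" by blast+
      show "\<omega> \<in> ?A \<union> ?N"
      proof (cases "\<omega> \<in> ?N")
        case False
        then have "X n i \<omega> = cis (2 * pi * angles n (X n) \<omega> i)" if "i < n" for i
          using \<omega>'(1) that cis_angle[of "X n i \<omega>"] by (simp add: angles_def)
        then have "Q n (\<lambda>i. X n i \<omega>) \<longleftrightarrow> Q n (\<lambda>i. cis (2 * pi * angles n (X n) \<omega> i))" by (rule cong)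
        then have "\<not> Q n (\<lambda>i. cis (2 * pi * angles n (X n) \<omega> i))" using \<omega>'(2) by blast
        moreover have "angles n (X n) \<omega> \<in> space (sample n)"
          by (rule measurable_space[OF law(1) \<omega>'(1)])
        ultimately have "angles n (X n) \<omega> \<in> E" using sub by blast
        then show ?thesis using \<omega>'(1) by blast
      qed blast
    qed
    moreover have "?A \<union> ?N \<in> sets (M n)" by (rule sets.Un[OF A null_setsD2[OF law(3)]])
    ultimately show "rare (M n) \<delta> {\<omega> \<in> space (M n). \<not> Q n (\<lambda>i. X n i \<omega>)}"
      by blast
  qed
qed

theorem corollary10:
  fixes M :: "nat \<Rightarrow> 'a measure" and X :: "nat \<Rightarrow> nat \<Rightarrow> 'a \<Rightarrow> complex"
  assumes prob: "\<And>n. n \<ge> 3 \<Longrightarrow> prob_space (M n)"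
    and indep: "\<And>n. n \<ge> 3 \<Longrightarrow> prob_space.indep_vars (M n) (\<lambda>_. borel) (X n) {..<n}"
    and unif: "\<And>n i. n \<ge> 3 \<Longrightarrow> i < n \<Longrightarrow> distr (M n) borel (X n i) = uniform_circle"
  shows "(tendsto_in_prob M (\<lambda>n \<omega>. number_fraction 0 n (\<lambda>i. X n i \<omega>)) (1/4) \<and>
          tendsto_in_prob M (\<lambda>n \<omega>. number_fraction 1 n (\<lambda>i. X n i \<omega>)) (1/2) \<and>
          tendsto_in_prob M (\<lambda>n \<omega>. number_fraction 2 n (\<lambda>i. X n i \<omega>)) (1/4)) \<and>
         (tendsto_in_prob M (\<lambda>n \<omega>. length_fraction 0 n (\<lambda>i. X n i \<omega>)) (1/8) \<and>
          tendsto_in_prob M (\<lambda>n \<omega>. length_fraction 1 n (\<lambda>i. X n i \<omega>)) (1/2) \<and>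
          tendsto_in_prob M (\<lambda>n \<omega>. length_fraction 2 n (\<lambda>i. X n i \<omega>)) (3/8)) \<and>
         tendsto_in_prob M (\<lambda>n \<omega>. empty_length_fraction n (\<lambda>i. X n i \<omega>)) (3/8)"
proof -
  have whp: "whp M (\<lambda>n \<omega>. fractions_within \<epsilon> n (\<lambda>i. X n i \<omega>))" if "0 < \<epsilon>" for \<epsilon>
  proof (rule whp_transfer[OF prob indep unif whp_fractions[OF that]])
    show "fractions_within \<epsilon> n x \<longleftrightarrow> fractions_within \<epsilon> n x'" if "\<And>i. i < n \<Longrightarrow> x i = x' i" for n x x'
      unfolding fractions_within_def by (simp only: fractions_cong[of n x x', OF that])
  qed
  have "tendsto_in_prob M (\<lambda>n \<omega>. Y n (\<lambda>i. X n i \<omega>)) c"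
    if "\<And>\<epsilon> n x. fractions_within \<epsilon> n x \<Longrightarrow> \<bar>Y n x - c\<bar> \<le> \<epsilon>" for Y :: "nat \<Rightarrow> (nat \<Rightarrow> complex) \<Rightarrow> real" and c
    unfolding tendsto_in_prob_whp
  proof (intro allI impI)
    fix \<epsilon> :: real assume "0 < \<epsilon>"
    show "whp M (\<lambda>n \<omega>. \<bar>Y n (\<lambda>i. X n i \<omega>) - c\<bar> \<le> \<epsilon>)"
      by (rule whp_mono[OF whp[OF \<open>0 < \<epsilon>\<close>]], rule always_eventually) (use that in blast)
  qed
  from this[of "number_fraction 0" "1/4"] this[of "number_fraction 1" "1/2"] this[of "number_fraction 2" "1/4"]
    this[of "length_fraction 0" "1/8"] this[of "length_fraction 1" "1/2"] this[of "length_fraction 2" "3/8"]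
    this[of empty_length_fraction "3/8"]
  show ?thesis unfolding fractions_within_def by blast
qed

end
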